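(* Let $B\subset X$ be a ball such that $X\setminus\overline{2B}$ is nonempty and let $E\subset B$. Then the following are equivalent. (1) $\mathrm{Cap}_1(E)=0$; (2) $\mathrm{Cap}_{\mathrm{BV},\mathrm{O}}(E)=0$; (3) $\mathrm{Cap}_1(E,2B)=0$; (4) $\mathrm{Cap}_{\mathrm{BV},\mathrm{O}}(E,2B)=0$; (5) $\mathrm{cap}_1(E,2B)=0$; (6) $\mathrm{cap}_{\mathrm{BV},\mathrm{O}}(E,2B)=0$; (7) $\mathcal{H}(E)=0$.
   Context: Standing assumptions: $X=(X,d,\mu)$ is a complete metric space with a Borel regular outer measure $\mu$, $0<\mu(B)<\infty$ for all balls $B$, which is doubling: there is a constant $C_D$ with $\mu(2B)\le C_D\mu(B)$ for all balls $B$. Moreover $X$ supports a weak $(1,1)$-Poincaré inequality: there are constants $C_P>0$, $\tau\ge 1$ such that for all balls $B(x,r)$, all locally integrable $u$ on $X$ and all $1$-weak upper gradients $g$ of $u$, $$\frac{1}{\mu(B(x,r))}\int_{B(x,r)}|u-u_{B(x,r)}|\,d\mu\le C_P\,r\,\frac{1}{\mu(B(x,\tau r))}\int_{B(x,\tau r)}g\,d\mu,$$ where $u_{B(x,r)}=\frac{1}{\mu(B(x,r))}\int_{B(x,r)}u\,d\mu$. Balls are open; for $B=B(x,r)$, $2B=B(x,2r)$. Paths and upper gradients: A path is a rectifiable nonconstant continuous mapping from a compact interval to $X$. A nonnegative Borel function $g$ on an open set $\Omega$ is an upper gradient of an extended real valued function $u$ on $\Omega$ if for all paths $\gamma$ in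 $\Omega$ with endpoints $x,y$: $|u(x)-u(y)|\le\int_\gamma g\,ds$ whenever $u(x),u(y)$ are both finite, and $\int_\gamma g\,ds=\infty$ otherwise. The $1$-modulus of a collection $\Gamma$ of paths in $\Omega$ is $\inf_\varrho\int_\Omega\varrho\,d\mu$, over all nonnegative Borel $\varrho$ with $\int_\gamma\varrho\,ds\ge1$ for every $\gamma\in\Gamma$. A nonnegative measurable $g$ is a $1$-weak upper gradient of $u$ if the upper gradient inequality holds (with $\int_\gamma g\,ds$ well defined) for all paths outside a family of zero $1$-modulus. Function spaces: for $\Omega\subset X$ open, $N^{1,1}(\Omega)$ consists of the (pointwise defined) $u\in L^1(\Omega)$ with $\|u\|_{N^{1,1}(\Omega)}=\int_\Omega|u|\,d\mu+\inf_g\int_\Omega g\,d\mu<\infty$, the infimum over $1$-weak upper gradients $g$ of $u$ (functions identified when the norm of their difference is $0$). For $u\in L^1_{\mathrm{loc}}(\Omega)$ the total variation is $\|Du\|(\Omega)=\inf\liminf_{i\to\infty}\int_\Omega g_{u_i}\,d\mu$, where $g_{u_i}$ is an upper gradient of $u_i$ and the infimum is over all sequences of locally Lipschitz functions $u_i$ on $\Omega$ with $u_i\to u$ in $L^1_{\mathrm{loc}}(\Omega)$. $\mathrm{BV}(\Omega)$ is the set of $u\in L^1(\Omega)$ with $\|Du\|(\Omega)<\infty$. Relative capacities: for a ball $B'\subset X$ and $E\subset B'$, $$\mathrm{cap}_1(E,B')=\inf\int_{B'}g_u\,d\mu,\qquad \mathrm{Cap}_1(E,B')=\inf\int_{B'}(|u|+g_u)\,d\mu,$$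 infima over all $u\in N^{1,1}(B')$ and all upper gradients $g_u$ of $u$ such that $u=1$ on $E$ and $u$ has compact support in $B'$; and $$\mathrm{cap}_{\mathrm{BV},\mathrm{O}}(E,B')=\inf\|Du\|(B'),\qquad \mathrm{Cap}_{\mathrm{BV},\mathrm{O}}(E,B')=\inf\Big(\int_{B'}|u|\,d\mu+\|Du\|(B')\Big),$$ infima over all $u\in\mathrm{BV}(B')$ such that $u=1$ in a neighborhood of $E$ and $u$ has compact support in $B'$. Each infimum is $\infty$ if there are no such functions. Total capacities: for $E\subset X$, $\mathrm{Cap}_1(E)=\inf\int_X(|u|+g_u)\,d\mu$ over all $u\in N^{1,1}(X)$ with $u=1$ on $E$ and upper gradients $g_u$ of $u$; $\mathrm{Cap}_{\mathrm{BV},\mathrm{O}}(E)=\inf\big(\int_X|u|\,d\mu+\|Du\|(X)\big)$ over all $u\in\mathrm{BV}(X)$ with $u=1$ on an open neighborhood of $E$. Codimension one Hausdorff measure: $$\mathcal{H}(E)=\lim_{\delta\to0}\inf\Big\{\sum_{i\in I}\frac{\mu(B_i)}{r_i}:\ I\subset\mathbb{N},\ r_i\le\delta\text{ for all }i\in I,\ E\subset\bigcup_{i\in I}B_i\Big\},$$ where the $B_i$ are balls in $X$ with radius $r_i$. *)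

theory Defs
  imports "HOL-Analysis.Analysis"
begin

text \<open>
  The space X is the whole type \<open>'a\<close>. A function ``on \<open>\<Omega>\<close>'' is a total function of which only the
  values on \<open>\<Omega>\<close> are used. Functions whose (weak) upper gradients are considered are extended real
  valued; (weak) upper gradients take values in \<open>[0,\<infinity>]\<close>, that is, in \<^typ>\<open>ennreal\<close>.
\<close>

definition borel_regular_outer_measure :: "('a::metric_space set \<Rightarrow> ennreal) \<Rightarrow> bool" where
  "borel_regular_outer_measure \<mu> \<longleftrightarrow>
     outer_measure_space (Pow UNIV) \<mu> \<and>
     sets borel \<subseteq> lambda_system UNIV (Pow UNIV) \<mu> \<and>
     (\<forall>A. \<exists>B\<in>sets borel. A \<subseteq> B \<and> \<mu> B = \<mu> A)"

text \<open>The measure obtained by restricting the outer measure to its Caratheodory-measurable sets;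
  all integrals over X and the notion of measurable function refer to it.\<close>

definition caratheodory_measure :: "('a set \<Rightarrow> ennreal) \<Rightarrow> 'a measure" where
  "caratheodory_measure \<mu> = measure_of UNIV (lambda_system UNIV (Pow UNIV) \<mu>) \<mu>"

lemma
  assumes "outer_measure_space (Pow UNIV) \<mu>"
  shows space_caratheodory_measure: "space (caratheodory_measure \<mu>) = UNIV"
    and sets_caratheodory_measure:
      "sets (caratheodory_measure \<mu>) = lambda_system UNIV (Pow UNIV) \<mu>"
    and emeasure_caratheodory_measure:
      "A \<in> lambda_system UNIV (Pow UNIV) \<mu> \<Longrightarrow> emeasure (caratheodory_measure \<mu>) A = \<mu> A"
proof -
  interpret sigma_algebra UNIV "Pow UNIV :: 'a set set" by (rule sigma_algebra_Pow)
  have ms: "measure_space UNIV (lambda_system UNIV (Pow UNIV) \<mu>) \<mu>"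
    by (rule caratheodory_lemma[OF assms])
  then have sa: "sigma_algebra UNIV (lambda_system UNIV (Pow UNIV) \<mu>)"
    by (simp add: measure_space_def)
  show "space (caratheodory_measure \<mu>) = UNIV"
    by (simp add: caratheodory_measure_def space_measure_of_conv)
  show "sets (caratheodory_measure \<mu>) = lambda_system UNIV (Pow UNIV) \<mu>"
    unfolding caratheodory_measure_def by (rule sigma_algebra.sets_measure_of_eq[OF sa])
  show "emeasure (caratheodory_measure \<mu>) A = \<mu> A" if "A \<in> lambda_system UNIV (Pow UNIV) \<mu>"
    using ms sa that unfolding caratheodory_measure_def measure_space_def
    by (intro emeasure_measure_of_sigma) auto
qed

definition doubling :: "('a::metric_space set \<Rightarrow> ennreal) \<Rightarrow> bool" where
  "doubling \<mu> \<longleftrightarrow>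
     (\<exists>C_D::real. \<forall>x r. 0 < r \<longrightarrow> \<mu> (ball x (2 * r)) \<le> ennreal C_D * \<mu> (ball x r))"

text \<open>The triple \<open>(a, b, \<gamma>)\<close> stands for the mapping \<open>\<gamma>\<close> restricted to \<open>[a,b]\<close>.\<close>

type_synonym 'a curve = "real \<times> real \<times> (real \<Rightarrow> 'a)"

definition curve_length :: "(real \<Rightarrow> 'a::metric_space) \<Rightarrow> real \<Rightarrow> real \<Rightarrow> ennreal" where
  "curve_length \<gamma> a b =
     (SUP ts \<in> {ts. sorted ts \<and> set ts \<subseteq> {a..b}}.
        \<Sum>i<length ts - 1. ennreal (dist (\<gamma> (ts ! i)) (\<gamma> (ts ! Suc i))))"

definition paths_in :: "'a::metric_space set \<Rightarrow> 'a curve set" where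
  "paths_in \<Omega> = {(a, b, \<gamma>). a \<le> b \<and> continuous_on {a..b} \<gamma> \<and> curve_length \<gamma> a b < \<infinity> \<and>
     \<not> \<gamma> constant_on {a..b} \<and> \<gamma> ` {a..b} \<subseteq> \<Omega>}"

text \<open>The arc-length parametrization, defined on \<open>[0, \<ell>]\<close> with \<open>\<ell>\<close> the length of the path. For a
  rectifiable path the choice of the parameter \<open>t\<close> is immaterial, since \<open>\<gamma>\<close> is constant on every
  interval on which the length of its initial pieces is constant.\<close>

definition arclength_param :: "'a::metric_space curve \<Rightarrow> real \<Rightarrow> 'a" where
  "arclength_param = (\<lambda>(a, b, \<gamma>) s. \<gamma> (SOME t. t \<in> {a..b} \<and> curve_length \<gamma> a t = ennreal s))"

definition arclength_domain :: "'a::metric_space curve \<Rightarrow> real set" where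
  "arclength_domain = (\<lambda>(a, b, \<gamma>). {0..enn2real (curve_length \<gamma> a b)})"

definition line_integral :: "'a::metric_space curve \<Rightarrow> ('a \<Rightarrow> ennreal) \<Rightarrow> ennreal" where
  "line_integral c g = (\<integral>\<^sup>+ s. g (arclength_param c s) \<partial>lebesgue_on (arclength_domain c))"

definition line_integral_well_defined :: "'a::metric_space curve \<Rightarrow> ('a \<Rightarrow> ennreal) \<Rightarrow> bool" where
  "line_integral_well_defined c g \<longleftrightarrow>
     (\<lambda>s. g (arclength_param c s)) \<in> borel_measurable (lebesgue_on (arclength_domain c))"

definition upper_gradient_inequality ::
    "('a::metric_space \<Rightarrow> ereal) \<Rightarrow> ('a \<Rightarrow> ennreal) \<Rightarrow> 'a curve \<Rightarrow> bool" where
  "upper_gradient_inequality u g = (\<lambda>(a, b, \<gamma>).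
     if \<bar>u (\<gamma> a)\<bar> \<noteq> \<infinity> \<and> \<bar>u (\<gamma> b)\<bar> \<noteq> \<infinity>
     then e2ennreal \<bar>u (\<gamma> a) - u (\<gamma> b)\<bar> \<le> line_integral (a, b, \<gamma>) g
     else line_integral (a, b, \<gamma>) g = \<infinity>)"

definition upper_gradient ::
    "'a::metric_space set \<Rightarrow> ('a \<Rightarrow> ereal) \<Rightarrow> ('a \<Rightarrow> ennreal) \<Rightarrow> bool" where
  "upper_gradient \<Omega> u g \<longleftrightarrow>
     g \<in> borel_measurable (restrict_space borel \<Omega>) \<and>
     (\<forall>c\<in>paths_in \<Omega>. upper_gradient_inequality u g c)"

definition modulus1 :: "'a::metric_space measure \<Rightarrow> 'a set \<Rightarrow> 'a curve set \<Rightarrow> ennreal" where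
  "modulus1 M \<Omega> \<Gamma> =
     (INF \<rho> \<in> {\<rho>. \<rho> \<in> borel_measurable (restrict_space borel \<Omega>) \<and> (\<forall>c\<in>\<Gamma>. 1 \<le> line_integral c \<rho>)}.
        \<integral>\<^sup>+x\<in>\<Omega>. \<rho> x \<partial>M)"

definition weak_upper_gradient ::
    "'a::metric_space measure \<Rightarrow> 'a set \<Rightarrow> ('a \<Rightarrow> ereal) \<Rightarrow> ('a \<Rightarrow> ennreal) \<Rightarrow> bool" where
  "weak_upper_gradient M \<Omega> u g \<longleftrightarrow>
     g \<in> borel_measurable (restrict_space M \<Omega>) \<and>
     (\<exists>\<Gamma>\<subseteq>paths_in \<Omega>. modulus1 M \<Omega> \<Gamma> = 0 \<and>
        (\<forall>c\<in>paths_in \<Omega> - \<Gamma>. line_integral_well_defined c g \<and> upper_gradient_inequality u g c))"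

definition L1_on :: "'a measure \<Rightarrow> 'a set \<Rightarrow> ('a \<Rightarrow> ereal) \<Rightarrow> bool" where
  "L1_on M \<Omega> u \<longleftrightarrow>
     u \<in> borel_measurable (restrict_space M \<Omega>) \<and> (\<integral>\<^sup>+x\<in>\<Omega>. e2ennreal \<bar>u x\<bar> \<partial>M) < \<infinity>"

text \<open>For open \<open>\<Omega>\<close>, a property holds locally in \<open>\<Omega>\<close> if every point of \<open>\<Omega>\<close> has a neighbourhood in
  which it holds. In a proper metric space (such as a complete doubling one) this amounts to the property
  holding on relatively compact open subsets of \<open>\<Omega>\<close>.\<close>

definition L1_loc_on :: "'a::metric_space measure \<Rightarrow> 'a set \<Rightarrow> ('a \<Rightarrow> ereal) \<Rightarrow> bool" where
  "L1_loc_on M \<Omega> u \<longleftrightarrow> (\<forall>x\<in>\<Omega>. \<exists>r>0. ball x r \<subseteq> \<Omega> \<and> L1_on M (ball x r) u)"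

definition L1_loc_tendsto ::
    "'a::metric_space measure \<Rightarrow> 'a set \<Rightarrow> (nat \<Rightarrow> 'a \<Rightarrow> real) \<Rightarrow> ('a \<Rightarrow> ereal) \<Rightarrow> bool" where
  "L1_loc_tendsto M \<Omega> v u \<longleftrightarrow> (\<forall>x\<in>\<Omega>. \<exists>r>0. ball x r \<subseteq> \<Omega> \<and>
     (\<lambda>i. \<integral>\<^sup>+y\<in>ball x r. e2ennreal \<bar>ereal (v i y) - u y\<bar> \<partial>M) \<longlonglongrightarrow> 0)"

definition locally_lipschitz_on :: "'a::metric_space set \<Rightarrow> ('a \<Rightarrow> real) \<Rightarrow> bool" where
  "locally_lipschitz_on \<Omega> v \<longleftrightarrow>
     (\<forall>x\<in>\<Omega>. \<exists>r>0. ball x r \<subseteq> \<Omega> \<and> (\<exists>L. L-lipschitz_on (ball x r) v))"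

definition N11_norm :: "'a::metric_space measure \<Rightarrow> 'a set \<Rightarrow> ('a \<Rightarrow> ereal) \<Rightarrow> ennreal" where
  "N11_norm M \<Omega> u = (\<integral>\<^sup>+x\<in>\<Omega>. e2ennreal \<bar>u x\<bar> \<partial>M) +
     (INF g \<in> {g. weak_upper_gradient M \<Omega> u g}. \<integral>\<^sup>+x\<in>\<Omega>. g x \<partial>M)"

text \<open>No identification of functions is made: \<open>u\<close> is a pointwise defined representative.\<close>

definition N11 :: "'a::metric_space measure \<Rightarrow> 'a set \<Rightarrow> ('a \<Rightarrow> ereal) \<Rightarrow> bool" where
  "N11 M \<Omega> u \<longleftrightarrow> L1_on M \<Omega> u \<and> N11_norm M \<Omega> u < \<infinity>"

definition total_variation :: "'a::metric_space measure \<Rightarrow> 'a set \<Rightarrow> ('a \<Rightarrow> ereal) \<Rightarrow> ennreal" where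
  "total_variation M \<Omega> u =
     (INF (v, g) \<in> {(v, g). (\<forall>i::nat. locally_lipschitz_on \<Omega> (v i) \<and>
          upper_gradient \<Omega> (\<lambda>x. ereal (v i x)) (g i)) \<and> L1_loc_tendsto M \<Omega> v u}.
        liminf (\<lambda>i. \<integral>\<^sup>+x\<in>\<Omega>. g i x \<partial>M))"

definition BV :: "'a::metric_space measure \<Rightarrow> 'a set \<Rightarrow> ('a \<Rightarrow> ereal) \<Rightarrow> bool" where
  "BV M \<Omega> u \<longleftrightarrow> L1_on M \<Omega> u \<and> total_variation M \<Omega> u < \<infinity>"

definition mean_value :: "'a measure \<Rightarrow> 'a set \<Rightarrow> ('a \<Rightarrow> ereal) \<Rightarrow> real" where
  "mean_value M B u = (LINT x:B|M. real_of_ereal (u x)) / measure M B"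

definition weak_11_poincare :: "'a::metric_space measure \<Rightarrow> bool" where
  "weak_11_poincare M \<longleftrightarrow>
     (\<exists>C_P \<tau>::real. 0 < C_P \<and> 1 \<le> \<tau> \<and>
        (\<forall>x r u g. 0 < r \<longrightarrow> L1_loc_on M UNIV u \<longrightarrow> weak_upper_gradient M UNIV u g \<longrightarrow>
           (\<integral>\<^sup>+y\<in>ball x r. e2ennreal \<bar>u y - ereal (mean_value M (ball x r) u)\<bar> \<partial>M)
               / emeasure M (ball x r)
           \<le> ennreal (C_P * r) *
             ((\<integral>\<^sup>+y\<in>ball x (\<tau> * r). g y \<partial>M) / emeasure M (ball x (\<tau> * r)))))"

definition compact_support_in :: "'a::metric_space set \<Rightarrow> ('a \<Rightarrow> ereal) \<Rightarrow> bool" where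
  "compact_support_in \<Omega> u \<longleftrightarrow>
     compact (closure {x\<in>\<Omega>. u x \<noteq> 0}) \<and> closure {x\<in>\<Omega>. u x \<noteq> 0} \<subseteq> \<Omega>"

definition one_near :: "'a::metric_space set \<Rightarrow> 'a set \<Rightarrow> ('a \<Rightarrow> ereal) \<Rightarrow> bool" where
  "one_near E \<Omega> u \<longleftrightarrow> (\<exists>U. open U \<and> E \<subseteq> U \<and> U \<subseteq> \<Omega> \<and> (\<forall>x\<in>U. u x = 1))"

definition rel_cap1 :: "'a::metric_space measure \<Rightarrow> 'a set \<Rightarrow> 'a set \<Rightarrow> ennreal" where
  "rel_cap1 M E \<Omega> =
     (INF (u, g) \<in> {(u, g). N11 M \<Omega> u \<and> upper_gradient \<Omega> u g \<and>
          (\<forall>x\<in>E. u x = 1) \<and> compact_support_in \<Omega> u}.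
        \<integral>\<^sup>+x\<in>\<Omega>. g x \<partial>M)"

definition rel_Cap1 :: "'a::metric_space measure \<Rightarrow> 'a set \<Rightarrow> 'a set \<Rightarrow> ennreal" where
  "rel_Cap1 M E \<Omega> =
     (INF (u, g) \<in> {(u, g). N11 M \<Omega> u \<and> upper_gradient \<Omega> u g \<and>
          (\<forall>x\<in>E. u x = 1) \<and> compact_support_in \<Omega> u}.
        \<integral>\<^sup>+x\<in>\<Omega>. (e2ennreal \<bar>u x\<bar> + g x) \<partial>M)"

definition rel_cap_BVO :: "'a::metric_space measure \<Rightarrow> 'a set \<Rightarrow> 'a set \<Rightarrow> ennreal" where
  "rel_cap_BVO M E \<Omega> =
     (INF u \<in> {u. BV M \<Omega> u \<and> one_near E \<Omega> u \<and> compact_support_in \<Omega> u}.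
        total_variation M \<Omega> u)"

definition rel_Cap_BVO :: "'a::metric_space measure \<Rightarrow> 'a set \<Rightarrow> 'a set \<Rightarrow> ennreal" where
  "rel_Cap_BVO M E \<Omega> =
     (INF u \<in> {u. BV M \<Omega> u \<and> one_near E \<Omega> u \<and> compact_support_in \<Omega> u}.
        (\<integral>\<^sup>+x\<in>\<Omega>. e2ennreal \<bar>u x\<bar> \<partial>M) + total_variation M \<Omega> u)"

definition Cap1 :: "'a::metric_space measure \<Rightarrow> 'a set \<Rightarrow> ennreal" where
  "Cap1 M E =
     (INF (u, g) \<in> {(u, g). N11 M UNIV u \<and> upper_gradient UNIV u g \<and> (\<forall>x\<in>E. u x = 1)}.
        \<integral>\<^sup>+x. (e2ennreal \<bar>u x\<bar> + g x) \<partial>M)"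

definition Cap_BVO :: "'a::metric_space measure \<Rightarrow> 'a set \<Rightarrow> ennreal" where
  "Cap_BVO M E =
     (INF u \<in> {u. BV M UNIV u \<and> one_near E UNIV u}.
        (\<integral>\<^sup>+x. e2ennreal \<bar>u x\<bar> \<partial>M) + total_variation M UNIV u)"

definition codim1_content ::
    "('a::metric_space set \<Rightarrow> ennreal) \<Rightarrow> real \<Rightarrow> 'a set \<Rightarrow> ennreal" where
  "codim1_content \<mu> \<delta> E =
     (INF (I, x, r) \<in> {(I, x, r). (\<forall>i\<in>I. 0 < r i \<and> r i \<le> \<delta>) \<and> E \<subseteq> (\<Union>i\<in>I. ball (x i) (r i))}.
        \<Sum>\<^sub>\<infinity>i\<in>(I::nat set). \<mu> (ball (x i) (r i)) / ennreal (r i))"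

definition codim1_hausdorff :: "('a::metric_space set \<Rightarrow> ennreal) \<Rightarrow> 'a set \<Rightarrow> ennreal" where
  "codim1_hausdorff \<mu> E = Lim (at_right 0) (\<lambda>\<delta>. codim1_content \<mu> \<delta> E)"

text \<open>\<^const>\<open>Lim\<close> is unspecified if there is no limit; here the limit exists, as the content is monotone in \<open>\<delta>\<close>.\<close>

lemma codim1_content_antimono:
  "\<delta> \<le> \<delta>' \<Longrightarrow> codim1_content \<mu> \<delta>' E \<le> codim1_content \<mu> \<delta> E"
  unfolding codim1_content_def by (rule INF_superset_mono) (auto intro: order_trans)

lemma codim1_content_tendsto:
  "((\<lambda>\<delta>. codim1_content \<mu> \<delta> E) \<longlongrightarrow> (SUP \<delta>\<in>{0<..}. codim1_content \<mu> \<delta> E)) (at_right 0)"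
proof (rule order_tendstoI)
  fix a assume "a < (SUP \<delta>\<in>{0<..}. codim1_content \<mu> \<delta> E)"
  then obtain \<delta>0 where d: "0 < \<delta>0" "a < codim1_content \<mu> \<delta>0 E"
    by (auto simp: less_SUP_iff)
  have "eventually (\<lambda>\<delta>. \<delta> \<in> {0<..<\<delta>0}) (at_right 0)"
    using d(1) by (rule eventually_at_right_real)
  then show "eventually (\<lambda>\<delta>. a < codim1_content \<mu> \<delta> E) (at_right 0)"
    by eventually_elim (use d codim1_content_antimono[of _ \<delta>0 \<mu> E] in \<open>auto intro: less_le_trans\<close>)
next
  fix a assume a: "(SUP \<delta>\<in>{0<..}. codim1_content \<mu> \<delta> E) < a"
  have "eventually (\<lambda>\<delta>::real. \<delta> \<in> {0<..<1}) (at_right 0)"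
    by (rule eventually_at_right_real) simp
  then show "eventually (\<lambda>\<delta>. codim1_content \<mu> \<delta> E < a) (at_right 0)"
  proof eventually_elim
    fix \<delta> :: real assume "\<delta> \<in> {0<..<1}"
    then have "codim1_content \<mu> \<delta> E \<le> (SUP \<delta>\<in>{0<..}. codim1_content \<mu> \<delta> E)"
      by (intro SUP_upper) simp
    then show "codim1_content \<mu> \<delta> E < a" using a by (rule le_less_trans)
  qed
qed

lemma codim1_hausdorff_eq_SUP:
  "codim1_hausdorff \<mu> E = (SUP \<delta>\<in>{0<..}. codim1_content \<mu> \<delta> E)"
  unfolding codim1_hausdorff_def
  by (rule tendsto_Lim[OF _ codim1_content_tendsto]) simp

end

(*
  If H(E) = 0, maxima of Lipschitz bumps over fine covers of E by balls give admissible functions for all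
  six capacities with arbitrarily small energy.

  Conversely, a BV function that is one near E and has small total variation has, by the coarea
  inequality, a superlevel set A that contains a neighbourhood of E and whose indicator function is the
  limit of functions with small upper gradient integral. If A has small measure, then around every point
  of E some small ball is filled by A in a fixed proportion strictly between 0 and 1; the Poincare
  inequality on these balls and a Vitali covering bound the codimension one content of E (boxing
  inequality). For the relative capacities, where the L1 norm is not part of the energy, the measure of A
  is controlled by the Poincare inequality on a large ball, which contains a ball outside 2B.

  A Sobolev function u that is only pointwise one on E says that every curve from E to the complement of
  2B has length at least one for a weight with small integral. Replacing the weight by a lower
  semicontinuous majorant h, the distance to the complement of 2B along discrete chains, weighted by
  continuous approximations of h, yields locally Lipschitz functions that increase to a lower
  semicontinuous function equal to one on E. This reduces the case to the previous one.
*)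
theory Submission
  imports Defs
begin

section \<open>Length of curves\<close>

text \<open>Total variation is defined by relaxation only, and it is never treated as a measure
  here. What is extracted from it is a sequence of continuous functions of bounded energy; every
  inequality is proved for the members of the sequence and then passed to the limit. Two obstacles
  shape the proof. A Sobolev competitor equals one on \<open>E\<close> but perhaps on no
  neighbourhood of \<open>E\<close>, so its superlevel sets cannot be used directly; instead of
  proving quasicontinuity, the chain distances produce a new function whose superlevel sets are
  open. Secondly, the functions that approximate a compactly supported BV function on 2B need not
  vanish near the boundary of 2B, while the Poincare inequality is a statement about functions on X;
  a cutoff removes them there at an arbitrarily small cost. Levels are taken between 1/4 and 3/4 to
  stay away from both 0 and 1, and the choice of a good level costs a factor 3. The equivalences
  close through the Hausdorff measure: the two total capacities and the two relative capacities
  without the L1 term are each shown to force it to vanish.\<close>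

fun polygon_length :: "(real \<Rightarrow> 'a::metric_space) \<Rightarrow> real list \<Rightarrow> ennreal" where
  "polygon_length \<gamma> (x # y # zs) = ennreal (dist (\<gamma> x) (\<gamma> y)) + polygon_length \<gamma> (y # zs)"
| "polygon_length \<gamma> xs = 0"

text \<open>The recursive form suits inductions that insert a point into a subdivision; this is the
  bridge to the indexed sum in \<open>curve_length\<close>.\<close>

lemma polygon_length_eq_sum:
  "polygon_length \<gamma> ts = (\<Sum>i<length ts - 1. ennreal (dist (\<gamma> (ts ! i)) (\<gamma> (ts ! Suc i))))"
proof (induction \<gamma> ts rule: polygon_length.induct)
  case (1 \<gamma> x y zs)
  then show ?case by (simp add: sum.lessThan_Suc_shift del: sum.lessThan_Suc)
qed auto

lemma curve_length_eq_SUP: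
  "curve_length \<gamma> a b = (SUP ts \<in> {ts. sorted ts \<and> set ts \<subseteq> {a..b}}. polygon_length \<gamma> ts)"
  by (simp add: curve_length_def polygon_length_eq_sum)

lemma polygon_length_le_curve_length:
  "sorted ts \<Longrightarrow> set ts \<subseteq> {a..b} \<Longrightarrow> polygon_length \<gamma> ts \<le> curve_length \<gamma> a b"
  unfolding curve_length_eq_SUP by (rule SUP_upper) simp

lemma dist_le_curve_length:
  assumes "s \<le> t"
  shows "ennreal (dist (\<gamma> s) (\<gamma> t)) \<le> curve_length \<gamma> s t"
  using polygon_length_le_curve_length[of "[s, t]" s t \<gamma>] assms by simp

lemma polygon_length_append:
  "polygon_length \<gamma> xs + polygon_length \<gamma> ys \<le> polygon_length \<gamma> (xs @ ys)"
proof (induction \<gamma> xs rule: polygon_length.induct)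
  case (1 \<gamma> x y zs)
  then show ?case by (simp add: add.assoc add_left_mono)
next
  case ("2_2" \<gamma> v)
  then show ?case by (cases ys) auto
qed auto

lemma polygon_length_Cons_le:
  "polygon_length \<gamma> (x # ys) \<le> ennreal (dist (\<gamma> x) (\<gamma> t)) + polygon_length \<gamma> (t # ys)"
proof (cases ys)
  case (Cons y zs)
  have "ennreal (dist (\<gamma> x) (\<gamma> y)) \<le> ennreal (dist (\<gamma> x) (\<gamma> t)) + ennreal (dist (\<gamma> t) (\<gamma> y))"
    using dist_triangle[of "\<gamma> x" "\<gamma> y" "\<gamma> t"]
    by (simp flip: ennreal_plus add: dist_commute ennreal_leI)
  then show ?thesis using Cons by (simp add: add.assoc[symmetric] add_right_mono)
qed simp

text \<open>Passing through \<open>t\<close> is a detour, which by the triangle inequality does not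
  shorten the polygon. This is the subadditive half of the additivity of length.\<close>

lemma polygon_length_insert:
  assumes "sorted ts"
  shows "polygon_length \<gamma> ts
    \<le> polygon_length \<gamma> (filter (\<lambda>r. r \<le> t) ts @ [t]) + polygon_length \<gamma> (t # filter (\<lambda>r. t < r) ts)"
  using assms
proof (induction ts)
  case (Cons x ys)
  show ?case
  proof (cases "x \<le> t")
    case False
    then have "\<forall>r\<in>set (x # ys). t < r" using Cons.prems by auto
    then have "filter (\<lambda>r. t < r) (x # ys) = x # ys" "filter (\<lambda>r. r \<le> t) (x # ys) = []"
      by (auto simp: filter_empty_conv)
    then show ?thesis by (simp del: filter.simps)
  next
    case x: True
    show ?thesis
    proof (cases ys)
      case ys: (Cons y zs)
      show ?thesis
      proof (cases "y \<le> t")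
        case True
        then show ?thesis using Cons x ys by (simp add: add.assoc add_left_mono)
      next
        case False
        then have "\<forall>r\<in>set ys. t < r" using Cons.prems ys by auto
        then have "filter (\<lambda>r. t < r) ys = ys" "filter (\<lambda>r. r \<le> t) ys = []"
          by (auto simp: filter_empty_conv)
        then show ?thesis using x polygon_length_Cons_le[of \<gamma> x ys t] by simp
      qed
    qed (use x in simp)
  qed
qed simp

lemma subdivisions_nonempty: "{ts. sorted ts \<and> set ts \<subseteq> {a..b}} \<noteq> {}" for a b :: real
  by (rule ex_in_conv[THEN iffD1], rule exI[of _ "[]"]) simp

lemma curve_length_add:
  assumes "s \<le> t" "t \<le> u"
  shows "curve_length \<gamma> s u = curve_length \<gamma> s t + curve_length \<gamma> t u"
proof (rule antisym)
  show "curve_length \<gamma> s u \<le> curve_length \<gamma> s t + curve_length \<gamma> t u"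
    unfolding curve_length_eq_SUP[of \<gamma> s u]
  proof (rule SUP_least, safe)
    fix ts assume ts: "sorted ts" "set ts \<subseteq> {s..u}"
    have "polygon_length \<gamma> (filter (\<lambda>r. r \<le> t) ts @ [t]) \<le> curve_length \<gamma> s t"
      using ts assms by (intro polygon_length_le_curve_length) (auto simp: sorted_append sorted_wrt_filter)
    moreover have "polygon_length \<gamma> (t # filter (\<lambda>r. t < r) ts) \<le> curve_length \<gamma> t u"
      using ts assms by (intro polygon_length_le_curve_length) (auto simp: sorted_wrt_filter)
    ultimately show "polygon_length \<gamma> ts \<le> curve_length \<gamma> s t + curve_length \<gamma> t u"
      using polygon_length_insert[OF ts(1), of \<gamma> t] by (meson add_mono order_trans)
  qed
  have *: "polygon_length \<gamma> ts + polygon_length \<gamma> ts' \<le> curve_length \<gamma> s u"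
    if "sorted ts" "set ts \<subseteq> {s..t}" "sorted ts'" "set ts' \<subseteq> {t..u}" for ts ts'
  proof -
    have "polygon_length \<gamma> (ts @ ts') \<le> curve_length \<gamma> s u"
      using that assms by (intro polygon_length_le_curve_length) (force simp: sorted_append)+
    then show ?thesis using polygon_length_append[of \<gamma> ts ts'] by (meson order_trans)
  qed
  show "curve_length \<gamma> s t + curve_length \<gamma> t u \<le> curve_length \<gamma> s u"
  proof -
    let ?I = "\<lambda>a b. {ts. sorted ts \<and> set ts \<subseteq> {a..b::real}}"
    have "polygon_length \<gamma> ts + curve_length \<gamma> t u \<le> curve_length \<gamma> s u" if "ts \<in> ?I s t" for ts
    proof -
      have "polygon_length \<gamma> ts + curve_length \<gamma> t u = (SUP ts'\<in>?I t u. polygon_length \<gamma> ts + polygon_length \<gamma> ts')"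
        unfolding curve_length_eq_SUP by (simp add: ennreal_SUP_add_right[OF subdivisions_nonempty])
      also have "\<dots> \<le> curve_length \<gamma> s u"
        using that * by (intro SUP_least) auto
      finally show ?thesis .
    qed
    then have "(SUP ts\<in>?I s t. polygon_length \<gamma> ts + curve_length \<gamma> t u) \<le> curve_length \<gamma> s u"
      by (rule SUP_least)
    then show ?thesis
      by (simp add: curve_length_eq_SUP[of \<gamma> s t] ennreal_SUP_add_left[OF subdivisions_nonempty])
  qed
qed

lemma curve_length_refl [simp]: "curve_length \<gamma> a a = 0"
proof -
  have "polygon_length \<gamma> ts = 0" if "set ts \<subseteq> {a}" for ts
    using that by (induction \<gamma> ts rule: polygon_length.induct) auto
  then have "curve_length \<gamma> a a \<le> 0" unfolding curve_length_eq_SUP by (intro SUP_least) auto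
  then show ?thesis by simp
qed

lemma curve_length_mono:
  assumes "a \<le> s" "s \<le> t" "t \<le> b"
  shows "curve_length \<gamma> s t \<le> curve_length \<gamma> a b"
  unfolding curve_length_eq_SUP using assms by (intro SUP_subset_mono) auto

lemma curve_length_lipschitz:
  assumes "a \<le> b" "L-lipschitz_on {a..b} \<gamma>"
  shows "curve_length \<gamma> a b \<le> ennreal (L * (b - a))"
proof -
  have L: "0 \<le> L" using assms(2) by (rule lipschitz_on_nonneg)
  \<comment> \<open>The induction needs a bound that depends on the first entry;
    \<open>hd (ts @ [b])\<close> extends this to the empty list with the value
    \<open>b\<close>.\<close>
  have "polygon_length \<gamma> ts \<le> ennreal (L * (b - hd (ts @ [b])))" if "sorted ts" "set ts \<subseteq> {a..b}" for ts
    using that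
  proof (induction ts)
    case (Cons x ys)
    show ?case
    proof (cases ys)
      case (Cons y zs)
      have IH: "polygon_length \<gamma> ys \<le> ennreal (L * (b - y))"
        using Cons.IH Cons.prems Cons by auto
      have xy: "x \<le> y" "x \<in> {a..b}" "y \<in> {a..b}" using Cons.prems Cons by auto
      have "dist (\<gamma> x) (\<gamma> y) \<le> L * (y - x)"
        using lipschitz_onD[OF assms(2), of x y] xy by (auto simp: dist_real_def)
      then have "ennreal (dist (\<gamma> x) (\<gamma> y)) + polygon_length \<gamma> ys
          \<le> ennreal (L * (y - x)) + ennreal (L * (b - y))"
        by (intro add_mono ennreal_leI IH)
      also have "\<dots> = ennreal (L * (b - x))"
        using xy L by (subst ennreal_plus[symmetric]) (auto simp: algebra_simps intro: mult_left_mono)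
      finally show ?thesis using Cons by simp
    qed simp
  qed simp
  moreover have "ennreal (L * (b - hd (ts @ [b]))) \<le> ennreal (L * (b - a))" if "set ts \<subseteq> {a..b}" for ts
    using that L assms(1) by (intro ennreal_leI mult_left_mono) (cases ts; auto)+
  ultimately show ?thesis unfolding curve_length_eq_SUP by (intro SUP_least) (auto intro: order_trans)
qed

text \<open>Unlike \<open>paths_in\<close>, this admits constant curves and one-point intervals, so
  that every piece of a rectifiable path is again an instance.\<close>

locale rect_path =
  fixes a b :: real and \<gamma> :: "real \<Rightarrow> 'a::metric_space"
  assumes le: "a \<le> b" and cont: "continuous_on {a..b} \<gamma>" and fin: "curve_length \<gamma> a b < \<infinity>"
begin

definition len :: "real \<Rightarrow> real" where "len t = enn2real (curve_length \<gamma> a t)"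


lemma finite_sub: "a \<le> s \<Longrightarrow> s \<le> t \<Longrightarrow> t \<le> b \<Longrightarrow> curve_length \<gamma> s t < \<infinity>"
  using curve_length_mono[of a s t b \<gamma>] fin by (auto intro: le_less_trans)

lemma ennreal_len: "t \<in> {a..b} \<Longrightarrow> ennreal (len t) = curve_length \<gamma> a t"
  unfolding len_def using finite_sub[of a t] by (simp add: less_top)

lemma len_a [simp]: "len a = 0"
  by (simp add: len_def)

lemma curve_length_eq_len:
  assumes "a \<le> s" "s \<le> t" "t \<le> b"
  shows "curve_length \<gamma> s t = ennreal (len t - len s)"
proof -
  have fs: "curve_length \<gamma> a s < top" "curve_length \<gamma> s t < top"
    using finite_sub[of a s] finite_sub[of s t] assms by auto
  have "curve_length \<gamma> a t = curve_length \<gamma> a s + curve_length \<gamma> s t"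
    using assms by (intro curve_length_add)
  then have "len t = len s + enn2real (curve_length \<gamma> s t)"
    unfolding len_def using fs by (simp add: enn2real_plus)
  then show ?thesis using fs by simp
qed

lemma len_mono: "a \<le> s \<Longrightarrow> s \<le> t \<Longrightarrow> t \<le> b \<Longrightarrow> len s \<le> len t"
  unfolding len_def using finite_sub[of a t] curve_length_mono[of a a s t \<gamma>]
  by (intro enn2real_mono) auto

lemma dist_le_len:
  assumes "a \<le> s" "s \<le> t" "t \<le> b"
  shows "dist (\<gamma> s) (\<gamma> t) \<le> len t - len s"
proof -
  have "ennreal (dist (\<gamma> s) (\<gamma> t)) \<le> ennreal (len t - len s)"
    using dist_le_curve_length[of s t \<gamma>] curve_length_eq_len[OF assms] assms by simp
  then show ?thesis using len_mono[OF assms] by simp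
qed

text \<open>Take a subdivision of \<open>{s..b}\<close> whose polygon misses the full length by less
  than \<open>e / 2\<close>. Up to the first subdivision point after \<open>s\<close>, cutting at
  \<open>t\<close> leaves the single segment from \<open>s\<close> to \<open>t\<close> on the left,
  and it is short by continuity of \<gamma>. What remains is at most the length from
  \<open>t\<close> to \<open>b\<close>, so little length can lie between \<open>s\<close> and
  \<open>t\<close>.\<close>

lemma len_right:
  assumes "s \<in> {a..<b}" "0 < e"
  shows "\<exists>d>0. \<forall>t\<in>{s..b}. t - s < d \<longrightarrow> len t - len s \<le> e"
proof -
  have sb: "a \<le> s" "s \<le> b" using assms by auto
  define e' where "e' = e / 2"
  have e': "0 < e'" using assms by (simp add: e'_def)
  have "\<exists>ts\<in>{ts. sorted ts \<and> set ts \<subseteq> {s..b}}. curve_length \<gamma> s b < polygon_length \<gamma> ts + ennreal e'"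
    using e' finite_sub[OF sb] subdivisions_nonempty
    by (intro SUP_approx_ennreal[OF _ _ curve_length_eq_SUP]) auto
  then obtain ts where ts: "sorted ts" "set ts \<subseteq> {s..b}"
      and lt: "curve_length \<gamma> s b < polygon_length \<gamma> ts + ennreal e'" by auto
  \<comment> \<open>The first subdivision point after \<open>s\<close>; inserting \<open>b\<close>
    makes the minimum exist.\<close>
  define m where "m = Min (insert b {r\<in>set ts. s < r})"
  have m: "s < m" using assms by (auto simp: m_def)
  have mle: "m \<le> r" if "r \<in> set ts" "s < r" for r using that by (auto simp: m_def intro: Min_le)
  have "continuous (at s within {a..b}) \<gamma>" using cont assms by (auto simp: continuous_on_eq_continuous_within)
  then obtain d where d: "0 < d" "\<And>t. t \<in> {a..b} \<Longrightarrow> dist t s < d \<Longrightarrow> dist (\<gamma> t) (\<gamma> s) < e'"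
    using e' unfolding continuous_within_eps_delta by blast
  show ?thesis
  proof (intro exI[of _ "min d (m - s)"] conjI ballI impI)
    show "0 < min d (m - s)" using d m by auto
    fix t assume t: "t \<in> {s..b}" "t - s < min d (m - s)"
    have el: "r = s" if "r \<in> set ts" "r \<le> t" for r
      using mle[OF that(1)] that ts t by force
    have *: "polygon_length \<gamma> (xs @ [t]) \<le> ennreal (dist (\<gamma> s) (\<gamma> t))" if "\<forall>r\<in>set xs. r = s" for xs
      using that
    proof (induction xs)
      case (Cons x ys)
      then show ?case by (cases ys) auto
    qed simp
    have "polygon_length \<gamma> (filter (\<lambda>r. r \<le> t) ts @ [t]) \<le> ennreal (dist (\<gamma> s) (\<gamma> t))"
      by (rule *) (use el in auto)
    also have "\<dots> \<le> ennreal e'"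
      using d(2)[of t] t sb by (intro ennreal_leI) (auto simp: dist_commute dist_real_def)
    finally have 1: "polygon_length \<gamma> (filter (\<lambda>r. r \<le> t) ts @ [t]) \<le> ennreal e'" .
    have 2: "polygon_length \<gamma> (t # filter (\<lambda>r. t < r) ts) \<le> curve_length \<gamma> t b"
      using ts t by (intro polygon_length_le_curve_length) (auto simp: sorted_wrt_filter)
    have "polygon_length \<gamma> ts + ennreal e' \<le> (ennreal e' + curve_length \<gamma> t b) + ennreal e'"
      by (intro add_mono order_trans[OF polygon_length_insert[OF ts(1), of \<gamma> t]] 1 2 order_refl)
    then have "ennreal (len b - len s) \<le> (ennreal e' + ennreal (len b - len t)) + ennreal e'"
      using order_trans[OF less_imp_le[OF lt]] curve_length_eq_len[of s b] curve_length_eq_len[of t b] t sb by auto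
    also have "\<dots> = ennreal (2 * e' + (len b - len t))"
      using e' len_mono[of t b] t sb by (simp flip: ennreal_plus)
    finally show "len t - len s \<le> e" using e' len_mono[of t b] t sb
      by (subst (asm) ennreal_le_iff) (auto simp: e'_def)
  qed
qed

text \<open>The mirror image of \<open>len_right\<close>, with the last subdivision point before
  \<open>s\<close>.\<close>

lemma len_left:
  assumes "s \<in> {a<..b}" "0 < e"
  shows "\<exists>d>0. \<forall>t\<in>{a..s}. s - t < d \<longrightarrow> len s - len t \<le> e"
proof -
  have sb: "a \<le> s" "s \<le> b" using assms by auto
  define e' where "e' = e / 2"
  have e': "0 < e'" using assms by (simp add: e'_def)
  have "\<exists>ts\<in>{ts. sorted ts \<and> set ts \<subseteq> {a..s}}. curve_length \<gamma> a s < polygon_length \<gamma> ts + ennreal e'"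
    using e' finite_sub[of a s] sb subdivisions_nonempty
    by (intro SUP_approx_ennreal[OF _ _ curve_length_eq_SUP]) auto
  then obtain ts where ts: "sorted ts" "set ts \<subseteq> {a..s}"
      and lt: "curve_length \<gamma> a s < polygon_length \<gamma> ts + ennreal e'" by auto
  define m where "m = Max (insert a {r\<in>set ts. r < s})"
  have m: "m < s" using assms by (auto simp: m_def)
  have mle: "r \<le> m" if "r \<in> set ts" "r < s" for r using that by (auto simp: m_def intro: Max_ge)
  have "continuous (at s within {a..b}) \<gamma>" using cont assms by (auto simp: continuous_on_eq_continuous_within)
  then obtain d where d: "0 < d" "\<And>t. t \<in> {a..b} \<Longrightarrow> dist t s < d \<Longrightarrow> dist (\<gamma> t) (\<gamma> s) < e'"
    using e' unfolding continuous_within_eps_delta by blast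
  show ?thesis
  proof (intro exI[of _ "min d (s - m)"] conjI ballI impI)
    show "0 < min d (s - m)" using d m by auto
    fix t assume t: "t \<in> {a..s}" "s - t < min d (s - m)"
    have el: "r = s" if "r \<in> set ts" "t < r" for r
      using mle[OF that(1)] that ts t by force
    have *: "polygon_length \<gamma> (s # xs) = 0" if "\<forall>r\<in>set xs. r = s" for xs
      using that by (induction xs) auto
    have **: "polygon_length \<gamma> (t # xs) \<le> ennreal (dist (\<gamma> t) (\<gamma> s))" if "\<forall>r\<in>set xs. r = s" for xs
      using that *[of "tl xs"] by (cases xs) auto
    have "polygon_length \<gamma> (t # filter (\<lambda>r. t < r) ts) \<le> ennreal (dist (\<gamma> t) (\<gamma> s))"
      by (rule **) (use el in auto)
    also have "\<dots> \<le> ennreal e'"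
      using d(2)[of t] t sb by (intro ennreal_leI) (auto simp: dist_commute dist_real_def)
    finally have 1: "polygon_length \<gamma> (t # filter (\<lambda>r. t < r) ts) \<le> ennreal e'" .
    have 2: "polygon_length \<gamma> (filter (\<lambda>r. r \<le> t) ts @ [t]) \<le> curve_length \<gamma> a t"
      using ts t by (intro polygon_length_le_curve_length) (auto simp: sorted_wrt_filter sorted_append)
    have "polygon_length \<gamma> ts + ennreal e' \<le> (curve_length \<gamma> a t + ennreal e') + ennreal e'"
      by (intro add_mono order_trans[OF polygon_length_insert[OF ts(1), of \<gamma> t]] 1 2 order_refl)
    then have "ennreal (len s) \<le> (ennreal (len t) + ennreal e') + ennreal e'"
      using order_trans[OF less_imp_le[OF lt]] curve_length_eq_len[of a s] curve_length_eq_len[of a t] t sb by auto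
    also have "\<dots> = ennreal (2 * e' + len t)"
      using e' len_mono[of a t] t sb by (simp flip: ennreal_plus)
    finally show "len s - len t \<le> e" using e' len_mono[of a t] t sb
      by (subst (asm) ennreal_le_iff) (auto simp: e'_def)
  qed
qed

lemma continuous_on_len: "continuous_on {a..b} len"
  unfolding continuous_on_iff
proof (intro ballI allI impI)
  fix s e :: real assume s: "s \<in> {a..b}" and e: "0 < e"
  have "\<exists>d>0. \<forall>t\<in>{s..b}. t - s < d \<longrightarrow> len t - len s \<le> e / 2"
  proof (cases "s < b")
    case True then show ?thesis using len_right[of s "e/2"] s e by auto
  next
    case False then show ?thesis using s e by (intro exI[of _ 1]) auto
  qed
  then obtain d1 where d1: "0 < d1" "\<And>t. t \<in> {s..b} \<Longrightarrow> t - s < d1 \<Longrightarrow> len t - len s \<le> e/2" by auto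
  have "\<exists>d>0. \<forall>t\<in>{a..s}. s - t < d \<longrightarrow> len s - len t \<le> e / 2"
  proof (cases "a < s")
    case True then show ?thesis using len_left[of s "e/2"] s e by auto
  next
    case False then show ?thesis using s e by (intro exI[of _ 1]) auto
  qed
  then obtain d2 where d2: "0 < d2" "\<And>t. t \<in> {a..s} \<Longrightarrow> s - t < d2 \<Longrightarrow> len s - len t \<le> e/2" by auto
  show "\<exists>d>0. \<forall>x'\<in>{a..b}. dist x' s < d \<longrightarrow> dist (len x') (len s) < e"
  proof (intro exI[of _ "min d1 d2"] conjI ballI impI)
    fix t assume t: "t \<in> {a..b}" "dist t s < min d1 d2"
    show "dist (len t) (len s) < e"
    proof (cases "s \<le> t")
      case True
      then show ?thesis using d1(2)[of t] t s e len_mono[of s t] by (auto simp: dist_real_def)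
    next
      case False
      then show ?thesis using d2(2)[of t] t s e len_mono[of t s] by (auto simp: dist_real_def)
    qed
  qed (use d1 d2 in auto)
qed

lemma len_surj: "s \<in> {0..len b} \<Longrightarrow> \<exists>t\<in>{a..b}. len t = s"
  using IVT'[of len a s b] continuous_on_len le by auto

lemma arclength_domain_eq: "arclength_domain (a, b, \<gamma>) = {0..len b}"
  by (simp add: arclength_domain_def len_def)

lemma arclength_param_len:
  assumes t: "t \<in> {a..b}"
  shows "arclength_param (a, b, \<gamma>) (len t) = \<gamma> t"
proof -
  let ?P = "\<lambda>r. r \<in> {a..b} \<and> curve_length \<gamma> a r = ennreal (len t)"
  define r where "r = (SOME r. ?P r)"
  have "?P t" using t ennreal_len by simp
  then have r: "?P r" unfolding r_def by (rule someI)
  then have "ennreal (len r) = ennreal (len t)" using ennreal_len[of r] by simp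
  then have eq: "len r = len t"
    using len_mono[of a r] len_mono[of a t] r t by simp
  have "dist (\<gamma> r) (\<gamma> t) \<le> 0"
  proof (cases "r \<le> t")
    case True
    then show ?thesis using dist_le_len[of r t] eq r t by simp
  next
    case False
    then show ?thesis using dist_le_len[of t r] eq r t by (simp add: dist_commute)
  qed
  then show ?thesis by (simp add: arclength_param_def r_def)
qed

lemma arclength_param_lipschitz: "1-lipschitz_on {0..len b} (arclength_param (a, b, \<gamma>))"
proof (rule lipschitz_onI)
  fix x y assume x: "x \<in> {0..len b}" and y: "y \<in> {0..len b}"
  obtain s where s: "s \<in> {a..b}" "len s = x" using len_surj[OF x] by auto
  obtain t where t: "t \<in> {a..b}" "len t = y" using len_surj[OF y] by auto
  show "dist (arclength_param (a, b, \<gamma>) x) (arclength_param (a, b, \<gamma>) y) \<le> 1 * dist x y"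
    unfolding s(2)[symmetric] t(2)[symmetric] arclength_param_len[OF s(1)] arclength_param_len[OF t(1)]
  proof (cases "s \<le> t")
    case True
    then show "dist (\<gamma> s) (\<gamma> t) \<le> 1 * dist (len s) (len t)"
      using dist_le_len[of s t] s(1) t(1) by (simp add: dist_real_def)
  next
    case False
    then show "dist (\<gamma> s) (\<gamma> t) \<le> 1 * dist (len s) (len t)"
      using dist_le_len[of t s] s(1) t(1) by (simp add: dist_real_def dist_commute)
  qed
qed simp

lemma arclength_param_image: "arclength_param (a, b, \<gamma>) ` {0..len b} = \<gamma> ` {a..b}"
proof safe
  fix s assume "s \<in> {0..len b}"
  then obtain t where "t \<in> {a..b}" "len t = s" using len_surj by blast
  then show "arclength_param (a, b, \<gamma>) s \<in> \<gamma> ` {a..b}"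
    using arclength_param_len[of t] by (metis imageI)
next
  fix t assume t: "t \<in> {a..b}"
  then show "\<gamma> t \<in> arclength_param (a, b, \<gamma>) ` {0..len b}"
    using len_mono[of a t] len_mono[of t b]
    by (intro image_eqI[of _ _ "len t"] arclength_param_len[OF t, symmetric]) auto
qed

lemma sub_path: "a \<le> s \<Longrightarrow> s \<le> t \<Longrightarrow> t \<le> b \<Longrightarrow> rect_path s t \<gamma>"
  using cont finite_sub by unfold_locales (auto intro: continuous_on_subset)

end

section \<open>Line integrals and upper gradients\<close>

lemma e2ennreal_abs_diff: "e2ennreal \<bar>ereal x - ereal y\<bar> = ennreal \<bar>x - y\<bar>"
  by simp

context rect_path
begin

lemma arclength_param_in_image: "s \<in> {0..len b} \<Longrightarrow> arclength_param (a, b, \<gamma>) s \<in> \<gamma> ` {a..b}"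
  using arclength_param_image by blast

text \<open>This holds for arbitrary \<open>g\<close>, because completing a measure does not change
  any \<open>nn_integral\<close>.\<close>

lemma line_integral_eq:
  "line_integral (a, b, \<gamma>) g = (\<integral>\<^sup>+ s. g (arclength_param (a, b, \<gamma>) s) * indicator {0..len b} s \<partial>lborel)"
  unfolding line_integral_def arclength_domain_eq
  by (subst nn_integral_restrict_space) (auto simp: nn_integral_completion)

lemma measurable_arclength:
  assumes "\<gamma> ` {a..b} \<subseteq> \<Omega>" and g: "g \<in> borel_measurable (restrict_space borel \<Omega>)"
  shows "(\<lambda>s. (g (arclength_param (a, b, \<gamma>) s) :: ennreal) * indicator {0..len b} s) \<in> borel_measurable borel"
proof -
  have "arclength_param (a, b, \<gamma>) \<in> borel_measurable (restrict_space borel {0..len b})"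
    using arclength_param_lipschitz
    by (intro borel_measurable_continuous_on_restrict lipschitz_on_continuous_on)
  then have "arclength_param (a, b, \<gamma>) \<in> restrict_space borel {0..len b} \<rightarrow>\<^sub>M restrict_space borel \<Omega>"
    using assms(1) arclength_param_in_image
    by (intro measurable_restrict_space2) (force simp: space_restrict_space)+
  from measurable_comp[OF this g]
  show ?thesis by (subst (asm) borel_measurable_restrict_space_iff_ennreal) (auto simp: comp_def)
qed

lemma measurable_arclength_lborel:
  assumes "\<gamma> ` {a..b} \<subseteq> \<Omega>" and g: "g \<in> borel_measurable (restrict_space borel \<Omega>)"
  shows "(\<lambda>s. (g (arclength_param (a, b, \<gamma>) s) :: ennreal) * indicator {0..len b} s) \<in> borel_measurable lborel"
  using measurable_arclength[OF assms] by simp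

lemma line_integral_well_defined_borel:
  assumes "\<gamma> ` {a..b} \<subseteq> \<Omega>" and g: "g \<in> borel_measurable (restrict_space borel \<Omega>)"
  shows "line_integral_well_defined (a, b, \<gamma>) g"
proof -
  have "(\<lambda>s. g (arclength_param (a, b, \<gamma>) s) * indicator {0..len b} s) \<in> borel_measurable lborel"
    using measurable_arclength[OF assms] by simp
  then have *: "(\<lambda>s. g (arclength_param (a, b, \<gamma>) s) * indicator {0..len b} s) \<in> borel_measurable lebesgue"
    by (rule measurable_completion)
  have "{0..len b} \<inter> space lebesgue \<in> sets lebesgue" by simp
  from borel_measurable_restrict_space_iff_ennreal[OF this, THEN iffD2, OF *]
  show ?thesis unfolding line_integral_well_defined_def arclength_domain_eq .
qed

lemma len_sub:
  assumes "a \<le> s" "s \<le> t" "t \<le> b"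
  shows "rect_path.len s \<gamma> t = len t - len s"
proof -
  interpret S: rect_path s t \<gamma> using assms by (rule sub_path)
  show ?thesis
    using curve_length_eq_len[OF assms] len_mono[OF assms] by (simp add: S.len_def)
qed

lemma arclength_param_sub:
  assumes st: "a \<le> s" "s \<le> t" "t \<le> b" and x: "x \<in> {0..len t - len s}"
  shows "arclength_param (s, t, \<gamma>) x = arclength_param (a, b, \<gamma>) (len s + x)"
proof -
  interpret S: rect_path s t \<gamma> using st by (rule sub_path)
  have "x \<in> {0..S.len t}" using x len_sub[OF st] by simp
  then obtain r where r: "r \<in> {s..t}" "S.len r = x" using S.len_surj by blast
  have "S.len r = len r - len s" using len_sub[of s r] r st by simp
  then have "len s + x = len r" using r by simp
  then show ?thesis
    using S.arclength_param_len[OF r(1)] arclength_param_len[of r] r st by simp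
qed

text \<open>The arc length parametrization of a piece is a translate of that of the whole curve.
  Translation invariance of \<open>lborel\<close> therefore identifies the integral over the piece
  with the integral of the whole integrand over \<open>{len s..len t}\<close>.\<close>

lemma line_integral_sub:
  assumes st: "a \<le> s" "s \<le> t" "t \<le> b" and sub: "\<gamma> ` {s..t} \<subseteq> S" "\<gamma> ` {a..b} \<subseteq> \<Omega>"
    and g: "g \<in> borel_measurable (restrict_space borel \<Omega>)"
  shows "line_integral (s, t, \<gamma>) g \<le> line_integral (a, b, \<gamma>) (\<lambda>x. g x * indicator S x)"
proof -
  interpret S: rect_path s t \<gamma> using st by (rule sub_path)
  let ?A = "arclength_param (a, b, \<gamma>)"
  define G where "G x = g (?A x) * indicator {0..len b} x * indicator {len s..len t} x" for x
  have G: "G \<in> borel_measurable borel"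
    unfolding G_def by (rule borel_measurable_times_ennreal[OF measurable_arclength[OF sub(2) g]]) simp
  have m: "0 \<le> len s" "len s \<le> len t" "len t \<le> len b"
    using len_mono[of a s] len_mono[of s t] len_mono[of t b] st by auto
  have "line_integral (s, t, \<gamma>) g = (\<integral>\<^sup>+ x. G (len s + 1 * x) \<partial>lborel)"
    unfolding S.line_integral_eq len_sub[OF st]
  proof (rule nn_integral_cong)
    fix x
    show "g (arclength_param (s, t, \<gamma>) x) * indicator {0..len t - len s} x = G (len s + 1 * x)"
      using arclength_param_sub[OF st, of x] m by (auto simp: G_def indicator_def)
  qed
  also have "\<dots> = (\<integral>\<^sup>+ x. G x \<partial>lborel)"
    using nn_integral_real_affine[OF G, of 1 "len s"] by simp
  also have "\<dots> \<le> line_integral (a, b, \<gamma>) (\<lambda>x. g x * indicator S x)"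
    unfolding line_integral_eq
  proof (rule nn_integral_mono)
    fix x
    have "?A x \<in> S" if x: "x \<in> {len s..len t}"
    proof -
      have "arclength_param (s, t, \<gamma>) (x - len s) \<in> \<gamma> ` {s..t}"
        using x len_sub[OF st] by (intro S.arclength_param_in_image) auto
      then have "arclength_param (s, t, \<gamma>) (x - len s) \<in> S" using sub(1) by blast
      then show ?thesis using arclength_param_sub[OF st, of "x - len s"] x by simp
    qed
    then show "G x \<le> g (?A x) * indicator S (?A x) * indicator {0..len b} x"
      by (auto simp: G_def indicator_def)
  qed
  finally show ?thesis .
qed

lemma line_integral_mono:
  assumes "\<And>x. x \<in> \<gamma> ` {a..b} \<Longrightarrow> g x \<le> g' x"
  shows "line_integral (a, b, \<gamma>) g \<le> line_integral (a, b, \<gamma>) g'"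
  unfolding line_integral_eq using assms[OF arclength_param_in_image]
  by (intro nn_integral_mono) (auto simp: indicator_def)

lemma line_integral_const: "line_integral (a, b, \<gamma>) (\<lambda>_. c) = c * ennreal (len b)"
  unfolding line_integral_eq using len_mono[of a b] le by (simp add: nn_integral_cmult_indicator)

end

lemma paths_in_rect_path: "(a, b, \<gamma>) \<in> paths_in \<Omega> \<Longrightarrow> rect_path a b \<gamma>"
  by (simp add: paths_in_def rect_path_def)

lemma paths_in_image: "(a, b, \<gamma>) \<in> paths_in \<Omega> \<Longrightarrow> \<gamma> ` {a..b} \<subseteq> \<Omega>"
  by (simp add: paths_in_def)

lemma paths_in_mono: "\<Omega> \<subseteq> \<Omega>' \<Longrightarrow> paths_in \<Omega> \<subseteq> paths_in \<Omega>'"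
  by (auto simp: paths_in_def)

lemma paths_in_sub:
  assumes "(a, b, \<gamma>) \<in> paths_in \<Omega>'" "a \<le> s" "s \<le> t" "t \<le> b" "\<gamma> s \<noteq> \<gamma> t" "\<gamma> ` {s..t} \<subseteq> \<Omega>"
  shows "(s, t, \<gamma>) \<in> paths_in \<Omega>"
proof -
  interpret rect_path a b \<gamma> using assms(1) by (rule paths_in_rect_path)
  interpret S: rect_path s t \<gamma> using assms by (intro sub_path)
  have "\<not> \<gamma> constant_on {s..t}"
    using assms(3,5) unfolding constant_on_def by (metis atLeastAtMost_iff order_refl)
  then show ?thesis using assms S.cont S.fin by (auto simp: paths_in_def)
qed

lemma upper_gradient_real_iff:
  "upper_gradient \<Omega> (\<lambda>x. ereal (v x)) g \<longleftrightarrow>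
     g \<in> borel_measurable (restrict_space borel \<Omega>) \<and>
     (\<forall>a b \<gamma>. (a, b, \<gamma>) \<in> paths_in \<Omega> \<longrightarrow> ennreal \<bar>v (\<gamma> a) - v (\<gamma> b)\<bar> \<le> line_integral (a, b, \<gamma>) g)"
  by (auto simp: upper_gradient_def upper_gradient_inequality_def e2ennreal_abs_diff simp del: ereal_minus)

lemma upper_gradient_measurable:
  "upper_gradient \<Omega> u g \<Longrightarrow> g \<in> borel_measurable (restrict_space borel \<Omega>)"
  by (simp add: upper_gradient_def)

lemma upper_gradient_realD:
  "upper_gradient \<Omega> (\<lambda>x. ereal (v x)) g \<Longrightarrow> (a, b, \<gamma>) \<in> paths_in \<Omega> \<Longrightarrow>
     ennreal \<bar>v (\<gamma> a) - v (\<gamma> b)\<bar> \<le> line_integral (a, b, \<gamma>) g"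
  by (simp add: upper_gradient_real_iff)

lemma upper_gradient_mono_set:
  assumes "upper_gradient \<Omega>' u g" "\<Omega> \<subseteq> \<Omega>'"
  shows "upper_gradient \<Omega> u g"
  using measurable_restrict_mono[OF upper_gradient_measurable[OF assms(1)] assms(2)]
    assms(1) paths_in_mono[OF assms(2)] unfolding upper_gradient_def by blast

lemma upper_gradient_mono:
  assumes u: "upper_gradient \<Omega> u g" and g': "g' \<in> borel_measurable (restrict_space borel \<Omega>)"
    and gg': "\<And>x. x \<in> \<Omega> \<Longrightarrow> g x \<le> g' x"
  shows "upper_gradient \<Omega> u g'"
  unfolding upper_gradient_def
proof (intro conjI ballI)
  fix c assume c: "c \<in> paths_in \<Omega>"
  obtain a b \<gamma> where c': "c = (a, b, \<gamma>)" by (cases c)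
  have ab: "(a, b, \<gamma>) \<in> paths_in \<Omega>" using c unfolding c' by simp
  interpret rect_path a b \<gamma> using ab by (rule paths_in_rect_path)
  have "line_integral c g \<le> line_integral c g'"
    unfolding c' using paths_in_image[OF ab] by (intro line_integral_mono gg') blast
  moreover have "upper_gradient_inequality u g c" using u c by (simp add: upper_gradient_def)
  ultimately show "upper_gradient_inequality u g' c"
    by (auto simp: upper_gradient_inequality_def c' top_unique split: if_splits)
qed (rule g')

text \<open>The exceptional family is empty, and the density 0 shows that its modulus vanishes. The
  remaining point is that the trace of a Borel set on \<Omega> is also the trace of a set of
  \<open>M\<close>.\<close>

lemma upper_gradient_imp_weak:
  assumes "upper_gradient \<Omega> u g" "sets borel \<subseteq> sets M"
  shows "weak_upper_gradient M \<Omega> u g"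
  unfolding weak_upper_gradient_def
proof (intro conjI exI[of _ "{}"])
  show "g \<in> borel_measurable (restrict_space M \<Omega>)"
  proof (rule measurableI)
    show "g -` A \<inter> space (restrict_space M \<Omega>) \<in> sets (restrict_space M \<Omega>)" if "A \<in> sets borel" for A
    proof -
      have "g -` A \<inter> \<Omega> \<in> sets (restrict_space borel \<Omega>)"
        using measurable_sets[OF upper_gradient_measurable[OF assms(1)] that]
        by (simp add: space_restrict_space)
      then obtain B where B: "B \<in> sets borel" "g -` A \<inter> \<Omega> = \<Omega> \<inter> B"
        by (auto simp: sets_restrict_space)
      have "B \<in> sets M" using B assms by auto
      moreover have "g -` A \<inter> space (restrict_space M \<Omega>) = \<Omega> \<inter> B"
        using B sets.sets_into_space[OF \<open>B \<in> sets M\<close>] by (auto simp: space_restrict_space)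
      ultimately show ?thesis by (auto simp: sets_restrict_space)
    qed
  qed auto
  show "modulus1 M \<Omega> {} = 0"
  proof -
    have "modulus1 M \<Omega> {} \<le> (\<integral>\<^sup>+x\<in>\<Omega>. 0 \<partial>M)"
      unfolding modulus1_def by (rule INF_lower) auto
    then show ?thesis by simp
  qed
  show "\<forall>c\<in>paths_in \<Omega> - {}. line_integral_well_defined c g \<and> upper_gradient_inequality u g c"
  proof (intro ballI conjI)
    fix c assume c: "c \<in> paths_in \<Omega> - {}"
    obtain a b \<gamma> where c': "c = (a, b, \<gamma>)" by (cases c)
    have ab: "(a, b, \<gamma>) \<in> paths_in \<Omega>" using c unfolding c' by simp
    interpret rect_path a b \<gamma> using ab by (rule paths_in_rect_path)
    show "line_integral_well_defined c g"
      unfolding c' by (rule line_integral_well_defined_borel[OF paths_in_image[OF ab] upper_gradient_measurable[OF assms(1)]])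
    show "upper_gradient_inequality u g c" using c assms(1) by (simp add: upper_gradient_def)
  qed
qed auto

text \<open>The curve may leave \<Omega> outside \<open>{s..t}\<close>; only the piece inside
  \<open>S\<close> is tested, and its integral is a part of the integral over the whole curve. If
  the endpoints of the piece coincide, it need not be a path, but then the left side is 0.\<close>

lemma upper_gradient_subpath:
  assumes u: "upper_gradient \<Omega> (\<lambda>x. ereal (v x)) g" and c: "(a, b, \<gamma>) \<in> paths_in \<Omega>'"
    and st: "a \<le> s" "s \<le> t" "t \<le> b" and S: "\<gamma> ` {s..t} \<subseteq> S" "S \<subseteq> \<Omega>"
    and g': "g' \<in> borel_measurable (restrict_space borel \<Omega>')" "\<And>x. x \<in> S \<Longrightarrow> g x \<le> g' x"
  shows "ennreal \<bar>v (\<gamma> s) - v (\<gamma> t)\<bar> \<le> line_integral (a, b, \<gamma>) g'"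
proof (cases "\<gamma> s = \<gamma> t")
  case False
  interpret rect_path a b \<gamma> using c by (rule paths_in_rect_path)
  interpret S: rect_path s t \<gamma> using st by (intro sub_path)
  have "(s, t, \<gamma>) \<in> paths_in \<Omega>"
    using paths_in_sub[OF c st False] S by (meson order_trans)
  then have "ennreal \<bar>v (\<gamma> s) - v (\<gamma> t)\<bar> \<le> line_integral (s, t, \<gamma>) g"
    by (rule upper_gradient_realD[OF u])
  also have "\<dots> \<le> line_integral (s, t, \<gamma>) g'"
    using S g'(2) by (intro S.line_integral_mono) auto
  also have "\<dots> \<le> line_integral (a, b, \<gamma>) (\<lambda>x. g' x * indicator UNIV x)"
    using line_integral_sub[OF st _ paths_in_image[OF c] g'(1), of UNIV] by simp
  finally show ?thesis by simp
qed simp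

lemma upper_gradient_uminus:
  "upper_gradient \<Omega> (\<lambda>x. ereal (v x)) g \<Longrightarrow> upper_gradient \<Omega> (\<lambda>x. ereal (- v x)) g"
  unfolding upper_gradient_real_iff by (simp add: abs_minus_commute)

section \<open>Passage times and truncation of functions with an upper gradient\<close>

lemma first_passage:
  fixes f :: "real \<Rightarrow> real"
  assumes "a \<le> c" "continuous_on {a..c} f" "f a \<le> e" "e \<le> f c"
  obtains s where "a \<le> s" "s \<le> c" "f s = e" "\<And>r. r \<in> {a..s} \<Longrightarrow> f r \<le> e"
proof -
  define T where "T = {r\<in>{a..c}. f r = e}"
  have "closed T" unfolding T_def using assms by (intro continuous_closed_preimage_constant) auto
  then have "compact T" unfolding compact_eq_bounded_closed
    by (auto simp: T_def intro!: bounded_subset[OF bounded_closed_interval[of a c]])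
  moreover have "T \<noteq> {}" using IVT'[of f a e c] assms by (auto simp: T_def)
  ultimately obtain s where s: "s \<in> T" "\<And>r. r \<in> T \<Longrightarrow> s \<le> r"
    using compact_attains_inf[of T] by blast
  have "f r \<le> e" if r: "r \<in> {a..s}" for r
  proof (rule ccontr)
    assume "\<not> f r \<le> e"
    then obtain r' where r': "r' \<ge> a" "r' \<le> r" "f r' = e"
      using IVT'[of f a e r] assms r s(1) continuous_on_subset[OF assms(2), of "{a..r}"] by (auto simp: T_def)
    then have "r' \<in> T" using r s(1) by (auto simp: T_def)
    then have "r = s" using s(2)[of r'] r r' by auto
    then show False using \<open>\<not> f r \<le> e\<close> s(1) by (simp add: T_def)
  qed
  then show ?thesis using that s(1) by (auto simp: T_def)
qed

lemma last_passage:
  fixes f :: "real \<Rightarrow> real"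
  assumes "c \<le> b" "continuous_on {c..b} f" "f b \<le> e" "e \<le> f c"
  obtains s where "c \<le> s" "s \<le> b" "f s = e" "\<And>r. r \<in> {s..b} \<Longrightarrow> f r \<le> e"
proof -
  have "continuous_on {- b..- c} (\<lambda>r. f (- r))"
    using assms by (intro continuous_on_compose2[OF assms(2)] continuous_intros) auto
  then obtain s where s: "- b \<le> s" "s \<le> - c" "f (- s) = e" "\<And>r. r \<in> {- b..s} \<Longrightarrow> f (- r) \<le> e"
    using first_passage[of "- b" "- c" "\<lambda>r. f (- r)" e] assms by auto
  show ?thesis
  proof (rule that[of "- s"])
    fix r assume "r \<in> {- s..b}"
    then show "f r \<le> e" using s(4)[of "- r"] by simp
  qed (use s in auto)
qed

text \<open>Only the part of a curve between the last passage at the lower level and the first passage at the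
  upper level matters.\<close>

lemma upper_gradient_clamp:
  assumes u: "upper_gradient \<Omega> (\<lambda>x. ereal (v x)) g" and v: "continuous_on \<Omega> v" and lh: "l \<le> h"
    and g': "g' \<in> borel_measurable (restrict_space borel \<Omega>)"
      "\<And>x. x \<in> \<Omega> \<Longrightarrow> l \<le> v x \<Longrightarrow> v x \<le> h \<Longrightarrow> g x \<le> g' x"
  shows "upper_gradient \<Omega> (\<lambda>x. ereal (max l (min h (v x)))) g'"
proof -
  have main: "ennreal (max l (min h (v (\<gamma> b))) - max l (min h (v (\<gamma> a)))) \<le> line_integral (a, b, \<gamma>) g'"
    if u: "upper_gradient \<Omega> (\<lambda>x. ereal (v x)) g" and v: "continuous_on \<Omega> v" and lh: "l \<le> h"
      and g'2: "\<And>x. x \<in> \<Omega> \<Longrightarrow> l \<le> v x \<Longrightarrow> v x \<le> h \<Longrightarrow> g x \<le> g' x"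
      and c: "(a, b, \<gamma>) \<in> paths_in \<Omega>"
      and lt: "max l (min h (v (\<gamma> a))) < max l (min h (v (\<gamma> b)))" for v l h a b \<gamma>
  proof -
    interpret rect_path a b \<gamma> using c by (rule paths_in_rect_path)
    define \<alpha> where "\<alpha> = max l (min h (v (\<gamma> a)))"
    define \<beta> where "\<beta> = max l (min h (v (\<gamma> b)))"
    define f where "f = v \<circ> \<gamma>"
    have f: "continuous_on {a..b} f"
      unfolding f_def using continuous_on_subset[OF v paths_in_image[OF c]] cont
      by (intro continuous_on_compose)
    \<comment> \<open>As \<open>\<alpha> < \<beta>\<close>, the value \<alpha> lies below
      \<open>h\<close> and \<beta> lies above \<open>l\<close>; hence clamping can only have raised
      the value at \<open>a\<close> and only have lowered the value at \<open>b\<close>.\<close>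
    have ab: "l \<le> \<alpha>" "\<alpha> < \<beta>" "\<beta> \<le> h" "f a \<le> \<alpha>" "\<beta> \<le> f b"
      using lt lh by (auto simp: \<alpha>_def \<beta>_def f_def max_def min_def split: if_splits)
    obtain t where tb: "a \<le> t" "t \<le> b" "f t = \<beta>" and ft: "\<And>r. r \<in> {a..t} \<Longrightarrow> f r \<le> \<beta>"
      using first_passage[OF le f, of \<beta>] ab by auto
    have "continuous_on {a..t} (\<lambda>r. - f r)"
      using continuous_on_subset[OF f, of "{a..t}"] tb by (intro continuous_intros) auto
    then obtain s where sb: "a \<le> s" "s \<le> t" "f s = \<alpha>" and fs: "\<And>r. r \<in> {s..t} \<Longrightarrow> \<alpha> \<le> f r"
      using last_passage[of a t "\<lambda>r. - f r" "- \<alpha>"] ab tb by auto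
    have "ennreal \<bar>v (\<gamma> s) - v (\<gamma> t)\<bar> \<le> line_integral (a, b, \<gamma>) g'"
    proof (rule upper_gradient_subpath[OF u c sb(1,2) tb(2) order_refl _ g'(1)])
      show sub: "\<gamma> ` {s..t} \<subseteq> \<Omega>" using paths_in_image[OF c] sb tb by auto
      fix x assume x: "x \<in> \<gamma> ` {s..t}"
      then obtain r where "r \<in> {s..t}" "x = \<gamma> r" by auto
      then show "g x \<le> g' x" using fs[of r] ft[of r] ab sub x sb by (intro g'2) (auto simp: f_def)
    qed
    then show ?thesis unfolding \<alpha>_def[symmetric] \<beta>_def[symmetric]
      using sb(3) tb(3) ab(2) by (simp add: f_def)
  qed
  show ?thesis
    unfolding upper_gradient_real_iff
  proof (intro conjI allI impI)
    fix a b \<gamma> assume c: "(a, b, \<gamma>) \<in> paths_in \<Omega>"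
    let ?w = "\<lambda>x. max l (min h (v x))"
    consider "?w (\<gamma> a) < ?w (\<gamma> b)" | "?w (\<gamma> b) < ?w (\<gamma> a)" | "?w (\<gamma> a) = ?w (\<gamma> b)" by linarith
    then show "ennreal \<bar>?w (\<gamma> a) - ?w (\<gamma> b)\<bar> \<le> line_integral (a, b, \<gamma>) g'"
    proof cases
      case 1
      then show ?thesis using main[OF u v lh g'(2) c 1] by simp
    next
      case 2
      \<comment> \<open>Negation exchanges the two levels, so the decreasing case is the increasing
        case for \<open>- v\<close>.\<close>
      have neg: "max (- h) (min (- l) (- v x)) = - ?w x" for x using lh by (auto simp: max_def min_def)
      have "ennreal (max (- h) (min (- l) (- v (\<gamma> b))) - max (- h) (min (- l) (- v (\<gamma> a)))) \<le> line_integral (a, b, \<gamma>) g'"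
        using 2 lh v g'(2) unfolding neg[symmetric]
        by (intro main upper_gradient_uminus[OF u] c continuous_intros) (auto simp: neg)
      moreover have "\<bar>?w (\<gamma> a) - ?w (\<gamma> b)\<bar> = max (- h) (min (- l) (- v (\<gamma> b))) - max (- h) (min (- l) (- v (\<gamma> a)))"
        unfolding neg using 2 by linarith
      ultimately show ?thesis by simp
    next
      case 3
      then show ?thesis by simp
    qed
  qed (rule g'(1))
qed

section \<open>Increments along curves and pointwise Lipschitz bounds\<close>

text \<open>A Riemann sum argument replaces differentiating \<open>f\<close>.\<close>

lemma increment_le_nn_integral:
  fixes f h :: "real \<Rightarrow> real"
  assumes L: "0 \<le> L" and h: "continuous_on {0..L} h" and \<delta>: "0 < \<delta>"
    and h0: "\<And>s. s \<in> {0..L} \<Longrightarrow> 0 \<le> h s"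
    and f: "\<And>s t. 0 \<le> s \<Longrightarrow> s \<le> t \<Longrightarrow> t \<le> L \<Longrightarrow> t - s \<le> \<delta> \<Longrightarrow> \<exists>r\<in>{s..t}. \<bar>f t - f s\<bar> \<le> h r * (t - s)"
  shows "ennreal \<bar>f L - f 0\<bar> \<le> (\<integral>\<^sup>+ s. ennreal (h s) * indicator {0..L} s \<partial>lborel)"
proof (rule ennreal_le_epsilon)
  fix e :: real assume e: "0 < e"
  \<comment> \<open>The accumulated error is \<open>e' * L\<close>; the summand 1 takes care of
    \<open>L = 0\<close>.\<close>
  define e' where "e' = e / (L + 1)"
  have e': "0 < e'" using e L by (simp add: e'_def)
  have "uniformly_continuous_on {0..L} h" using h by (intro compact_uniformly_continuous) auto
  then obtain d where d: "0 < d" "\<And>s t. s \<in> {0..L} \<Longrightarrow> t \<in> {0..L} \<Longrightarrow> dist t s < d \<Longrightarrow> dist (h t) (h s) < e'"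
    using e' unfolding uniformly_continuous_on_def by metis
  \<comment> \<open>Steps of length \<open>L / N\<close> have to be at most \<delta>, so that the
    hypothesis on increments applies, and below \<open>d\<close>, so that \<open>h\<close> varies by
    less than \<open>e'\<close> on each of them.\<close>
  obtain N :: nat where N: "L / min (d/2) \<delta> < real N" using reals_Archimedean2 by blast
  have N0: "0 < N" using N L d \<delta> by (cases N) (auto simp: divide_less_0_iff min_def split: if_splits)
  have "0 < min (d/2) \<delta>" using d \<delta> by simp
  then have "L < real N * min (d/2) \<delta>" using N pos_divide_less_eq by blast
  then have "L < min (d/2) \<delta> * real N" by (simp only: mult.commute)
  then have "L / N < min (d/2) \<delta>" using N0 pos_divide_less_eq[of "real N"] by (metis of_nat_0_less_iff)
  then have step: "L / N \<le> min (d/2) \<delta>" by (rule less_imp_le)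
  define t where "t i = L * real i / N" for i
  have mt: "(\<lambda>s. ennreal (h s + e') * indicator {0..L} s) \<in> borel_measurable borel"
  proof -
    have "(\<lambda>s. ennreal (h s + e')) \<in> borel_measurable (restrict_space borel {0..L})"
      using h by (intro measurable_compose[OF _ measurable_ennreal] borel_measurable_continuous_on_restrict continuous_intros)
    then show ?thesis by (subst (asm) borel_measurable_restrict_space_iff_ennreal) auto
  qed
  let ?H = "\<lambda>s. ennreal (h s + e') * indicator {0..L} s"
  have "ennreal \<bar>f (t i) - f 0\<bar> \<le> (\<integral>\<^sup>+ s. ?H s * indicator {0..<t i} s \<partial>lborel)" if "i \<le> N" for i
    using that
  proof (induction i)
    case (Suc i)
    have ti: "0 \<le> t i" "t i \<le> t (Suc i)" "t (Suc i) \<le> L" "t (Suc i) - t i = L / N"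
      using Suc.prems L N0 mult_left_mono[of "real (Suc i)" "real N" L]
      by (auto simp: t_def field_simps)
    then obtain r where r: "r \<in> {t i..t (Suc i)}" "\<bar>f (t (Suc i)) - f (t i)\<bar> \<le> h r * (t (Suc i) - t i)"
      using f[of "t i" "t (Suc i)"] step by auto
    have "ennreal \<bar>f (t (Suc i)) - f (t i)\<bar> \<le> ennreal (h r) * ennreal (t (Suc i) - t i)"
      using r ti h0[of r] by (subst ennreal_mult[symmetric]) (auto intro!: ennreal_leI)
    also have "\<dots> = (\<integral>\<^sup>+ s. ennreal (h r) * indicator {t i..<t (Suc i)} s \<partial>lborel)"
      using ti by (simp add: nn_integral_cmult_indicator)
    also have "\<dots> \<le> (\<integral>\<^sup>+ s. ?H s * indicator {t i..<t (Suc i)} s \<partial>lborel)"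
    proof (rule nn_integral_mono)
      fix s
      have "h r \<le> h s + e'" if "s \<in> {t i..<t (Suc i)}"
      proof -
        have "dist r s \<le> L / N" using r that ti by (auto simp: dist_real_def)
        moreover have "L / N \<le> d / 2" using step by linarith
        ultimately have "dist r s < d" using d(1) by linarith
        then have "dist (h r) (h s) < e'" using r that ti by (intro d(2)) auto
        then show ?thesis by (auto simp: dist_real_def)
      qed
      then show "ennreal (h r) * indicator {t i..<t (Suc i)} s \<le> ?H s * indicator {t i..<t (Suc i)} s"
        using ti by (auto simp: indicator_def intro: ennreal_leI)
    qed
    finally have 1: "ennreal \<bar>f (t (Suc i)) - f (t i)\<bar> \<le> (\<integral>\<^sup>+ s. ?H s * indicator {t i..<t (Suc i)} s \<partial>lborel)" .
    have "ennreal \<bar>f (t (Suc i)) - f 0\<bar> \<le> ennreal \<bar>f (t i) - f 0\<bar> + ennreal \<bar>f (t (Suc i)) - f (t i)\<bar>"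
      by (simp flip: ennreal_plus add: ennreal_leI)
    also have "\<dots> \<le> (\<integral>\<^sup>+ s. ?H s * indicator {0..<t i} s \<partial>lborel) + (\<integral>\<^sup>+ s. ?H s * indicator {t i..<t (Suc i)} s \<partial>lborel)"
      using Suc 1 by (intro add_mono) auto
    also have "\<dots> = (\<integral>\<^sup>+ s. ?H s * indicator {0..<t i} s + ?H s * indicator {t i..<t (Suc i)} s \<partial>lborel)"
      using borel_measurable_times_ennreal[OF mt] by (intro nn_integral_add[symmetric]) simp_all
    also have "\<dots> = (\<integral>\<^sup>+ s. ?H s * indicator {0..<t (Suc i)} s \<partial>lborel)"
      using ti by (intro nn_integral_cong) (auto simp: indicator_def)
    finally show ?case .
  qed (simp add: t_def)
  from this[of N] have "ennreal \<bar>f L - f 0\<bar> \<le> (\<integral>\<^sup>+ s. ?H s * indicator {0..<L} s \<partial>lborel)"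
    using N0 by (simp add: t_def)
  also have "\<dots> \<le> (\<integral>\<^sup>+ s. ennreal (h s) * indicator {0..L} s + ennreal e' * indicator {0..L} s \<partial>lborel)"
    using h0 e' by (intro nn_integral_mono) (auto simp: indicator_def ennreal_plus)
  also have "\<dots> = (\<integral>\<^sup>+ s. ennreal (h s) * indicator {0..L} s \<partial>lborel) + (\<integral>\<^sup>+ s. ennreal e' * indicator {0..L} s \<partial>lborel)"
  proof (rule nn_integral_add)
    have "(\<lambda>s. ennreal (h s)) \<in> borel_measurable (restrict_space borel {0..L})"
      using h by (intro measurable_compose[OF _ measurable_ennreal] borel_measurable_continuous_on_restrict continuous_intros)
    then show "(\<lambda>s. ennreal (h s) * indicator {0..L} s) \<in> borel_measurable lborel"
      by (subst (asm) borel_measurable_restrict_space_iff_ennreal) auto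
  qed auto
  also have "(\<integral>\<^sup>+ s. ennreal e' * indicator {0..L} s \<partial>lborel) = ennreal (e' * L)"
    using L e' by (simp add: nn_integral_cmult_indicator ennreal_mult)
  also have "ennreal (e' * L) \<le> ennreal e"
    using L e by (intro ennreal_leI) (auto simp: e'_def field_simps)
  finally show "ennreal \<bar>f L - f 0\<bar> \<le> (\<integral>\<^sup>+ s. ennreal (h s) * indicator {0..L} s \<partial>lborel) + ennreal e"
    by (auto simp: add_left_mono)
qed

text \<open>Composed with the 1-Lipschitz arc length parametrization, \<open>v\<close> satisfies the
  increment bound of \<open>increment_le_nn_integral\<close>, where \<open>r\<close> is the endpoint
  at which \<open>h\<close> is larger. The bound by a maximum is the form in which it holds for
  \<open>chain_dist\<close>.\<close>

lemma upper_gradient_pointwise_lipschitz: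
  fixes v h :: "'a::metric_space \<Rightarrow> real"
  assumes h: "continuous_on UNIV h" "\<And>x. 0 \<le> h x" and \<delta>: "0 < \<delta>"
    and v: "\<And>x y. dist x y \<le> \<delta> \<Longrightarrow> \<bar>v x - v y\<bar> \<le> max (h x) (h y) * dist x y"
  shows "upper_gradient UNIV (\<lambda>x. ereal (v x)) (\<lambda>x. ennreal (h x))"
  unfolding upper_gradient_real_iff
proof (intro conjI allI impI)
  show "(\<lambda>x. ennreal (h x)) \<in> borel_measurable (restrict_space borel UNIV)"
    using borel_measurable_continuous_onI[OF h(1)] by (intro measurable_restrict_space1) auto
  fix a b and \<gamma> :: "real \<Rightarrow> 'a" assume c: "(a, b, \<gamma>) \<in> paths_in UNIV"
  interpret rect_path a b \<gamma> using c by (rule paths_in_rect_path)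
  let ?A = "arclength_param (a, b, \<gamma>)"
  have A: "continuous_on {0..len b} ?A"
    using arclength_param_lipschitz by (rule lipschitz_on_continuous_on)
  have "ennreal \<bar>v (?A (len b)) - v (?A 0)\<bar> \<le> (\<integral>\<^sup>+ s. ennreal (h (?A s)) * indicator {0..len b} s \<partial>lborel)"
  proof (rule increment_le_nn_integral[OF _ _ \<delta>])
    show "0 \<le> len b" using len_mono[of a b] le by simp
    show "continuous_on {0..len b} (\<lambda>s. h (?A s))"
      using continuous_on_compose2[OF h(1) A] by auto
    fix s t assume st: "0 \<le> s" "s \<le> t" "t \<le> len b" "t - s \<le> \<delta>"
    have d: "dist (?A t) (?A s) \<le> t - s"
      using lipschitz_onD[OF arclength_param_lipschitz, of t s] st by (simp add: dist_real_def)
    have "\<bar>v (?A t) - v (?A s)\<bar> \<le> max (h (?A t)) (h (?A s)) * dist (?A t) (?A s)"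
      using d st by (intro v) simp
    also have "\<dots> \<le> max (h (?A t)) (h (?A s)) * (t - s)"
      using d h(2) by (intro mult_left_mono) (auto simp: le_max_iff_disj)
    finally have "\<bar>v (?A t) - v (?A s)\<bar> \<le> max (h (?A t)) (h (?A s)) * (t - s)" .
    then show "\<exists>r\<in>{s..t}. \<bar>v (?A t) - v (?A s)\<bar> \<le> h (?A r) * (t - s)"
      using st by (cases "h (?A t) \<le> h (?A s)") (auto simp: max_def)
  qed (rule h(2))
  then show "ennreal \<bar>v (\<gamma> a) - v (\<gamma> b)\<bar> \<le> line_integral (a, b, \<gamma>) (\<lambda>x. ennreal (h x))"
    using arclength_param_len[of a] arclength_param_len[of b] le
    by (simp add: line_integral_eq abs_minus_commute)
qed

lemma upper_gradient_lipschitz: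
  assumes "L-lipschitz_on UNIV v"
  shows "upper_gradient UNIV (\<lambda>x. ereal (v x)) (\<lambda>_. ennreal L)"
  using lipschitz_onD[OF assms] lipschitz_on_nonneg[OF assms]
  by (intro upper_gradient_pointwise_lipschitz[of "\<lambda>_. L" 1]) (auto simp: dist_real_def)

text \<open>A limit of chains comes with a 1-Lipschitz parametrization that may be slower than arc
  length, or even pause; such a parametrization can only make the integral larger. In the proof
  \<open>f\<close> is the line integral up to time \<open>t\<close>. Its increment over
  \<open>{s..t}\<close> is at most the maximum of \<open>h\<close> there times
  \<open>len t - len s\<close>, and the latter is at most \<open>t - s\<close>.\<close>

lemma line_integral_le_of_lipschitz:
  fixes \<gamma> :: "real \<Rightarrow> 'a::metric_space" and h :: "'a \<Rightarrow> real"
  assumes L: "0 \<le> L" and lip: "1-lipschitz_on {0..L} \<gamma>"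
    and h: "continuous_on UNIV h" "\<And>x. 0 \<le> h x"
  shows "line_integral (0, L, \<gamma>) (\<lambda>x. ennreal (h x)) \<le> (\<integral>\<^sup>+ s. ennreal (h (\<gamma> s)) * indicator {0..L} s \<partial>lborel)"
proof -
  interpret rect_path 0 L \<gamma>
    using L lipschitz_on_continuous_on[OF lip] curve_length_lipschitz[OF L lip]
    by unfold_locales (auto intro: le_less_trans)
  let ?A = "arclength_param (0, L, \<gamma>)"
  have A: "continuous_on {0..len L} ?A"
    using arclength_param_lipschitz by (rule lipschitz_on_continuous_on)
  have hA: "continuous_on {0..len L} (\<lambda>s. h (?A s))"
    using continuous_on_compose2[OF h(1) A] by auto
  have h\<gamma>: "continuous_on {0..L} (\<lambda>s. h (\<gamma> s))"
    using continuous_on_compose2[OF h(1) cont] by auto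
  have int: "(\<lambda>s. h (?A s)) integrable_on {x..y}" if "0 \<le> x" "y \<le> len L" for x y
    using that by (intro integrable_continuous_real continuous_on_subset[OF hA]) auto
  define f where "f t = integral {0..len t} (\<lambda>s. h (?A s))" for t
  have "ennreal \<bar>f L - f 0\<bar> \<le> (\<integral>\<^sup>+ s. ennreal (h (\<gamma> s)) * indicator {0..L} s \<partial>lborel)"
  proof (rule increment_le_nn_integral[OF L h\<gamma> zero_less_one])
    fix s t assume st: "0 \<le> s" "s \<le> t" "t \<le> L"
    have m: "0 \<le> len s" "len s \<le> len t" "len t \<le> len L"
      using len_mono[of 0 s] len_mono[of s t] len_mono[of t L] st by auto
    obtain r where r: "r \<in> {s..t}" "\<And>r'. r' \<in> {s..t} \<Longrightarrow> h (\<gamma> r') \<le> h (\<gamma> r)"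
      using continuous_attains_sup[of "{s..t}" "\<lambda>s. h (\<gamma> s)"] continuous_on_subset[OF h\<gamma>, of "{s..t}"] st by auto
    have bd: "h (?A x) \<le> h (\<gamma> r)" if x: "x \<in> {len s..len t}" for x
    proof -
      obtain q where q: "q \<in> {s..t}" "len q = x"
        using IVT'[of len s x t] x st continuous_on_subset[OF continuous_on_len, of "{s..t}"] by auto
      then have "?A x = \<gamma> q" using arclength_param_len[of q] st by auto
      then show ?thesis using r(2)[OF q(1)] by simp
    qed
    have "f t - f s = integral {len s..len t} (\<lambda>s. h (?A s))"
      using Henstock_Kurzweil_Integration.integral_combine[of 0 "len s" "len t" "\<lambda>s. h (?A s)"] m int
      by (simp add: f_def)
    moreover have "0 \<le> integral {len s..len t} (\<lambda>s. h (?A s))"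
      using m int h by (intro integral_nonneg) auto
    moreover have "integral {len s..len t} (\<lambda>s. h (?A s)) \<le> integral {len s..len t} (\<lambda>s. h (\<gamma> r))"
      using m int bd by (intro integral_le) auto
    moreover have "integral {len s..len t} (\<lambda>s. h (\<gamma> r)) = (len t - len s) * h (\<gamma> r)"
      using m by simp
    moreover have "len t - len s \<le> t - s"
    proof -
      have "ennreal (len t - len s) \<le> ennreal (1 * (t - s))"
        unfolding curve_length_eq_len[OF st, symmetric]
        using st by (intro curve_length_lipschitz lipschitz_on_subset[OF lip]) auto
      then show ?thesis using st by simp
    qed
    ultimately have "\<bar>f t - f s\<bar> \<le> (t - s) * h (\<gamma> r)"
      using mult_right_mono[OF \<open>len t - len s \<le> t - s\<close> h(2)[of "\<gamma> r"]] by linarith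
    then show "\<exists>r\<in>{s..t}. \<bar>f t - f s\<bar> \<le> h (\<gamma> r) * (t - s)"
      using r by (auto simp: mult.commute)
  qed (rule h(2))
  moreover have "f 0 = 0" by (simp add: f_def)
  moreover have "0 \<le> f L" unfolding f_def using int h by (intro integral_nonneg) auto
  moreover have "line_integral (0, L, \<gamma>) (\<lambda>x. ennreal (h x)) = ennreal (f L)"
  proof -
    have "((\<lambda>s. h (?A s)) has_integral f L) {0..len L}"
      unfolding f_def using int[of 0 "len L"] by (simp add: integrable_integral)
    then have "(\<integral>\<^sup>+ s. ennreal (indicator {0..len L} s * h (?A s)) \<partial>lborel) = ennreal (f L)"
      using h(2) by (intro nn_integral_has_integral_lebesgue) auto
    moreover have "line_integral (0, L, \<gamma>) (\<lambda>x. ennreal (h x))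
        = (\<integral>\<^sup>+ s. ennreal (indicator {0..len L} s * h (?A s)) \<partial>lborel)"
      unfolding line_integral_eq by (intro nn_integral_cong) (auto simp: indicator_def)
    ultimately show ?thesis by simp
  qed
  ultimately show ?thesis by simp
qed

section \<open>Doubling metric measure spaces\<close>

lemma open_indicator_approx:
  fixes U :: "'a::metric_space set"
  assumes "open U"
  obtains \<psi> :: "nat \<Rightarrow> 'a \<Rightarrow> real" where "\<And>m. continuous_on UNIV (\<psi> m)"
    "\<And>m x. 0 \<le> \<psi> m x" "\<And>m x. \<psi> m x \<le> 1" "\<And>m x. \<psi> m x \<le> \<psi> (Suc m) x"
    "\<And>m x. x \<notin> U \<Longrightarrow> \<psi> m x = 0" "\<And>x. x \<in> U \<Longrightarrow> \<exists>N. \<forall>m\<ge>N. \<psi> m x = 1"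
\<comment> \<open>\<open>infdist\<close> to the empty set is 0, so the distance to the complement is
  of no use for the whole space.\<close>
proof (cases "U = UNIV")
  case True
  then show ?thesis by (intro that[of "\<lambda>_ _. 1"]) auto
next
  case False
  then have ne: "- U \<noteq> {}" by auto
  show ?thesis
  proof (rule that[of "\<lambda>m x. min 1 (real m * infdist x (- U))"])
    show "continuous_on UNIV (\<lambda>x. min 1 (real m * infdist x (- U)))" for m
      by (intro continuous_intros)
    show "min 1 (real m * infdist x (- U)) \<le> min 1 (real (Suc m) * infdist x (- U))" for m x
      by (intro min.mono mult_right_mono) (auto simp: infdist_nonneg)
    show "min 1 (real m * infdist x (- U)) = 0" if "x \<notin> U" for m x
      using that by simp
    fix x assume x: "x \<in> U"
    have "0 < infdist x (- U)"
      using x ne assms in_closed_iff_infdist_zero[of "- U" x] infdist_nonneg[of x "- U"]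
      by (auto simp: closed_Compl less_le)
    then obtain N :: nat where "1 / infdist x (- U) < real N" using reals_Archimedean2 by blast
    then have N: "1 < real N * infdist x (- U)" using \<open>0 < infdist x (- U)\<close> by (simp add: divide_less_eq)
    have "1 \<le> real m * infdist x (- U)" if "N \<le> m" for m
    proof -
      have "real N * infdist x (- U) \<le> real m * infdist x (- U)"
        using that by (intro mult_right_mono) (auto simp: infdist_nonneg)
      then show ?thesis using N by linarith
    qed
    then show "\<exists>N. \<forall>m\<ge>N. min 1 (real m * infdist x (- U)) = 1" by (intro exI[of _ N]) auto
  qed (auto simp: infdist_nonneg)
qed

text \<open>A discrete layer cake formula: without the restriction \<open>n < N\<close> the sum is
  \<open>q\<close> rounded up to a multiple of \<open>s\<close>.\<close>

lemma step_sum_bounds: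
  fixes s q :: real
  assumes "0 < s" "0 \<le> q"
  shows "min (real N * s) q \<le> (\<Sum>n<N. s * of_bool (real n * s < q))" (is ?lower)
    and "(\<Sum>n<N. s * of_bool (real n * s < q)) \<le> q + s" (is ?upper)
proof -
  \<comment> \<open>The upper bound also records \<open>real N * s\<close>; without it the induction
    step would lose another \<open>s\<close> each time a new level lies below
    \<open>q\<close>.\<close>
  have "min (real N * s) q \<le> (\<Sum>n<N. s * of_bool (real n * s < q)) \<and>
        (\<Sum>n<N. s * of_bool (real n * s < q)) \<le> min (real N * s) (q + s)"
  proof (induction N)
    case (Suc N)
    define S where "S = (\<Sum>n<N. s * of_bool (real n * s < q))"
    have S: "min (real N * s) q \<le> S" "S \<le> real N * s" "S \<le> q + s" using Suc by (auto simp: S_def)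
    have N: "real (Suc N) * s = real N * s + s" by (simp add: algebra_simps)
    have "min (real N * s + s) q \<le> S + s * of_bool (real N * s < q) \<and>
        S + s * of_bool (real N * s < q) \<le> min (real N * s + s) (q + s)"
      using S assms by (cases "real N * s < q") (auto simp: min_def split: if_splits)
    then show ?case unfolding N sum.lessThan_Suc S_def[symmetric] .
  qed (use assms in auto)
  then show ?lower ?upper by auto
qed

text \<open>\<open>M\<close> stands for \<open>caratheodory_measure \<mu>\<close>, and
  \<open>borel_hull\<close> carries over Borel regularity to its measurable sets. Finiteness is
  stated for all radii because balls of nonpositive radius are empty.\<close>

locale doubling_space =
  fixes M :: "'a::complete_space measure" and CD :: real
  assumes space_M [simp]: "space M = UNIV"
    and borel_M: "sets borel \<subseteq> sets M"
    and borel_hull: "A \<in> sets M \<Longrightarrow> \<exists>B\<in>sets borel. A \<subseteq> B \<and> emeasure M B = emeasure M A"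
    and ball_pos: "0 < r \<Longrightarrow> 0 < emeasure M (ball x r)"
    and ball_finite: "emeasure M (ball x r) < \<infinity>"
    and ball_double: "0 < r \<Longrightarrow> emeasure M (ball x (2 * r)) \<le> ennreal CD * emeasure M (ball x r)"
begin

lemma open_M [measurable, intro]: "open U \<Longrightarrow> U \<in> sets M"
  using borel_M by auto

lemma closed_M [measurable, intro]: "closed U \<Longrightarrow> U \<in> sets M"
  using borel_M by auto

lemma ball_M [measurable, simp]: "ball x r \<in> sets M" and cball_M [measurable, simp]: "cball x r \<in> sets M"
  by auto

lemma borel_measurable_M: "f \<in> borel_measurable borel \<Longrightarrow> f \<in> borel_measurable M"
  using borel_M by (auto simp: measurable_def)

lemma continuous_M: "continuous_on UNIV f \<Longrightarrow> f \<in> borel_measurable M"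
  by (intro borel_measurable_M borel_measurable_continuous_onI)

lemma bounded_finite: 
  assumes "bounded A"
  shows "emeasure M A < \<infinity>"
proof -
  obtain r where "A \<subseteq> ball undefined r" using bounded_subset_ballD[OF assms] by blast
  then show ?thesis
    using emeasure_mono[of A "ball undefined r" M] ball_finite[of undefined r] by (auto intro: le_less_trans)
qed

lemma ball_real: "emeasure M (ball x r) = ennreal (measure M (ball x r))"
  using ball_finite[of x r] by (intro emeasure_eq_ennreal_measure) auto

lemma measure_ball_pos: "0 < r \<Longrightarrow> 0 < measure M (ball x r)"
  using ball_pos[of r x] by (simp add: ball_real)

lemma CD_ge_1: "1 \<le> CD"
proof -
  have "emeasure M (ball undefined 1) \<le> emeasure M (ball undefined (2 * 1))"
    by (intro emeasure_mono) auto
  also have "\<dots> \<le> ennreal CD * emeasure M (ball undefined 1)" by (rule ball_double) simp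
  also have "\<dots> = ennreal (CD * measure M (ball undefined 1))"
    by (simp add: ball_real ennreal_mult'')
  finally have "measure M (ball undefined 1) \<le> CD * measure M (ball undefined 1)"
    using measure_ball_pos[of 1 undefined] by (simp add: ball_real ennreal_le_iff2)
  then show ?thesis using measure_ball_pos[of 1 undefined] by simp
qed

lemma measure_ball_double: "0 < r \<Longrightarrow> measure M (ball x (2 * r)) \<le> CD * measure M (ball x r)"
  using ball_double[of r x] CD_ge_1 by (simp add: ball_real ennreal_mult[symmetric])

lemma measure_ball_mono: "ball x r \<subseteq> ball y s \<Longrightarrow> measure M (ball x r) \<le> measure M (ball y s)"
  using emeasure_mono[of "ball x r" "ball y s" M] by (simp add: ball_real)

lemma measure_ball_pow: "0 < r \<Longrightarrow> measure M (ball x (2 ^ n * r)) \<le> CD ^ n * measure M (ball x r)"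
proof (induction n)
  case (Suc n)
  have "measure M (ball x (2 * (2 ^ n * r))) \<le> CD * measure M (ball x (2 ^ n * r))"
    using Suc.prems by (intro measure_ball_double) simp
  also have "\<dots> \<le> CD * (CD ^ n * measure M (ball x r))"
    using Suc CD_ge_1 by (intro mult_left_mono) auto
  finally show ?case by (simp add: mult.assoc)
qed simp

lemma measure_ball_dilate:
  obtains C where "1 \<le> C" "\<And>x r. 0 < r \<Longrightarrow> measure M (ball x (K * r)) \<le> C * measure M (ball x r)"
proof -
  obtain n :: nat where "K < 2 ^ n" using real_arch_pow[of 2 K] by auto
  show ?thesis
  proof (rule that[of "CD ^ n"])
    show "1 \<le> CD ^ n" using CD_ge_1 by simp
    fix x :: 'a and r :: real assume r: "0 < r"
    have "measure M (ball x (K * r)) \<le> measure M (ball x (2 ^ n * r))"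
      using \<open>K < 2 ^ n\<close> r by (intro measure_ball_mono subset_ball) simp
    also have "\<dots> \<le> CD ^ n * measure M (ball x r)" using r by (rule measure_ball_pow)
    finally show "measure M (ball x (K * r)) \<le> CD ^ n * measure M (ball x r)" .
  qed
qed

text \<open>If \<open>x\<close> lies in \<open>ball x0 R\<close>, then \<open>ball x (2 * R)\<close>
  contains \<open>ball x0 R\<close>; doubling brings the radius \<open>2 * R\<close> down to
  \<open>r\<close> at a cost that does not depend on \<open>x\<close>.\<close>

lemma measure_ball_lower:
  assumes "0 < r"
  obtains m where "0 < m" "\<And>x. x \<in> ball x0 R \<Longrightarrow> m \<le> measure M (ball x r)"
proof (cases "0 < R")
  case True
  obtain C where C: "1 \<le> C" "\<And>x s. 0 < s \<Longrightarrow> measure M (ball x (2 * R / r * s)) \<le> C * measure M (ball x s)"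
    using measure_ball_dilate by blast
  show ?thesis
  proof (rule that[of "measure M (ball x0 R) / C"])
    show "0 < measure M (ball x0 R) / C" using measure_ball_pos[OF True] C by simp
    fix x assume x: "x \<in> ball x0 R"
    have "ball x0 R \<subseteq> ball x (2 * R)"
    proof
      fix y assume "y \<in> ball x0 R"
      then show "y \<in> ball x (2 * R)" using x dist_triangle[of x y x0] by (auto simp: dist_commute)
    qed
    then have "measure M (ball x0 R) \<le> measure M (ball x (2 * R / r * r))"
      using assms by (intro measure_ball_mono) simp
    also have "\<dots> \<le> C * measure M (ball x r)" by (rule C(2)[OF assms])
    finally show "measure M (ball x0 R) / C \<le> measure M (ball x r)"
      using C by (simp add: divide_le_eq mult.commute)
  qed
next
  case False
  then show ?thesis by (intro that[of 1]) (auto simp: ball_empty)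
qed

text \<open>A separated subset of a ball is finite, because the balls around its points are disjoint and have
  comparable measures.\<close>

lemma totally_bounded_ball:
  assumes e: "0 < e"
  shows "\<exists>k. finite k \<and> ball (x0::'a) R \<subseteq> (\<Union>x\<in>k. ball x e)"
proof (cases "0 < R")
  case R: True
  obtain m where m: "0 < m" "\<And>x. x \<in> ball x0 R \<Longrightarrow> m \<le> measure M (ball x (e/2))"
    using measure_ball_lower[of "e/2" x0 R] e by auto
  define sep where "sep k \<longleftrightarrow> finite k \<and> k \<subseteq> ball x0 R \<and> (\<forall>x\<in>k. \<forall>y\<in>k. x \<noteq> y \<longrightarrow> e \<le> dist x y)" for k
  have bd: "real (card k) \<le> measure M (ball x0 (R + e)) / m" if k: "sep k" for k
  proof -
    have "(\<Sum>x\<in>k. m) \<le> (\<Sum>x\<in>k. measure M (ball x (e/2)))"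
      using k by (intro sum_mono m(2)) (auto simp: sep_def)
    then have "real (card k) * m \<le> (\<Sum>x\<in>k. measure M (ball x (e/2)))" by simp
    also have "\<dots> = measure M (\<Union>x\<in>k. ball x (e/2))"
    proof (rule measure_finite_Union[symmetric])
      show "finite k" using k by (simp add: sep_def)
      show "disjoint_family_on (\<lambda>x. ball x (e/2)) k"
        unfolding disjoint_family_on_def
      proof safe
        fix x y z assume xy: "x \<in> k" "y \<in> k" "x \<noteq> y" "z \<in> ball x (e/2)" "z \<in> ball y (e/2)"
        then have "e \<le> dist x y" using k by (auto simp: sep_def)
        also have "\<dots> \<le> dist x z + dist y z" by (rule dist_triangle2)
        finally show "z \<in> {}" using xy by auto
      qed
      show "emeasure M (ball x (e/2)) \<noteq> \<infinity>" if "x \<in> k" for x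
        using ball_finite[of x "e/2"] by auto
    qed auto
    also have "\<dots> \<le> measure M (ball x0 (R + e))"
    proof (rule measure_mono_fmeasurable)
      show "(\<Union>x\<in>k. ball x (e/2)) \<subseteq> ball x0 (R + e)"
      proof
        fix z assume "z \<in> (\<Union>x\<in>k. ball x (e/2))"
        then obtain x where "x \<in> k" "dist x z < e/2" by auto
        moreover have "dist x0 x < R" using \<open>x \<in> k\<close> k by (auto simp: sep_def)
        ultimately show "z \<in> ball x0 (R + e)" using dist_triangle[of x0 z x] e by auto
      qed
      show "ball x0 (R + e) \<in> fmeasurable M" using ball_finite by (auto intro: fmeasurableI)
    qed auto
    finally show ?thesis using m by (simp add: le_divide_eq)
  qed
  then obtain B :: nat where B: "\<And>k. sep k \<Longrightarrow> card k \<le> B"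
    by (meson le_nat_floor)
  have "sep {}" by (simp add: sep_def)
  \<comment> \<open>A separated set of largest cardinality is an \<open>e\<close>-net, since a point
    that it misses could be added to it.\<close>
  then obtain k where k: "sep k" "\<And>k'. sep k' \<Longrightarrow> card k' \<le> card k"
    using ex_has_greatest_nat[of sep "{}" card "Suc B"] B by (metis less_Suc_eq_le)
  show ?thesis
  proof (intro exI[of _ k] conjI subsetI)
    show "finite k" using k by (simp add: sep_def)
    fix y assume y: "y \<in> ball x0 R"
    show "y \<in> (\<Union>x\<in>k. ball x e)"
    proof (rule ccontr)
      assume ny: "y \<notin> (\<Union>x\<in>k. ball x e)"
      then have "sep (insert y k)" "y \<notin> k"
        using k(1) y e by (auto simp: sep_def dist_commute not_less)
      then show False using k(2)[of "insert y k"] k(1) by (simp add: sep_def)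
    qed
  qed
next
  case False
  then show ?thesis by (intro exI[of _ "{}"]) auto
qed

text \<open>Doubling makes bounded sets totally bounded, and closed sets are complete. So the space
  is proper, which all later compactness arguments rely on.\<close>

lemma compact_closed_bounded:
  fixes S :: "'a set"
  assumes "closed S" "bounded S"
  shows "compact S"
  unfolding compact_eq_totally_bounded
proof (intro conjI allI impI)
  show "complete S" using assms(1) by (simp add: complete_eq_closed)
  fix e :: real assume "0 < e"
  obtain x0 R where "S \<subseteq> ball x0 R" using bounded_subset_ballD[OF assms(2)] by blast
  then show "\<exists>k. finite k \<and> S \<subseteq> (\<Union>x\<in>k. ball x e)"
    using totally_bounded_ball[OF \<open>0 < e\<close>, of x0 R] by (meson order_trans)
qed

lemma compact_cball [simp]: "compact (cball (x::'a) r)"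
  by (intro compact_closed_bounded) auto

section \<open>Regularity of the measure and lower semicontinuous majorants\<close>

lemma emeasure_decseq_0:
  assumes A: "\<And>n::nat. A n \<in> sets M" "decseq A" "(\<Inter>n. A n) = {}" "A 0 \<subseteq> ball x0 r"
  shows "(\<lambda>n. emeasure M (A n)) \<longlonglongrightarrow> 0"
proof -
  have "A n \<subseteq> ball x0 r" for n using A(2,4) by (auto simp: decseq_def)
  then have "emeasure M (A n) \<noteq> \<infinity>" for n
    using bounded_finite[of "A n"] bounded_subset[OF bounded_ball] by (metis less_irrefl infinity_ennreal_def)
  then have "(\<lambda>n. emeasure M (A n)) \<longlonglongrightarrow> emeasure M (\<Inter>n. A n)"
    using A by (intro Lim_emeasure_decseq) auto
  then show ?thesis by (simp add: A)
qed

text \<open>Approximation from inside by closed sets and from outside by open sets is proved at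
  once, because taking complements exchanges the two. Intersecting with a ball keeps the measures
  finite, so that continuity from above is available.\<close>

lemma borel_regular_ball:
  assumes "A \<in> sets borel" "0 < e"
  shows "\<exists>C U. closed C \<and> open U \<and> C \<subseteq> A \<and> A \<subseteq> U \<and> emeasure M ((U - C) \<inter> ball x0 r) \<le> ennreal e"
proof -
  have "A \<in> sigma_sets UNIV {S. open S}" using assms(1) by (simp add: borel_def)
  then show ?thesis using assms(2)
  proof (induction arbitrary: e)
    case (Basic U)
    then have U: "open U" by simp
    obtain \<psi> :: "nat \<Rightarrow> 'a \<Rightarrow> real" where \<psi>: "\<And>m. continuous_on UNIV (\<psi> m)"
      "\<And>m x. 0 \<le> \<psi> m x" "\<And>m x. \<psi> m x \<le> 1" "\<And>m x. \<psi> m x \<le> \<psi> (Suc m) x"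
      "\<And>m x. x \<notin> U \<Longrightarrow> \<psi> m x = 0" "\<And>x. x \<in> U \<Longrightarrow> \<exists>N. \<forall>m\<ge>N. \<psi> m x = 1"
      using open_indicator_approx[OF U] by blast
    define C where "C n = {x. \<psi> n x \<ge> 1}" for n
    have C: "closed (C n)" for n
      unfolding C_def using \<psi>(1) by (intro closed_Collect_le continuous_intros)
    have CU: "C n \<subseteq> U" for n using \<psi>(5) by (force simp: C_def)
    have inc: "C n \<subseteq> C (Suc n)" for n using \<psi>(4) by (auto simp: C_def intro: order_trans)
    have "(\<lambda>n. emeasure M ((U - C n) \<inter> ball x0 r)) \<longlonglongrightarrow> 0"
    proof (rule emeasure_decseq_0)
      show "decseq (\<lambda>n. (U - C n) \<inter> ball x0 r)" using inc by (intro decseq_SucI) auto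
      have "\<exists>N. x \<in> C N" if "x \<in> U" for x
        using \<psi>(6)[OF that] unfolding C_def by (metis mem_Collect_eq order_refl)
      then show "(\<Inter>n. (U - C n) \<inter> ball x0 r) = {}" by blast
    qed (use C U in auto)
    then have "eventually (\<lambda>n. emeasure M ((U - C n) \<inter> ball x0 r) < ennreal e) sequentially"
      using Basic by (intro order_tendstoD) auto
    then obtain n where "emeasure M ((U - C n) \<inter> ball x0 r) < ennreal e"
      by (auto simp: eventually_sequentially)
    then show ?case using U C CU by (intro exI[of _ "C n"] exI[of _ U]) (auto intro: less_imp_le)
  next
    case Empty
    then show ?case by (intro exI[of _ "{}"]) auto
  next
    case (Compl A)
    from Compl.IH[OF Compl.prems]
    obtain C U where "closed C" "open U" "C \<subseteq> A" "A \<subseteq> U"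
      "emeasure M ((U - C) \<inter> ball x0 r) \<le> ennreal e" by blast
    moreover have "- C - - U = U - C" by auto
    ultimately show ?case
      by (intro exI[of _ "- U"] exI[of _ "- C"]) (simp add: open_Compl closed_Compl Compl_eq_Diff_UNIV[symmetric])
  next
    case (Union A)
    have "\<exists>C U. closed C \<and> open U \<and> C \<subseteq> A i \<and> A i \<subseteq> U \<and>
        emeasure M ((U - C) \<inter> ball x0 r) \<le> ennreal (e / 2 * (1/2) ^ Suc i)" for i
      by (rule Union.IH) (use Union.prems in simp)
    then obtain C U where CU: "\<And>i. closed (C i)" "\<And>i. open (U i)" "\<And>i. C i \<subseteq> A i" "\<And>i. A i \<subseteq> U i"
      "\<And>i. emeasure M ((U i - C i) \<inter> ball x0 r) \<le> ennreal (e / 2 * (1/2) ^ Suc i)" by metis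
    \<comment> \<open>An infinite union of closed sets need not be closed, so only finitely many are
      kept; the measure of the rest within the ball tends to 0.\<close>
    define D where "D n = (\<Union>i<n. C i)" for n
    have "(\<lambda>n. emeasure M (((\<Union>i. C i) - D n) \<inter> ball x0 r)) \<longlonglongrightarrow> 0"
    proof (rule emeasure_decseq_0)
      show "decseq (\<lambda>n. ((\<Union>i. C i) - D n) \<inter> ball x0 r)"
        by (intro decseq_SucI) (auto simp: D_def less_Suc_eq)
      show "(\<Inter>n. ((\<Union>i. C i) - D n) \<inter> ball x0 r) = {}" by (auto simp: D_def)
    qed (use CU(1) in \<open>auto simp: D_def\<close>)
    then have "eventually (\<lambda>n. emeasure M (((\<Union>i. C i) - D n) \<inter> ball x0 r) < ennreal (e/2)) sequentially"
      using Union by (intro order_tendstoD) auto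
    then obtain n where n: "emeasure M (((\<Union>i. C i) - D n) \<inter> ball x0 r) < ennreal (e/2)"
      by (auto simp: eventually_sequentially)
    have "emeasure M (\<Union>i. (U i - C i) \<inter> ball x0 r) \<le> (\<Sum>i. emeasure M ((U i - C i) \<inter> ball x0 r))"
      using CU by (intro emeasure_subadditive_countably) auto
    also have "\<dots> \<le> (\<Sum>i. ennreal (e / 2 * (1/2) ^ Suc i))"
      using CU by (intro suminf_le) auto
    also have "\<dots> = ennreal (e / 2)"
    proof (rule suminf_ennreal_eq)
      show "(\<lambda>i. e / 2 * (1/2) ^ Suc i) sums (e/2)"
        using sums_mult[OF power_half_series, of "e/2"] by simp
    qed (use Union in auto)
    finally have 1: "emeasure M (\<Union>i. (U i - C i) \<inter> ball x0 r) \<le> ennreal (e/2)" .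
    have "emeasure M (((\<Union>i. U i) - D n) \<inter> ball x0 r)
        \<le> emeasure M ((\<Union>i. (U i - C i) \<inter> ball x0 r) \<union> (((\<Union>i. C i) - D n) \<inter> ball x0 r))"
      using CU by (intro emeasure_mono) (auto simp: D_def)
    also have "\<dots> \<le> emeasure M (\<Union>i. (U i - C i) \<inter> ball x0 r) + emeasure M (((\<Union>i. C i) - D n) \<inter> ball x0 r)"
      using CU by (intro emeasure_subadditive) (auto simp: D_def)
    also have "\<dots> \<le> ennreal (e/2) + ennreal (e/2)" using 1 n by (intro add_mono) auto
    also have "\<dots> = ennreal e" using Union by (simp flip: ennreal_plus)
    finally have "emeasure M (((\<Union>i. U i) - D n) \<inter> ball x0 r) \<le> ennreal e" .
    moreover have "D n \<subseteq> \<Union> (range A)" using CU(3) by (auto simp: D_def)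
    moreover have "\<Union> (range A) \<subseteq> (\<Union>i. U i)" using CU(4) by blast
    moreover have "closed (D n)" "open (\<Union>i. U i)" using CU by (auto simp: D_def)
    ultimately show ?case by (intro exI[of _ "D n"] exI[of _ "\<Union>i. U i"] conjI)
  qed
qed

lemma outer_regular_ball:
  assumes A: "A \<in> sets M" "A \<subseteq> ball x0 r" and e: "0 < e"
  obtains U where "open U" "A \<subseteq> U" "emeasure M (U \<inter> ball x0 r) \<le> emeasure M A + ennreal e"
proof -
  obtain B where B: "B \<in> sets borel" "A \<subseteq> B" "emeasure M B = emeasure M A"
    using borel_hull[OF A(1)] by auto
  obtain C U where CU: "closed C" "open U" "C \<subseteq> B" "B \<subseteq> U" "emeasure M ((U - C) \<inter> ball x0 r) \<le> ennreal e"
    using borel_regular_ball[OF B(1) e, of x0 r] by (elim exE conjE)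
  have "emeasure M (U \<inter> ball x0 r) \<le> emeasure M (B \<union> ((U - C) \<inter> ball x0 r))"
    using CU B borel_M by (intro emeasure_mono) auto
  also have "\<dots> \<le> emeasure M B + emeasure M ((U - C) \<inter> ball x0 r)"
    using CU B borel_M by (intro emeasure_subadditive) auto
  also have "\<dots> \<le> emeasure M A + ennreal e" using CU B by (auto intro: add_left_mono)
  finally show ?thesis using that CU B by auto
qed

text \<open>Vitali--Caratheodory: a lower semicontinuous majorant with almost the same integral, presented as
  a supremum of continuous functions. It is built from open neighbourhoods of the superlevel sets at the
  multiples of a small step \<open>s\<close>.\<close>

lemma lsc_majorant:
  assumes \<rho> [measurable]: "\<rho> \<in> borel_measurable M" and e: "0 < e" and r: "0 < r"
  obtains h :: "nat \<Rightarrow> 'a \<Rightarrow> real" and c where "0 < c" "\<And>m. continuous_on UNIV (h m)" "\<And>m x. c \<le> h m x"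
    "\<And>m x. h m x \<le> h (Suc m) x" "\<And>x. x \<in> ball x0 r \<Longrightarrow> \<rho> x \<le> (SUP m. ennreal (h m x))"
    "(\<integral>\<^sup>+x\<in>ball x0 r. (SUP m. ennreal (h m x)) \<partial>M) \<le> (\<integral>\<^sup>+x\<in>ball x0 r. \<rho> x \<partial>M) + ennreal e"
proof -
  let ?B = "ball x0 r"
  define \<beta> where "\<beta> = measure M ?B"
  have \<beta>: "0 < \<beta>" "emeasure M ?B = ennreal \<beta>" using measure_ball_pos[OF r] by (auto simp: \<beta>_def ball_real)
  \<comment> \<open>Three errors of size \<open>s * \<beta>\<close> occur: the constant summand of
    \<open>h\<close>, the rounding of \<rho> to multiples of \<open>s\<close>, and the excess of the
    neighbourhoods \<open>U n\<close> over the level sets \<open>A n\<close>.\<close>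
  define s where "s = e / (3 * \<beta>)"
  have s: "0 < s" "s * \<beta> = e / 3" using e \<beta> by (auto simp: s_def)
  define A where "A n = {x \<in> ?B. ennreal (real n * s) < \<rho> x}" for n
  have A [measurable]: "A n \<in> sets M" for n
  proof -
    have "A n = ?B \<inter> {x \<in> space M. ennreal (real n * s) < \<rho> x}" by (auto simp: A_def)
    also have "\<dots> \<in> sets M" by measurable
    finally show ?thesis .
  qed
  have "\<exists>U. open U \<and> A n \<subseteq> U \<and> emeasure M (U \<inter> ?B) \<le> emeasure M (A n) + ennreal (\<beta> * (1/2) ^ Suc n)" for n
  proof -
    have "A n \<subseteq> ?B" "0 < \<beta> * (1/2) ^ Suc n" using \<beta> by (auto simp: A_def)
    from outer_regular_ball[OF A this] show ?thesis by metis
  qed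
  then obtain U where U: "\<And>n. open (U n)" "\<And>n. A n \<subseteq> U n"
    "\<And>n. emeasure M (U n \<inter> ?B) \<le> emeasure M (A n) + ennreal (\<beta> * (1/2) ^ Suc n)" by metis
  have "\<exists>\<psi>::nat \<Rightarrow> 'a \<Rightarrow> real. (\<forall>m. continuous_on UNIV (\<psi> m)) \<and>
    (\<forall>m x. 0 \<le> \<psi> m x) \<and> (\<forall>m x. \<psi> m x \<le> 1) \<and> (\<forall>m x. \<psi> m x \<le> \<psi> (Suc m) x) \<and>
    (\<forall>m x. x \<notin> U n \<longrightarrow> \<psi> m x = 0) \<and> (\<forall>x. x \<in> U n \<longrightarrow> (\<exists>N. \<forall>m\<ge>N. \<psi> m x = 1))" for n
    using open_indicator_approx[OF U(1)[of n]] by metis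
  then obtain \<psi> :: "nat \<Rightarrow> nat \<Rightarrow> 'a \<Rightarrow> real" where \<psi>: "\<And>n m. continuous_on UNIV (\<psi> n m)"
    "\<And>n m x. 0 \<le> \<psi> n m x" "\<And>n m x. \<psi> n m x \<le> 1" "\<And>n m x. \<psi> n m x \<le> \<psi> n (Suc m) x"
    "\<And>n m x. x \<notin> U n \<Longrightarrow> \<psi> n m x = 0" "\<And>n x. x \<in> U n \<Longrightarrow> \<exists>N. \<forall>m\<ge>N. \<psi> n m x = 1"
    by metis
  \<comment> \<open>The constant \<open>s\<close> keeps \<open>h\<close> away from 0; later this
    bounds the length of chains by their cost.\<close>
  define h where "h m x = s + (\<Sum>n<m. s * \<psi> n m x)" for m x
  have hs: "s \<le> h m x" for m x using s \<psi>(2) by (auto simp: h_def intro!: sum_nonneg)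
  have hmono: "h m x \<le> h (Suc m) x" for m x
    unfolding h_def using s \<psi>
    by (simp, intro add_increasing2 sum_mono mult_left_mono) auto
  have hle: "ennreal (h m x) \<le> ennreal s + (\<Sum>n. ennreal s * indicator (U n) x)" for m x
  proof -
    have "h m x \<le> s + (\<Sum>n<m. s * indicator (U n) x)"
      unfolding h_def using s \<psi>(3,5) by (intro add_left_mono sum_mono mult_left_mono) (auto simp: indicator_def)
    then have "ennreal (h m x) \<le> ennreal (s + (\<Sum>n<m. s * indicator (U n) x))" by (rule ennreal_leI)
    also have "\<dots> = ennreal s + (\<Sum>n<m. ennreal s * indicator (U n) x)"
      using s by (subst ennreal_plus) (auto simp: sum_nonneg ennreal_mult' ennreal_indicator ennreal_of_nat_eq_real_of_nat simp flip: sum_ennreal)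
    also have "\<dots> \<le> ennreal s + (\<Sum>n. ennreal s * indicator (U n) x)"
      by (intro add_left_mono sum_le_suminf) auto
    finally show ?thesis .
  qed
  have lower: "ennreal (min (real N * s) q) \<le> (SUP m. ennreal (h m x))"
    if x: "x \<in> ?B" and q: "0 \<le> q" "ennreal q \<le> \<rho> x" for N q x
  proof -
    \<comment> \<open>At \<open>x\<close>, each \<open>\<psi> n\<close> with
      \<open>x \<in> U n\<close> is eventually equal to 1, not merely close to it. As only finitely
      many levels are involved, one index \<open>K\<close> serves all of them.\<close>
    have "\<exists>K. \<forall>n<N. \<forall>m\<ge>K. of_bool (real n * s < q) \<le> \<psi> n m x"
    proof (induction N)
      case (Suc N)
      then obtain K where K: "\<forall>n<N. \<forall>m\<ge>K. of_bool (real n * s < q) \<le> \<psi> n m x" by auto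
      have "\<exists>K'. \<forall>m\<ge>K'. of_bool (real N * s < q) \<le> \<psi> N m x"
      proof (cases "real N * s < q")
        case True
        then have "ennreal (real N * s) < ennreal q" using s(1) by (simp add: ennreal_less_iff)
        then have "x \<in> A N" using x q(2) by (auto simp: A_def)
        then obtain K' where "\<forall>m\<ge>K'. \<psi> N m x = 1" using \<psi>(6)[of x N] U(2) by blast
        then show ?thesis by (intro exI[of _ K']) auto
      qed (use \<psi>(2) in auto)
      then obtain K' where "\<forall>m\<ge>K'. of_bool (real N * s < q) \<le> \<psi> N m x" ..
      then show ?case using K by (intro exI[of _ "max K K'"]) (auto simp: less_Suc_eq)
    qed simp
    then obtain K where K: "\<And>n m. n < N \<Longrightarrow> K \<le> m \<Longrightarrow> of_bool (real n * s < q) \<le> \<psi> n m x" by auto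
    define m where "m = max K N"
    have "min (real N * s) q \<le> (\<Sum>n<N. s * of_bool (real n * s < q))"
      using step_sum_bounds(1)[of s q N] s q by simp
    also have "\<dots> \<le> (\<Sum>n<N. s * \<psi> n m x)"
      using s K by (intro sum_mono mult_left_mono) (auto simp: m_def)
    also have "\<dots> \<le> (\<Sum>n<m. s * \<psi> n m x)"
      using s \<psi>(2) by (intro sum_mono2) (auto simp: m_def)
    also have "\<dots> \<le> h m x" using s by (simp add: h_def)
    finally have "ennreal (min (real N * s) q) \<le> ennreal (h m x)" by (rule ennreal_leI)
    then show ?thesis by (rule SUP_upper2[OF UNIV_I])
  qed
  have "\<rho> x \<le> (SUP m. ennreal (h m x))" if x: "x \<in> ?B" for x
  \<comment> \<open>Since \<rho> may be infinite at \<open>x\<close>, it is approached from below by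
    finite values.\<close>
  proof (rule dense_le)
    fix y assume y: "y < \<rho> x"
    then obtain q where q: "0 \<le> q" "y = ennreal q" by (cases y) (auto simp: top_unique)
    obtain N :: nat where "q / s < real N" using reals_Archimedean2 by blast
    then have "min (real N * s) q = q" using s by (simp add: divide_less_eq)
    then show "y \<le> (SUP m. ennreal (h m x))" using lower[OF x q(1), of N] y q by simp
  qed
  moreover have "(\<integral>\<^sup>+x\<in>?B. (SUP m. ennreal (h m x)) \<partial>M) \<le> (\<integral>\<^sup>+x\<in>?B. \<rho> x \<partial>M) + ennreal e"
  proof -
    have sumA: "(\<Sum>n. ennreal s * indicator (A n) x) \<le> \<rho> x + ennreal s" for x
    proof (cases "\<rho> x")
      case (real q)
      show ?thesis
      proof (rule suminf_le_const)
        fix N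
        have "(\<Sum>n<N. ennreal s * indicator (A n) x) \<le> (\<Sum>n<N. ennreal (s * of_bool (real n * s < q)))"
        proof (rule sum_mono)
          fix n
          have "real n * s < q" if "x \<in> A n"
            using that real s by (auto simp: A_def ennreal_less_iff)
          then show "ennreal s * indicator (A n) x \<le> ennreal (s * of_bool (real n * s < q))"
            by (auto simp: indicator_def)
        qed
        also have "\<dots> = ennreal (\<Sum>n<N. s * of_bool (real n * s < q))" using s by (intro sum_ennreal) auto
        also have "\<dots> \<le> ennreal (q + s)" using step_sum_bounds(2)[of s q N] s real by (intro ennreal_leI) auto
        also have "\<dots> = \<rho> x + ennreal s" using real s by simp
        finally show "(\<Sum>n<N. ennreal s * indicator (A n) x) \<le> \<rho> x + ennreal s" .
      qed auto
    qed simp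
    have "(\<integral>\<^sup>+x\<in>?B. (SUP m. ennreal (h m x)) \<partial>M)
        \<le> (\<integral>\<^sup>+x. ennreal s * indicator ?B x + (\<Sum>n. ennreal s * indicator (U n \<inter> ?B) x) \<partial>M)"
      using hle by (intro nn_integral_mono) (auto simp: indicator_def intro!: SUP_least)
    also have "\<dots> = ennreal s * emeasure M ?B + (\<Sum>n. ennreal s * emeasure M (U n \<inter> ?B))"
    proof -
      have UB: "U n \<inter> ?B \<in> sets M" for n using U(1) by auto
      have "(\<integral>\<^sup>+x. (\<Sum>n. ennreal s * indicator (U n \<inter> ?B) x) \<partial>M) = (\<Sum>n. ennreal s * emeasure M (U n \<inter> ?B))"
        using UB by (subst nn_integral_suminf) (simp_all only: nn_integral_cmult_indicator borel_measurable_times_ennreal borel_measurable_const borel_measurable_indicator)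
      moreover have "(\<lambda>x. \<Sum>n. ennreal s * indicator (U n \<inter> ?B) x) \<in> borel_measurable M"
        using UB by (intro borel_measurable_suminf_order borel_measurable_times_ennreal) simp_all
      ultimately show ?thesis
        by (subst nn_integral_add) (simp_all add: nn_integral_cmult_indicator)
    qed
    also have "\<dots> \<le> ennreal s * emeasure M ?B + (\<Sum>n. ennreal s * emeasure M (A n) + ennreal (s * (\<beta> * (1/2) ^ Suc n)))"
    proof (intro add_left_mono suminf_le)
      fix n
      have "ennreal s * emeasure M (U n \<inter> ?B) \<le> ennreal s * (emeasure M (A n) + ennreal (\<beta> * (1/2) ^ Suc n))"
        by (intro mult_left_mono U) auto
      also have "\<dots> = ennreal s * emeasure M (A n) + ennreal (s * (\<beta> * (1/2) ^ Suc n))"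
        using s(1) by (simp only: distrib_left ennreal_mult'[OF less_imp_le])
      finally show "ennreal s * emeasure M (U n \<inter> ?B) \<le> ennreal s * emeasure M (A n) + ennreal (s * (\<beta> * (1/2) ^ Suc n))" .
    qed auto
    also have "\<dots> = ennreal s * emeasure M ?B + ((\<Sum>n. ennreal s * emeasure M (A n)) + (\<Sum>n. ennreal (s * (\<beta> * (1/2) ^ Suc n))))"
      by (subst suminf_add) auto
    also have "(\<Sum>n. ennreal (s * (\<beta> * (1/2) ^ Suc n))) = ennreal (s * \<beta>)"
    proof (rule suminf_ennreal_eq)
      show "(\<lambda>n. s * (\<beta> * (1/2) ^ Suc n)) sums (s * \<beta>)"
        using sums_mult[OF power_half_series, of "s * \<beta>"] by (simp add: mult.assoc)
    qed (use s \<beta> in auto)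
    also have "(\<Sum>n. ennreal s * emeasure M (A n)) = (\<integral>\<^sup>+x. (\<Sum>n. ennreal s * indicator (A n) x) \<partial>M)"
      by (subst nn_integral_suminf) (auto simp: nn_integral_cmult_indicator)
    also have "\<dots> \<le> (\<integral>\<^sup>+x. \<rho> x * indicator ?B x + ennreal s * indicator ?B x \<partial>M)"
    proof (rule nn_integral_mono)
      fix x
      show "(\<Sum>n. ennreal s * indicator (A n) x) \<le> \<rho> x * indicator ?B x + ennreal s * indicator ?B x"
      proof (cases "x \<in> ?B")
        case False
        then have "x \<notin> A n" for n by (auto simp: A_def)
        then show ?thesis by simp
      qed (use sumA[of x] in simp)
    qed
    also have "\<dots> = (\<integral>\<^sup>+x\<in>?B. \<rho> x \<partial>M) + ennreal s * emeasure M ?B"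
      by (subst nn_integral_add) (auto simp: nn_integral_cmult_indicator)
    finally have "(\<integral>\<^sup>+x\<in>?B. (SUP m. ennreal (h m x)) \<partial>M)
      \<le> ennreal s * emeasure M ?B + ((\<integral>\<^sup>+x\<in>?B. \<rho> x \<partial>M) + ennreal s * emeasure M ?B + ennreal (s * \<beta>))"
      by (simp add: add_left_mono add_right_mono)
    also have "ennreal s * emeasure M ?B = ennreal (e / 3)"
      unfolding \<beta>(2) s(2)[symmetric] using s(1) by (simp only: ennreal_mult'[OF less_imp_le])
    also have "ennreal (e/3) + ((\<integral>\<^sup>+x\<in>?B. \<rho> x \<partial>M) + ennreal (e/3) + ennreal (s * \<beta>))
        = (\<integral>\<^sup>+x\<in>?B. \<rho> x \<partial>M) + (ennreal (e/3) + ennreal (e/3) + ennreal (e/3))"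
      unfolding s(2) by (simp only: ac_simps)
    also have "ennreal (e/3) + ennreal (e/3) + ennreal (e/3) = ennreal e"
      using e by (simp flip: ennreal_plus)
    finally show ?thesis .
  qed
  moreover have "continuous_on UNIV (h m)" for m
    unfolding h_def by (intro continuous_intros \<psi>(1))
  ultimately show ?thesis using that[of s h] s hs hmono by auto
qed

end

section \<open>Approximable functions and the coarea inequality\<close>

lemma upper_gradient_affine:
  assumes u: "upper_gradient \<Omega> (\<lambda>x. ereal (v x)) g" and c: "0 \<le> c"
  shows "upper_gradient \<Omega> (\<lambda>x. ereal (c * v x + d)) (\<lambda>x. ennreal c * g x)"
  unfolding upper_gradient_real_iff
proof (intro conjI allI impI)
  show "(\<lambda>x. ennreal c * g x) \<in> borel_measurable (restrict_space borel \<Omega>)"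
    using upper_gradient_measurable[OF u] by simp
  fix a b \<gamma> assume p: "(a, b, \<gamma>) \<in> paths_in \<Omega>"
  interpret rect_path a b \<gamma> using p by (rule paths_in_rect_path)
  have "\<bar>c * v (\<gamma> a) + d - (c * v (\<gamma> b) + d)\<bar> = c * \<bar>v (\<gamma> a) - v (\<gamma> b)\<bar>"
    using c by (simp add: abs_mult flip: right_diff_distrib)
  then have "ennreal \<bar>c * v (\<gamma> a) + d - (c * v (\<gamma> b) + d)\<bar> = ennreal c * ennreal \<bar>v (\<gamma> a) - v (\<gamma> b)\<bar>"
    using c by (simp add: ennreal_mult)
  also have "\<dots> \<le> ennreal c * line_integral (a, b, \<gamma>) g"
    by (intro mult_left_mono upper_gradient_realD[OF u p]) simp
  also have "\<dots> = line_integral (a, b, \<gamma>) (\<lambda>x. ennreal c * g x)"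
    unfolding line_integral_eq mult.assoc
    by (rule nn_integral_cmult[symmetric]) (rule measurable_arclength_lborel[OF paths_in_image[OF p] upper_gradient_measurable[OF u]])
  finally show "ennreal \<bar>c * v (\<gamma> a) + d - (c * v (\<gamma> b) + d)\<bar> \<le> line_integral (a, b, \<gamma>) (\<lambda>x. ennreal c * g x)" .
qed

lemma upper_gradient_diff:
  assumes u: "upper_gradient \<Omega> (\<lambda>x. ereal (v x)) g" and u': "upper_gradient \<Omega> (\<lambda>x. ereal (v' x)) g'"
  shows "upper_gradient \<Omega> (\<lambda>x. ereal (v x - v' x)) (\<lambda>x. g x + g' x)"
  unfolding upper_gradient_real_iff
proof (intro conjI allI impI)
  show "(\<lambda>x. g x + g' x) \<in> borel_measurable (restrict_space borel \<Omega>)"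
    using upper_gradient_measurable[OF u] upper_gradient_measurable[OF u'] by simp
  fix a b \<gamma> assume p: "(a, b, \<gamma>) \<in> paths_in \<Omega>"
  interpret rect_path a b \<gamma> using p by (rule paths_in_rect_path)
  have "ennreal \<bar>v (\<gamma> a) - v' (\<gamma> a) - (v (\<gamma> b) - v' (\<gamma> b))\<bar>
      \<le> ennreal \<bar>v (\<gamma> a) - v (\<gamma> b)\<bar> + ennreal \<bar>v' (\<gamma> a) - v' (\<gamma> b)\<bar>"
    by (simp flip: ennreal_plus add: ennreal_leI)
  also have "\<dots> \<le> line_integral (a, b, \<gamma>) g + line_integral (a, b, \<gamma>) g'"
    by (intro add_mono upper_gradient_realD[OF u p] upper_gradient_realD[OF u' p])
  also have "\<dots> = line_integral (a, b, \<gamma>) (\<lambda>x. g x + g' x)"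
    unfolding line_integral_eq distrib_right
    by (rule nn_integral_add[symmetric])
      (rule measurable_arclength_lborel[OF paths_in_image[OF p] upper_gradient_measurable[OF u]]
        measurable_arclength_lborel[OF paths_in_image[OF p] upper_gradient_measurable[OF u']])+
  finally show "ennreal \<bar>v (\<gamma> a) - v' (\<gamma> a) - (v (\<gamma> b) - v' (\<gamma> b))\<bar> \<le> line_integral (a, b, \<gamma>) (\<lambda>x. g x + g' x)" .
qed

text \<open>Meant for the cutoff in \<open>approx_per_zero_extension\<close>: the clamps of a
  distance function at small positive levels have a common gradient that vanishes where the distance
  is 0, and the clamp at level 0 inherits it.\<close>

lemma upper_gradient_uniform_limit:
  assumes g: "g \<in> borel_measurable (restrict_space borel \<Omega>)"
    and v: "\<And>e::real. 0 < e \<Longrightarrow> e < 1 \<Longrightarrow> \<exists>w. upper_gradient \<Omega> (\<lambda>x. ereal (w x)) g \<and> (\<forall>x\<in>\<Omega>. \<bar>v x - w x\<bar> \<le> e)"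
  shows "upper_gradient \<Omega> (\<lambda>x. ereal (v x)) g"
  unfolding upper_gradient_real_iff
proof (intro conjI allI impI g)
  fix a b \<gamma> assume p: "(a, b, \<gamma>) \<in> paths_in \<Omega>"
  then have ab: "\<gamma> a \<in> \<Omega>" "\<gamma> b \<in> \<Omega>" by (auto simp: paths_in_def)
  show "ennreal \<bar>v (\<gamma> a) - v (\<gamma> b)\<bar> \<le> line_integral (a, b, \<gamma>) g"
  proof (rule ennreal_le_epsilon)
    fix e :: real assume e: "0 < e"
    obtain w where w: "upper_gradient \<Omega> (\<lambda>x. ereal (w x)) g" "\<And>x. x \<in> \<Omega> \<Longrightarrow> \<bar>v x - w x\<bar> \<le> min (e/2) (1/2)"
    proof -
      have "0 < min (e/2) (1/2)" "min (e/2) (1/2) < 1" using e by auto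
      from v[OF this] show ?thesis using that by blast
    qed
    have "\<bar>v (\<gamma> a) - v (\<gamma> b)\<bar> \<le> \<bar>w (\<gamma> a) - w (\<gamma> b)\<bar> + e"
      using w(2)[OF ab(1), THEN order_trans, OF min.cobounded1]
        w(2)[OF ab(2), THEN order_trans, OF min.cobounded1] by linarith
    then have "ennreal \<bar>v (\<gamma> a) - v (\<gamma> b)\<bar> \<le> ennreal \<bar>w (\<gamma> a) - w (\<gamma> b)\<bar> + ennreal e"
      using e by (simp flip: ennreal_plus add: ennreal_leI)
    then show "ennreal \<bar>v (\<gamma> a) - v (\<gamma> b)\<bar> \<le> line_integral (a, b, \<gamma>) g + ennreal e"
      using upper_gradient_realD[OF w(1) p] by (meson add_right_mono order_trans)
  qed
qed

text \<open>A curve leaving \<open>{f \<le> e}\<close> is cut at its first and at its last passage through \<open>{f = e}\<close>.\<close>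

lemma upper_gradient_zero_extension:
  fixes f w W :: "'a::metric_space \<Rightarrow> real"
  assumes u: "upper_gradient \<Omega> (\<lambda>x. ereal (w x)) g"
    and f: "continuous_on UNIV f" "{x. f x \<le> e} \<subseteq> \<Omega>"
    and W: "\<And>x. f x \<le> e \<Longrightarrow> W x = w x" "\<And>x. e \<le> f x \<Longrightarrow> W x = 0" "\<And>x. 0 \<le> W x"
    and G: "G \<in> borel_measurable borel" "\<And>x. f x \<le> e \<Longrightarrow> g x \<le> G x"
  shows "upper_gradient UNIV (\<lambda>x. ereal (W x)) G"
  unfolding upper_gradient_real_iff
proof (intro conjI allI impI)
  show Gm: "G \<in> borel_measurable (restrict_space borel UNIV)"
    using G by (intro measurable_restrict_space1) auto
  fix a b and \<gamma> :: "real \<Rightarrow> 'a" assume p: "(a, b, \<gamma>) \<in> paths_in UNIV"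
  interpret rect_path a b \<gamma> using p by (rule paths_in_rect_path)
  let ?F = "\<lambda>r. f (\<gamma> r)"
  have F: "continuous_on {a..b} ?F" using continuous_on_compose2[OF f(1) cont] by auto
  have piece: "ennreal \<bar>w (\<gamma> s) - w (\<gamma> t)\<bar> \<le> line_integral (a, b, \<gamma>) G"
    if "a \<le> s" "s \<le> t" "t \<le> b" "\<And>r. r \<in> {s..t} \<Longrightarrow> ?F r \<le> e" for s t
    using that f(2) by (intro upper_gradient_subpath[OF u p that(1-3), where S = "{x. f x \<le> e}"] Gm G(2)) auto
  show "ennreal \<bar>W (\<gamma> a) - W (\<gamma> b)\<bar> \<le> line_integral (a, b, \<gamma>) G"
  proof (cases "\<forall>r\<in>{a..b}. ?F r \<le> e")
    case True
    then show ?thesis using piece[of a b] le by (simp add: W(1))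
  next
    case False
    then obtain c where c: "c \<in> {a..b}" "e < ?F c" by auto
    have "ennreal (W (\<gamma> a)) \<le> line_integral (a, b, \<gamma>) G"
    proof (cases "?F a \<le> e")
      case True
      obtain s where s: "a \<le> s" "s \<le> c" "?F s = e" "\<And>r. r \<in> {a..s} \<Longrightarrow> ?F r \<le> e"
        using first_passage[of a c ?F e] True c continuous_on_subset[OF F, of "{a..c}"] by auto
      have "W (\<gamma> s) = 0" "W (\<gamma> s) = w (\<gamma> s)" "W (\<gamma> a) = w (\<gamma> a)"
        using s(3) True W(2)[of "\<gamma> s"] W(1)[of "\<gamma> s"] W(1)[of "\<gamma> a"] by simp_all
      then show ?thesis using piece[OF order_refl s(1) _ s(4)] s c W(3)[of "\<gamma> a"] by simp
    next
      case False
      then show ?thesis using W(2)[of "\<gamma> a"] by simp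
    qed
    moreover have "ennreal (W (\<gamma> b)) \<le> line_integral (a, b, \<gamma>) G"
    proof (cases "?F b \<le> e")
      case True
      obtain s where s: "c \<le> s" "s \<le> b" "?F s = e" "\<And>r. r \<in> {s..b} \<Longrightarrow> ?F r \<le> e"
        using last_passage[of c b ?F e] True c continuous_on_subset[OF F, of "{c..b}"] by auto
      have "W (\<gamma> s) = 0" "W (\<gamma> s) = w (\<gamma> s)" "W (\<gamma> b) = w (\<gamma> b)"
        using s(3) True W(2)[of "\<gamma> s"] W(1)[of "\<gamma> s"] W(1)[of "\<gamma> b"] by simp_all
      then show ?thesis using piece[OF _ s(2) order_refl s(4)] s c W(3)[of "\<gamma> b"] by simp
    next
      case False
      then show ?thesis using W(2)[of "\<gamma> b"] by simp
    qed
    moreover have "\<bar>W (\<gamma> a) - W (\<gamma> b)\<bar> \<le> W (\<gamma> a) \<or> \<bar>W (\<gamma> a) - W (\<gamma> b)\<bar> \<le> W (\<gamma> b)"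
      using W(3)[of "\<gamma> a"] W(3)[of "\<gamma> b"] by linarith
    ultimately show ?thesis by (meson ennreal_leI order_trans)
  qed
qed

lemma locally_lipschitz_continuous:
  assumes "locally_lipschitz_on \<Omega> v"
  shows "continuous_on \<Omega> v"
  unfolding continuous_on_eq_continuous_within
proof
  fix x assume "x \<in> \<Omega>"
  then obtain r L where r: "r > 0" "ball x r \<subseteq> \<Omega>" "L-lipschitz_on (ball x r) v"
    using assms by (auto simp: locally_lipschitz_on_def)
  then have "continuous_on (ball x r) v" by (intro lipschitz_on_continuous_on)
  then have "isCont v x" using r by (auto simp: continuous_on_eq_continuous_at)
  then show "continuous (at x within \<Omega>) v" by (rule continuous_at_imp_continuous_at_within)
qed

lemma ennreal_tendsto_0I:
  assumes "\<And>e::real. 0 < e \<Longrightarrow> eventually (\<lambda>i. f i \<le> ennreal e) F"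
  shows "(f \<longlongrightarrow> 0) F"
proof (rule order_tendstoI)
  fix a :: ennreal assume "0 < a"
  then obtain y where y: "0 < y" "y < a" using dense by blast
  then obtain e where e: "y = ennreal e" "0 < e" by (cases y) auto
  show "eventually (\<lambda>i. f i < a) F"
    using assms[OF e(2)] by eventually_elim (use y e in auto)
qed auto

lemma ennreal_tendsto_0D:
  fixes f :: "'i \<Rightarrow> ennreal"
  assumes "(f \<longlongrightarrow> 0) F" "0 < e"
  shows "eventually (\<lambda>i. f i \<le> ennreal e) F"
  using order_tendstoD(2)[OF assms(1), of "ennreal e"] assms(2) by (auto elim: eventually_mono)

text \<open>A relaxed form of \<open>total_variation M \<Omega> u < \<epsilon>\<close>. The bound on
  the liminf becomes a bound for every member, which a subsequence achieves, and continuity replaces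
  the local Lipschitz condition; BV functions and chain distances both provide such
  sequences.\<close>

definition approx_var :: "'a::metric_space measure \<Rightarrow> 'a set \<Rightarrow> ('a \<Rightarrow> ereal) \<Rightarrow> ennreal \<Rightarrow> bool" where
  "approx_var M \<Omega> u \<epsilon> \<longleftrightarrow> (\<exists>v g. (\<forall>i::nat. continuous_on \<Omega> (v i) \<and>
     upper_gradient \<Omega> (\<lambda>x. ereal (v i x)) (g i) \<and> (\<integral>\<^sup>+x\<in>\<Omega>. g i x \<partial>M) \<le> \<epsilon>) \<and> L1_loc_tendsto M \<Omega> v u)"

text \<open>Reads as: the perimeter of \<open>A\<close> in \<Omega> is at most \<epsilon>. The
  bounds 0 and 1 make the approximants locally integrable, as the Poincare inequality requires, and
  allow a cutoff of height one to remove them near the boundary of \<Omega>.\<close>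

definition approx_per :: "'a::metric_space measure \<Rightarrow> 'a set \<Rightarrow> 'a set \<Rightarrow> ennreal \<Rightarrow> bool" where
  "approx_per M \<Omega> A \<epsilon> \<longleftrightarrow> (\<exists>v g. (\<forall>i::nat. continuous_on \<Omega> (v i) \<and> (\<forall>x. 0 \<le> v i x \<and> v i x \<le> 1) \<and>
     upper_gradient \<Omega> (\<lambda>x. ereal (v i x)) (g i) \<and> (\<integral>\<^sup>+x\<in>\<Omega>. g i x \<partial>M) \<le> \<epsilon>) \<and>
     L1_loc_tendsto M \<Omega> v (\<lambda>x. ereal (indicator A x)))"

lemma L1_loc_tendsto_subseq:
  assumes "L1_loc_tendsto M \<Omega> v u" "strict_mono r"
  shows "L1_loc_tendsto M \<Omega> (\<lambda>i. v (r i)) u"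
  unfolding L1_loc_tendsto_def
proof
  fix x assume "x \<in> \<Omega>"
  then obtain s where "s > 0" "ball x s \<subseteq> \<Omega>"
    "(\<lambda>i. \<integral>\<^sup>+y\<in>ball x s. e2ennreal \<bar>ereal (v i y) - u y\<bar> \<partial>M) \<longlonglongrightarrow> 0"
    using assms(1) by (auto simp: L1_loc_tendsto_def)
  then show "\<exists>s>0. ball x s \<subseteq> \<Omega> \<and> (\<lambda>i. \<integral>\<^sup>+y\<in>ball x s. e2ennreal \<bar>ereal (v (r i) y) - u y\<bar> \<partial>M) \<longlonglongrightarrow> 0"
    using LIMSEQ_subseq_LIMSEQ[OF _ assms(2)] by (fastforce simp: comp_def)
qed

lemma liminf_less_subseq:
  fixes X :: "nat \<Rightarrow> ennreal"
  assumes "liminf X < c"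
  obtains r :: "nat \<Rightarrow> nat" where "strict_mono r" "\<And>i. X (r i) < c"
proof -
  have "infinite {n. X n < c}"
  proof
    assume "finite {n. X n < c}"
    then have "eventually (\<lambda>n. n \<notin> {n. X n < c}) sequentially"
      by (simp flip: cofinite_eq_sequentially add: eventually_cofinite)
    then have "eventually (\<lambda>n. c \<le> X n) sequentially" by (simp add: not_less)
    then have "c \<le> liminf X" by (rule Liminf_bounded)
    then show False using assms by simp
  qed
  then show ?thesis using infinite_enumerate that by (metis mem_Collect_eq)
qed

lemma total_variation_approx_var:
  assumes "total_variation M \<Omega> u < \<epsilon>"
  shows "approx_var M \<Omega> u \<epsilon>"
proof -
  obtain v g where vg: "\<And>i::nat. locally_lipschitz_on \<Omega> (v i)" "\<And>i. upper_gradient \<Omega> (\<lambda>x. ereal (v i x)) (g i)"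
    "L1_loc_tendsto M \<Omega> v u" "liminf (\<lambda>i. \<integral>\<^sup>+x\<in>\<Omega>. g i x \<partial>M) < \<epsilon>"
    using assms by (auto simp: total_variation_def INF_less_iff)
  obtain r :: "nat \<Rightarrow> nat" where r: "strict_mono r" "\<And>i. (\<integral>\<^sup>+x\<in>\<Omega>. g (r i) x \<partial>M) < \<epsilon>"
    using liminf_less_subseq[OF vg(4)] by auto
  show ?thesis unfolding approx_var_def
    using vg r locally_lipschitz_continuous[OF vg(1)] L1_loc_tendsto_subseq[OF vg(3) r(1)]
    by (intro exI[of _ "\<lambda>i. v (r i)"] exI[of _ "\<lambda>i. g (r i)"]) (auto intro: less_imp_le)
qed

text \<open>If \<open>u\<close> is farther than \<open>2 * \<eta>\<close> from the level
  \<open>t\<close> and \<open>v\<close> is within \<eta> of \<open>u\<close>, then \<open>v\<close>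
  lies on the same side of \<open>{t..t + h}\<close> as \<open>u\<close> does of \<open>t\<close>,
  and the left side is 0. Otherwise it is at most 1, which is charged to the first term if
  \<open>u\<close> is near \<open>t\<close> and to the second if \<open>v\<close> is far from
  \<open>u\<close>. Infinite values of \<open>u\<close> fall under the latter.\<close>

lemma clamp_indicator_diff:
  fixes t h \<eta> v :: real and u :: ereal
  assumes h: "0 < h" "h < \<eta>"
  shows "ennreal \<bar>(max t (min (t + h) v) - t) / h - of_bool (ereal t < u)\<bar>
    \<le> of_bool (ereal (t - 2 * \<eta>) \<le> u \<and> u \<le> ereal (t + 2 * \<eta>)) + ennreal (1 / \<eta>) * e2ennreal \<bar>ereal v - u\<bar>"
proof -
  let ?W = "(max t (min (t + h) v) - t) / h"
  have W: "0 \<le> ?W" "?W \<le> 1" using h by (auto simp: divide_le_eq)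
  have d1: "\<bar>?W - of_bool b\<bar> \<le> 1" for b
  proof -
    define w where "w = ?W"
    have "0 \<le> w" "w \<le> 1" using W by (auto simp: w_def)
    then show ?thesis unfolding w_def[symmetric] by (cases b) auto
  qed
  then have le1: "ennreal \<bar>?W - of_bool (ereal t < u)\<bar> \<le> 1" by (simp only: ennreal_le_1)
  show ?thesis
  proof (cases u)
    case (real q)
    have "\<bar>?W - of_bool (t < q)\<bar> \<le> of_bool (t - 2 * \<eta> \<le> q \<and> q \<le> t + 2 * \<eta>) + 1 / \<eta> * \<bar>v - q\<bar>"
    proof -
      consider "t - 2 * \<eta> \<le> q \<and> q \<le> t + 2 * \<eta>" | "\<eta> \<le> \<bar>v - q\<bar>"
        | "q < t - 2 * \<eta>" "\<bar>v - q\<bar> < \<eta>" | "t + 2 * \<eta> < q" "\<bar>v - q\<bar> < \<eta>" by linarith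
      then show ?thesis
      proof cases
        case 1
        then have "of_bool (t - 2 * \<eta> \<le> q \<and> q \<le> t + 2 * \<eta>) = (1::real)" by simp
        moreover have "0 \<le> 1 / \<eta> * \<bar>v - q\<bar>" using h by simp
        ultimately show ?thesis using d1[of "t < q"] by linarith
      next
        case 2
        then have "1 \<le> 1 / \<eta> * \<bar>v - q\<bar>" using h by (simp add: le_divide_eq)
        then show ?thesis using d1[of "t < q"] by (intro add_increasing) auto
      next
        case 3
        then have "v \<le> t" "\<not> t < q" using h by linarith+
        then show ?thesis using h by simp
      next
        case 4
        then have "t + h \<le> v" "t < q" using h by linarith+
        then show ?thesis using h by simp
      qed
    qed
    then have "ennreal \<bar>?W - of_bool (t < q)\<bar>
        \<le> ennreal (of_bool (t - 2 * \<eta> \<le> q \<and> q \<le> t + 2 * \<eta>)) + ennreal (1 / \<eta>) * ennreal \<bar>v - q\<bar>"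
      using h by (simp flip: ennreal_plus ennreal_mult add: ennreal_leI)
    then show ?thesis using real h by (simp add: of_bool_def e2ennreal_abs_diff split: if_splits)
  next
    case PInf
    then show ?thesis using h le1 by (simp add: ennreal_mult_top)
  next
    case MInf
    then show ?thesis using h le1 by (simp add: ennreal_mult_top)
  qed
qed

context doubling_space
begin

section \<open>The coarea inequality\<close>

lemma sigma_finite: "sigma_finite_measure M"
proof
  have "(\<Union>n::nat. ball undefined (real n)) = (UNIV::'a set)"
    by (auto intro: reals_Archimedean2)
  then show "\<exists>A. countable A \<and> A \<subseteq> sets M \<and> \<Union> A = space M \<and> (\<forall>a\<in>A. emeasure M a \<noteq> \<infinity>)"
    using ball_finite by (intro exI[of _ "range (\<lambda>n::nat. ball undefined (real n))"]) (auto simp: less_top)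
qed

text \<open>The clamps of \<open>v i\<close> to \<open>{t..t + h i}\<close>, rescaled to height one,
  converge to the indicator of \<open>{u > t}\<close> for almost all \<open>t\<close>. By Fubini
  their energies integrate over \<open>t\<close> to at most \<epsilon>, whatever \<open>h i\<close>
  is, so Fatou's lemma finds a level at which infinitely many of them are small.\<close>

lemma coarea:
  assumes app: "approx_var M \<Omega> u (ennreal \<epsilon>)" and \<Omega>: "open \<Omega>" and \<epsilon>: "0 < \<epsilon>"
    and u: "u \<in> borel_measurable (restrict_space M \<Omega>)"
  obtains t where "1/4 < t" "t < 3/4" "approx_per M \<Omega> {x\<in>\<Omega>. ereal t < u x} (ennreal (3 * \<epsilon>))"
proof -
  obtain v g where vg: "\<And>i::nat. continuous_on \<Omega> (v i)" "\<And>i. upper_gradient \<Omega> (\<lambda>x. ereal (v i x)) (g i)"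
    "\<And>i. (\<integral>\<^sup>+x\<in>\<Omega>. g i x \<partial>M) \<le> ennreal \<epsilon>" and conv: "L1_loc_tendsto M \<Omega> v u"
    using app unfolding approx_var_def by blast
  \<comment> \<open>Cutting everything off outside \<Omega> gives functions that are measurable on
    the whole space, to which Fubini applies.\<close>
  define V where "V i x = v i x * indicator \<Omega> x" for i x
  define G where "G i x = g i x * indicator \<Omega> x" for i x
  have \<Omega>M: "\<Omega> \<inter> space M \<in> sets M" using \<Omega> by auto
  have [measurable]: "V i \<in> borel_measurable M" for i
    using borel_measurable_M[OF borel_measurable_continuous_on_indicator[OF _ vg(1)[of i]]] \<Omega>
    by (simp add: V_def[abs_def] mult.commute)
  have [measurable]: "G i \<in> borel_measurable M" for i
  proof -
    have "G i \<in> borel_measurable borel"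
      using upper_gradient_measurable[OF vg(2)[of i]] \<Omega> unfolding G_def
      by (subst (asm) borel_measurable_restrict_space_iff_ennreal) auto
    then show ?thesis by (rule borel_measurable_M)
  qed
  define u' where "u' x = u x * indicator \<Omega> x" for x
  have [measurable]: "u' \<in> borel_measurable M"
    using u \<Omega>M unfolding u'_def by (subst (asm) borel_measurable_restrict_space_iff_ereal) auto
  have [measurable]: "\<Omega> \<in> sets M" using \<Omega> by auto
  define h where "h i = 1 / real (Suc i)" for i
  have h: "0 < h i" for i by (simp add: h_def)
  define g' where "g' i t x = ennreal (1 / h i) * (g i x * indicator {x. t \<le> v i x \<and> v i x \<le> t + h i} x)" for i t x
  define \<Phi> where "\<Phi> i t = (\<integral>\<^sup>+x\<in>\<Omega>. g' i t x \<partial>M)" for i t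
  have \<Phi>_eq: "\<Phi> i t = (\<integral>\<^sup>+x. ennreal (1 / h i) * (G i x * indicator {0..h i} (V i x - t)) \<partial>M)" for i t
    unfolding \<Phi>_def g'_def G_def V_def by (intro nn_integral_cong) (auto simp: indicator_def)
  interpret P: pair_sigma_finite M lborel
    using sigma_finite lborel.sigma_finite_measure_axioms by (simp add: pair_sigma_finite_def)
  have [measurable]: "\<Phi> i \<in> borel_measurable lborel" for i
    unfolding \<Phi>_eq using sigma_finite by (intro sigma_finite_measure.borel_measurable_nn_integral) measurable
  have int\<Phi>: "(\<integral>\<^sup>+t. \<Phi> i t \<partial>lborel) \<le> ennreal \<epsilon>" for i
  proof -
    have "(\<integral>\<^sup>+t. \<Phi> i t \<partial>lborel)
        = (\<integral>\<^sup>+x. (\<integral>\<^sup>+t. ennreal (1 / h i) * (G i x * indicator {0..h i} (V i x - t)) \<partial>lborel) \<partial>M)"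
      unfolding \<Phi>_eq by (rule P.Fubini') measurable
    also have "\<dots> = (\<integral>\<^sup>+x. G i x \<partial>M)"
    proof (rule nn_integral_cong)
      fix x
      have "(\<integral>\<^sup>+t. ennreal (1 / h i) * (G i x * indicator {0..h i} (V i x - t)) \<partial>lborel)
          = (\<integral>\<^sup>+t. (ennreal (1 / h i) * G i x) * indicator {V i x - h i..V i x} t \<partial>lborel)"
        by (intro nn_integral_cong) (auto simp: indicator_def mult.assoc)
      also have "\<dots> = (ennreal (1 / h i) * G i x) * ennreal (h i)"
        using h[of i] by (subst nn_integral_cmult_indicator) auto
      also have "\<dots> = (ennreal (1 / h i) * ennreal (h i)) * G i x" by (simp only: ac_simps)
      also have "ennreal (1 / h i) * ennreal (h i) = 1"
        using h[of i] by (subst ennreal_mult[symmetric]) auto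
      finally show "(\<integral>\<^sup>+t. ennreal (1 / h i) * (G i x * indicator {0..h i} (V i x - t)) \<partial>lborel) = G i x" by simp
    qed
    also have "\<dots> \<le> ennreal \<epsilon>" using vg(3)[of i] by (simp add: G_def)
    finally show ?thesis .
  qed
  \<comment> \<open>The clamps of \<open>v i\<close> need not converge where \<open>u\<close> equals
    \<open>t\<close>; by Fubini such points matter only for a null set of levels.\<close>
  have null: "AE t in lborel. emeasure M {x\<in>\<Omega>. u x = ereal t} = 0"
  proof -
    define N where "N t = (\<integral>\<^sup>+x. indicator \<Omega> x * indicator {0} (u' x - ereal t) \<partial>M)" for t :: real
    have [measurable]: "N \<in> borel_measurable lborel"
      unfolding N_def using sigma_finite by (intro sigma_finite_measure.borel_measurable_nn_integral) measurable
    have "(\<integral>\<^sup>+t. N t \<partial>lborel) = (\<integral>\<^sup>+x. (\<integral>\<^sup>+t. indicator \<Omega> x * indicator {0} (u' x - ereal t) \<partial>lborel) \<partial>M)"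
      unfolding N_def by (rule P.Fubini') measurable
    also have "\<dots> = (\<integral>\<^sup>+x. 0 \<partial>M)"
    proof (rule nn_integral_cong)
      fix x
      have "(\<integral>\<^sup>+t. indicator \<Omega> x * indicator {0} (u' x - ereal t) \<partial>lborel)
          \<le> (\<integral>\<^sup>+t. indicator {real_of_ereal (u' x)} t \<partial>lborel)"
      proof (rule nn_integral_mono)
        fix t
        show "indicator \<Omega> x * indicator {0} (u' x - ereal t) \<le> (indicator {real_of_ereal (u' x)} t :: ennreal)"
          by (cases "u' x") (auto simp: indicator_def zero_ereal_def)
      qed
      then show "(\<integral>\<^sup>+t. indicator \<Omega> x * indicator {0} (u' x - ereal t) \<partial>lborel) = 0" by simp
    qed
    finally have "AE t in lborel. N t = 0" by (simp add: nn_integral_0_iff_AE)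
    moreover have "N t = emeasure M {x\<in>\<Omega>. u x = ereal t}" for t
    proof -
      have "{x\<in>\<Omega>. u x = ereal t} = \<Omega> \<inter> {x\<in>space M. u' x = ereal t}" by (auto simp: u'_def)
      also have "\<dots> \<in> sets M" by measurable
      finally have m: "{x\<in>\<Omega>. u x = ereal t} \<in> sets M" .
      have "N t = (\<integral>\<^sup>+x. indicator {x\<in>\<Omega>. u x = ereal t} x \<partial>M)"
        unfolding N_def
      proof (rule nn_integral_cong)
        fix x
        show "indicator \<Omega> x * indicator {0} (u' x - ereal t) = (indicator {x\<in>\<Omega>. u x = ereal t} x :: ennreal)"
          by (cases "u x") (auto simp: indicator_def u'_def zero_ereal_def)
      qed
      then show ?thesis using m by simp
    qed
    ultimately show ?thesis by simp
  qed
  \<comment> \<open>The interval has length 1/2, so a liminf of at least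
    \<open>3 * \<epsilon>\<close> almost everywhere on it would integrate to more than
    \<epsilon>.\<close>
  have "\<exists>t. 1/4 < t \<and> t < 3/4 \<and> emeasure M {x\<in>\<Omega>. u x = ereal t} = 0 \<and> liminf (\<lambda>i. \<Phi> i t) < ennreal (3 * \<epsilon>)"
  proof (rule ccontr)
    assume contr: "\<not> ?thesis"
    have "(\<integral>\<^sup>+t. ennreal (3 * \<epsilon>) * indicator {1/4<..<3/4::real} t \<partial>lborel) \<le> (\<integral>\<^sup>+t. liminf (\<lambda>i. \<Phi> i t) \<partial>lborel)"
    proof (rule nn_integral_mono_AE)
      show "AE t in lborel. ennreal (3 * \<epsilon>) * indicator {1/4<..<3/4::real} t \<le> liminf (\<lambda>i. \<Phi> i t)"
        using null by eventually_elim (use contr in \<open>auto simp: indicator_def not_less\<close>)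
    qed
    also have "\<dots> \<le> liminf (\<lambda>i. \<integral>\<^sup>+t. \<Phi> i t \<partial>lborel)" by (intro nn_integral_liminf) measurable
    also have "\<dots> \<le> liminf (\<lambda>i. ennreal \<epsilon>)" by (intro Liminf_mono always_eventually allI int\<Phi>)
    also have "\<dots> = ennreal \<epsilon>" by (simp add: Liminf_const)
    also have "(\<integral>\<^sup>+t. ennreal (3 * \<epsilon>) * indicator {1/4<..<3/4::real} t \<partial>lborel) = ennreal (3 * \<epsilon> * (1/2))"
    proof -
      have "(\<integral>\<^sup>+t. ennreal (3 * \<epsilon>) * indicator {1/4<..<3/4::real} t \<partial>lborel) = ennreal (3 * \<epsilon>) * ennreal (1/2)"
        by (subst nn_integral_cmult_indicator) (simp_all del: ennreal_half ennreal_divide_numeral)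
      then show ?thesis using \<epsilon> by (simp only: ennreal_mult'')
    qed
    finally show False using \<epsilon> by simp
  qed
  then obtain t where t: "1/4 < t" "t < 3/4" "emeasure M {x\<in>\<Omega>. u x = ereal t} = 0"
    "liminf (\<lambda>i. \<Phi> i t) < ennreal (3 * \<epsilon>)" by blast
  obtain r :: "nat \<Rightarrow> nat" where r: "strict_mono r" "\<And>i. \<Phi> (r i) t < ennreal (3 * \<epsilon>)"
    using liminf_less_subseq[OF t(4)] by auto
  define W where "W i x = (max t (min (t + h i) (v i x)) - t) / h i" for i x
  have W: "0 \<le> W i x" "W i x \<le> 1" for i x using h[of i] by (auto simp: W_def divide_le_eq)
  have Wc: "continuous_on \<Omega> (W i)" for i
    unfolding W_def using vg(1) h[of i] by (intro continuous_intros) auto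
  have Wu: "upper_gradient \<Omega> (\<lambda>x. ereal (W i x)) (g' i t)" for i
  proof -
    have m: "(\<lambda>x. g i x * indicator {x. t \<le> v i x \<and> v i x \<le> t + h i} x) \<in> borel_measurable (restrict_space borel \<Omega>)"
    proof -
      have [measurable]: "v i \<in> borel_measurable (restrict_space borel \<Omega>)"
        by (intro borel_measurable_continuous_on_restrict vg)
      have [measurable]: "g i \<in> borel_measurable (restrict_space borel \<Omega>)"
        by (rule upper_gradient_measurable[OF vg(2)])
      have "(\<lambda>x. g i x * indicator {0..h i} (v i x - t)) \<in> borel_measurable (restrict_space borel \<Omega>)" by measurable
      also have "(\<lambda>x. g i x * indicator {0..h i} (v i x - t)) = (\<lambda>x. g i x * indicator {x. t \<le> v i x \<and> v i x \<le> t + h i} x)"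
        by (auto simp: indicator_def fun_eq_iff)
      finally show ?thesis .
    qed
    have "upper_gradient \<Omega> (\<lambda>x. ereal (max t (min (t + h i) (v i x))))
        (\<lambda>x. g i x * indicator {x. t \<le> v i x \<and> v i x \<le> t + h i} x)"
      using h[of i] by (intro upper_gradient_clamp[OF vg(2,1) _ m]) auto
    from upper_gradient_affine[OF this, of "1 / h i" "- t / h i"]
    show ?thesis using h[of i] by (simp add: W_def g'_def[abs_def] diff_divide_distrib)
  qed
  let ?A = "{x\<in>\<Omega>. ereal t < u x}"
  have Wconv: "L1_loc_tendsto M \<Omega> W (\<lambda>x. ereal (indicator ?A x))"
    unfolding L1_loc_tendsto_def
  proof
    fix x assume "x \<in> \<Omega>"
    then obtain s where s: "0 < s" "ball x s \<subseteq> \<Omega>"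
      "(\<lambda>i. \<integral>\<^sup>+y\<in>ball x s. e2ennreal \<bar>ereal (v i y) - u y\<bar> \<partial>M) \<longlonglongrightarrow> 0"
      using conv by (auto simp: L1_loc_tendsto_def)
    let ?B = "ball x s"
    \<comment> \<open>The exceptional set of \<open>clamp_indicator_diff\<close> for \<eta> equal to
      \<open>1 / real (Suc n)\<close>, within the ball. These sets shrink to a part of
      \<open>{u = t}\<close>, which is null.\<close>
    define S where "S n = {y\<in>?B. ereal (t - 2 / real (Suc n)) \<le> u y \<and> u y \<le> ereal (t + 2 / real (Suc n))}" for n
    have S: "S n \<in> sets M" for n
    proof -
      have "S n = ?B \<inter> {y\<in>space M. ereal (t - 2 / real (Suc n)) \<le> u' y \<and> u' y \<le> ereal (t + 2 / real (Suc n))}"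
        using s(2) by (auto simp: S_def u'_def)
      also have "\<dots> \<in> sets M" by measurable
      finally show ?thesis .
    qed
    have Z: "{y\<in>\<Omega>. u y = ereal t} \<in> sets M"
    proof -
      have "{x\<in>\<Omega>. u x = ereal t} = \<Omega> \<inter> {x\<in>space M. u' x = ereal t}" by (auto simp: u'_def)
      also have "\<dots> \<in> sets M" by measurable
      finally show ?thesis .
    qed
    have "(\<lambda>n. emeasure M (S n - {y\<in>\<Omega>. u y = ereal t})) \<longlonglongrightarrow> 0"
    proof (rule emeasure_decseq_0[where ?x0.0 = x and r = s])
      show "decseq (\<lambda>n. S n - {y\<in>\<Omega>. u y = ereal t})"
      proof (rule decseq_SucI, rule subsetI)
        fix n y assume "y \<in> S (Suc n) - {y\<in>\<Omega>. u y = ereal t}"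
        moreover have "2 / real (Suc (Suc n)) \<le> 2 / real (Suc n)" by (intro divide_left_mono) auto
        ultimately show "y \<in> S n - {y\<in>\<Omega>. u y = ereal t}"
          by (cases "u y") (auto simp: S_def)
      qed
      have False if y: "y \<in> (\<Inter>n. S n - {y\<in>\<Omega>. u y = ereal t})" for y
      proof (cases "u y")
        case (real q)
        have "\<bar>q - t\<bar> \<le> 2 / real (Suc n)" for n
          using y real by (auto simp: S_def abs_le_iff) (smt (verit) INT_D UNIV_I)+
        moreover have "(\<lambda>n. 2 / real (Suc n)) \<longlonglongrightarrow> 0"
          using tendsto_mult_right_zero[OF LIMSEQ_inverse_real_of_nat, of 2] by (simp add: divide_inverse)
        ultimately have "\<bar>q - t\<bar> \<le> 0" by (intro LIMSEQ_le_const[of _ 0 "\<bar>q - t\<bar>"]) auto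
        then show False using y real s(2) by (auto simp: S_def)
      qed (use y in \<open>auto simp: S_def\<close>)
      then show "(\<Inter>n. S n - {y\<in>\<Omega>. u y = ereal t}) = {}" by blast
    qed (use S Z in \<open>auto simp: S_def\<close>)
    moreover have "emeasure M (S n - {y\<in>\<Omega>. u y = ereal t}) = emeasure M (S n)" for n
      using S Z t(3) by (intro emeasure_Diff_null_set) auto
    ultimately have S0: "(\<lambda>n. emeasure M (S n)) \<longlonglongrightarrow> 0" by simp
    have "(\<lambda>i. \<integral>\<^sup>+y\<in>?B. e2ennreal \<bar>ereal (W i y) - ereal (indicator ?A y)\<bar> \<partial>M) \<longlonglongrightarrow> 0"
    proof (rule ennreal_tendsto_0I)
      fix e :: real assume e: "0 < e"
      obtain n where n: "emeasure M (S n) \<le> ennreal (e/2)"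
        using ennreal_tendsto_0D[OF S0, of "e/2"] e by (auto simp: eventually_sequentially)
      define \<eta> where "\<eta> = 1 / real (Suc n)"
      have \<eta>: "0 < \<eta>" by (simp add: \<eta>_def)
      have "eventually (\<lambda>i. (\<integral>\<^sup>+y\<in>?B. e2ennreal \<bar>ereal (v i y) - u y\<bar> \<partial>M) \<le> ennreal (\<eta> * (e/2))) sequentially"
        using \<eta> e by (intro ennreal_tendsto_0D[OF s(3)]) simp
      moreover have "eventually (\<lambda>i. i > n) sequentially" by (rule eventually_gt_at_top)
      ultimately show "eventually (\<lambda>i. (\<integral>\<^sup>+y\<in>?B. e2ennreal \<bar>ereal (W i y) - ereal (indicator ?A y)\<bar> \<partial>M) \<le> ennreal e) sequentially"
      proof eventually_elim
        case (elim i)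
        have hi: "h i < \<eta>" using elim(2) by (simp add: h_def \<eta>_def frac_less2)
        have "(\<integral>\<^sup>+y\<in>?B. e2ennreal \<bar>ereal (W i y) - ereal (indicator ?A y)\<bar> \<partial>M)
            \<le> (\<integral>\<^sup>+y. indicator (S n) y + ennreal (1 / \<eta>) * (e2ennreal \<bar>ereal (V i y) - u' y\<bar> * indicator ?B y) \<partial>M)"
        proof (rule nn_integral_mono)
          fix y
          show "e2ennreal \<bar>ereal (W i y) - ereal (indicator ?A y)\<bar> * indicator ?B y
              \<le> indicator (S n) y + ennreal (1 / \<eta>) * (e2ennreal \<bar>ereal (V i y) - u' y\<bar> * indicator ?B y)"
          proof (cases "y \<in> ?B")
            case True
            then have y: "y \<in> \<Omega>" using s(2) by auto
            have ind: "indicator ?A y = (of_bool (ereal t < u y) :: real)"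
              "indicator (S n) y = (of_bool (ereal (t - 2 * \<eta>) \<le> u y \<and> u y \<le> ereal (t + 2 * \<eta>)) :: ennreal)"
              using y True by (auto simp: indicator_def S_def \<eta>_def)
            have VV: "V i y = v i y" "u' y = u y" using y by (auto simp: V_def u'_def)
            show ?thesis
              using clamp_indicator_diff[OF h[of i] hi, of t "v i y" "u y"] True
              unfolding ind e2ennreal_abs_diff W_def VV by simp
          qed simp
        qed
        also have "\<dots> = emeasure M (S n) + ennreal (1 / \<eta>) * (\<integral>\<^sup>+y\<in>?B. e2ennreal \<bar>ereal (V i y) - u' y\<bar> \<partial>M)"
          using S by (subst nn_integral_add) (auto simp: nn_integral_cmult)
        also have "(\<integral>\<^sup>+y\<in>?B. e2ennreal \<bar>ereal (V i y) - u' y\<bar> \<partial>M) = (\<integral>\<^sup>+y\<in>?B. e2ennreal \<bar>ereal (v i y) - u y\<bar> \<partial>M)"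
          using s(2) by (intro nn_integral_cong) (auto simp: V_def u'_def indicator_def)
        also have "emeasure M (S n) + ennreal (1 / \<eta>) * \<dots> \<le> ennreal (e/2) + ennreal (1/\<eta>) * ennreal (\<eta> * (e/2))"
          using n elim(1) by (intro add_mono mult_left_mono) auto
        also have "\<dots> = ennreal e"
          using \<eta> e by (simp flip: ennreal_plus ennreal_mult)
        finally show ?case .
      qed
    qed
    then show "\<exists>r>0. ball x r \<subseteq> \<Omega> \<and>
        (\<lambda>i. \<integral>\<^sup>+y\<in>ball x r. e2ennreal \<bar>ereal (W i y) - ereal (indicator ?A y)\<bar> \<partial>M) \<longlonglongrightarrow> 0"
      using s by blast
  qed
  have "approx_per M \<Omega> ?A (ennreal (3 * \<epsilon>))"
    unfolding approx_per_def
  proof (intro exI[of _ "\<lambda>i. W (r i)"] exI[of _ "\<lambda>i. g' (r i) t"] conjI allI)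
    show "(\<integral>\<^sup>+x\<in>\<Omega>. g' (r i) t x \<partial>M) \<le> ennreal (3 * \<epsilon>)" for i
      using r(2)[of i] by (simp add: \<Phi>_def)
  qed (use W Wc Wu L1_loc_tendsto_subseq[OF Wconv r(1)] in auto)
  then show ?thesis using that t by blast
qed

section \<open>Extension by zero of a set of small perimeter\<close>

lemma L1_loc_tendsto_compact:
  assumes conv: "L1_loc_tendsto M \<Omega> v (\<lambda>x. ereal (indicator A x))" and K: "compact K" "K \<subseteq> \<Omega>"
    and v: "\<And>i. continuous_on \<Omega> (v i)" and \<Omega>: "open \<Omega>" and A: "A \<in> sets M"
  shows "(\<lambda>i. \<integral>\<^sup>+x\<in>K. ennreal \<bar>v i x - indicator A x\<bar> \<partial>M) \<longlonglongrightarrow> 0"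
proof -
  define V where "V i x = v i x * indicator \<Omega> x" for i x
  have [measurable]: "V i \<in> borel_measurable M" for i
    using borel_measurable_M[OF borel_measurable_continuous_on_indicator[OF _ v(1)[of i]]] \<Omega>
    by (simp add: V_def[abs_def] mult.commute)
  note A[measurable]
  let ?P = "\<lambda>x r. 0 < r \<and> ball x r \<subseteq> \<Omega> \<and>
    (\<lambda>i. \<integral>\<^sup>+y\<in>ball x r. ennreal \<bar>v i y - indicator A y\<bar> \<partial>M) \<longlonglongrightarrow> 0"
  have "\<forall>x\<in>K. \<exists>r. ?P x r"
  proof
    fix x assume "x \<in> K"
    then have "x \<in> \<Omega>" using K(2) by auto
    from conv[unfolded L1_loc_tendsto_def e2ennreal_abs_diff, rule_format, OF this]
    show "\<exists>r. ?P x r" by (simp only:)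
  qed
  then have "\<exists>r. \<forall>x\<in>K. ?P x (r x)" by (rule bchoice)
  then obtain r where rP: "\<forall>x\<in>K. ?P x (r x)" ..
  have r: "0 < r x" "ball x (r x) \<subseteq> \<Omega>"
    "(\<lambda>i. \<integral>\<^sup>+y\<in>ball x (r x). ennreal \<bar>v i y - indicator A y\<bar> \<partial>M) \<longlonglongrightarrow> 0" if "x \<in> K" for x
    using bspec[OF rP that] by simp_all
  obtain F where F: "F \<subseteq> K" "finite F" "K \<subseteq> (\<Union>x\<in>F. ball x (r x))"
    by (rule compactE_image[OF K(1), of K "\<lambda>x. ball x (r x)"]) (use r(1) in force)+
  have "(\<lambda>i. \<Sum>x\<in>F. \<integral>\<^sup>+y\<in>ball x (r x). ennreal \<bar>v i y - indicator A y\<bar> \<partial>M) \<longlonglongrightarrow> (\<Sum>x\<in>F. 0)"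
    using F(1) r(3) by (intro tendsto_sum) auto
  then have lim: "(\<lambda>i. \<Sum>x\<in>F. \<integral>\<^sup>+y\<in>ball x (r x). ennreal \<bar>v i y - indicator A y\<bar> \<partial>M) \<longlonglongrightarrow> 0" by simp
  have bd: "(\<integral>\<^sup>+x\<in>K. ennreal \<bar>v i x - indicator A x\<bar> \<partial>M)
      \<le> (\<Sum>x\<in>F. \<integral>\<^sup>+y\<in>ball x (r x). ennreal \<bar>v i y - indicator A y\<bar> \<partial>M)" for i
  proof -
    have "(\<integral>\<^sup>+x\<in>K. ennreal \<bar>v i x - indicator A x\<bar> \<partial>M)
        \<le> (\<integral>\<^sup>+y. (\<Sum>x\<in>F. ennreal \<bar>V i y - indicator A y\<bar> * indicator (ball x (r x)) y) \<partial>M)"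
    proof (rule nn_integral_mono)
      fix y
      show "ennreal \<bar>v i y - indicator A y\<bar> * indicator K y
        \<le> (\<Sum>x\<in>F. ennreal \<bar>V i y - indicator A y\<bar> * indicator (ball x (r x)) y)"
      proof (cases "y \<in> K")
        case True
        then obtain x where x: "x \<in> F" "y \<in> ball x (r x)" using F(3) by blast
        have "ennreal \<bar>v i y - indicator A y\<bar> * indicator K y
            = ennreal \<bar>V i y - indicator A y\<bar> * indicator (ball x (r x)) y"
          using True K(2) x(2) by (auto simp: V_def)
        also have "\<dots> \<le> (\<Sum>x\<in>F. ennreal \<bar>V i y - indicator A y\<bar> * indicator (ball x (r x)) y)"
          using x(1) F(2) by (intro member_le_sum) auto
        finally show ?thesis .
      qed simp
    qed
    also have "\<dots> = (\<Sum>x\<in>F. \<integral>\<^sup>+y. ennreal \<bar>V i y - indicator A y\<bar> * indicator (ball x (r x)) y \<partial>M)"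
      by (rule nn_integral_sum) measurable
    also have "\<dots> = (\<Sum>x\<in>F. \<integral>\<^sup>+y\<in>ball x (r x). ennreal \<bar>v i y - indicator A y\<bar> \<partial>M)"
    proof (intro sum.cong nn_integral_cong refl)
      fix x y assume "x \<in> F"
      then have "ball x (r x) \<subseteq> \<Omega>" using F(1) r(2) by auto
      then show "ennreal \<bar>V i y - indicator A y\<bar> * indicator (ball x (r x)) y
          = ennreal \<bar>v i y - indicator A y\<bar> * indicator (ball x (r x)) y"
        by (cases "y \<in> ball x (r x)") (auto simp: V_def)
    qed
    finally show ?thesis .
  qed
  show ?thesis
    by (rule tendsto_sandwich[OF _ _ tendsto_const lim]) (auto intro: always_eventually bd)
qed

text \<open>The approximants on \<Omega> need not vanish near its boundary. Subtracting a cutoff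
  \<zeta> that is 0 on \<open>K\<close> and 1 from distance \<open>e\<close> on, and taking the
  positive part, makes them vanish there, since they are at most 1. The cutoff adds its slope
  \<open>L\<close> to the gradient only at points outside \<open>K\<close> where
  \<open>\<zeta> \<le> v i\<close>. The measure of these points tends to 0, because
  \<open>v i\<close> tends to 0 in measure off \<open>K\<close>, so the extra energy is eventually
  at most \<eta>.\<close>

lemma approx_per_zero_extension:
  assumes app: "approx_per M \<Omega> A (ennreal \<epsilon>)" and \<Omega>: "open \<Omega>" and K: "compact K" "K \<subseteq> \<Omega>"
    and A: "A \<in> sets M" "A \<subseteq> K" and \<eta>: "0 < \<eta>" and \<epsilon>: "0 \<le> \<epsilon>"
  shows "approx_per M UNIV A (ennreal (\<epsilon> + \<eta>))"
proof (cases "K = {}")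
  case True
  then have "A = {}" using A by simp
  have "upper_gradient UNIV (\<lambda>x::'a. ereal 0) (\<lambda>_. ennreal 0)"
    by (intro upper_gradient_lipschitz) (auto simp: lipschitz_on_def)
  then show ?thesis
    unfolding approx_per_def L1_loc_tendsto_def \<open>A = {}\<close>
    by (intro exI[of _ "\<lambda>_ _. 0"] conjI) (auto simp: e2ennreal_neg intro!: exI[of _ 1])
next
  case False
  obtain v g where vg: "\<And>i::nat. continuous_on \<Omega> (v i)" "\<And>i x. 0 \<le> v i x" "\<And>i x. v i x \<le> 1"
    "\<And>i. upper_gradient \<Omega> (\<lambda>x. ereal (v i x)) (g i)"
    "\<And>i. (\<integral>\<^sup>+x\<in>\<Omega>. g i x \<partial>M) \<le> ennreal \<epsilon>" and conv: "L1_loc_tendsto M \<Omega> v (\<lambda>x. ereal (indicator A x))"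
    using app unfolding approx_per_def by blast
  define f where "f x = infdist x K" for x
  have f: "continuous_on UNIV f" unfolding f_def by (intro continuous_intros)
  have f0: "0 \<le> f x" for x by (simp add: f_def infdist_nonneg)
  have fK: "f x = 0 \<longleftrightarrow> x \<in> K" for x
    using in_closed_iff_infdist_zero[OF compact_imp_closed[OF K(1)] False, of x] by (simp add: f_def)
  obtain e0 where e0: "0 < e0" "(\<Union>x\<in>K. cball x e0) \<subseteq> \<Omega>"
    using compact_subset_open_imp_cball_epsilon_subset[OF K(1) \<Omega> K(2)] by blast
  \<comment> \<open>Half of \<open>e0\<close>, so that \<open>infdist\<close> at most
    \<open>e\<close> yields a point of \<open>K\<close> at distance strictly below
    \<open>e0\<close>.\<close>
  define e where "e = e0 / 2"
  have e: "0 < e" using e0 by (simp add: e_def)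
  have near: "\<exists>k\<in>K. dist x k < e0" if "f x \<le> e" for x
  proof -
    have "(INF a\<in>K. dist x a) < e0" using that e0 False by (simp add: f_def infdist_notempty e_def)
    then show ?thesis using False by (subst (asm) cINF_less_iff) (auto intro: bdd_belowI2)
  qed
  have f\<Omega>: "{x. f x \<le> e} \<subseteq> \<Omega>"
  proof
    fix x assume "x \<in> {x. f x \<le> e}"
    then obtain k where "k \<in> K" "dist x k < e0" using near by auto
    then show "x \<in> \<Omega>" using e0(2) by (force simp: dist_commute)
  qed
  define K' where "K' = {x. f x \<le> e}"
  have clK': "closed K'" unfolding K'_def using f by (intro closed_Collect_le continuous_intros)
  have bK': "bounded K'"
  proof -
    obtain x0 R where R: "K \<subseteq> ball x0 R" using bounded_subset_ballD[OF compact_imp_bounded[OF K(1)]] by blast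
    have "K' \<subseteq> ball x0 (R + e0)"
    proof
      fix x assume "x \<in> K'"
      then obtain k where "k \<in> K" "dist x k < e0" using near by (auto simp: K'_def)
      then show "x \<in> ball x0 (R + e0)"
        using R dist_triangle[of x0 x k] by (force simp: dist_commute)
    qed
    then show ?thesis by (rule bounded_subset[OF bounded_ball])
  qed
  have K': "compact K'" "K' \<subseteq> \<Omega>" using compact_closed_bounded[OF clK' bK'] f\<Omega> by (auto simp: K'_def)
  define L where "L = 1 / e"
  have L: "0 < L" using e by (simp add: L_def)
  define \<zeta> where "\<zeta> x = min 1 (f x / e)" for x
  have \<zeta>0: "0 \<le> \<zeta> x" "\<zeta> x \<le> 1" for x using f0 e by (auto simp: \<zeta>_def)
  have \<zeta>c: "continuous_on S \<zeta>" for S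
    unfolding \<zeta>_def using e by (intro continuous_intros continuous_on_subset[OF f]) auto
  \<comment> \<open>Clamping at a positive level \<open>s\<close> instead of 0 takes
    \<open>K\<close> out of the region in which the gradient counts; then \<open>s\<close> tends to
    0.\<close>
  have \<zeta>u: "upper_gradient UNIV (\<lambda>x. ereal (\<zeta> x)) (\<lambda>x. ennreal L * indicator (- K) x)"
  proof (rule upper_gradient_uniform_limit)
    have Kb: "- K \<in> sets borel" using K(1) by (simp add: compact_imp_closed open_Compl)
    then show m: "(\<lambda>x. ennreal L * indicator (- K) x) \<in> borel_measurable (restrict_space borel UNIV)"
      by (intro measurable_restrict_space1 borel_measurable_times_ennreal) auto
    fix s :: real assume s: "0 < s" "s < 1"
    have "L-lipschitz_on UNIV (\<lambda>x. f x / e)"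
    proof (rule lipschitz_onI)
      fix x y
      have "\<bar>f x - f y\<bar> \<le> dist x y" unfolding f_def by (rule infdist_triangle_abs)
      then show "dist (f x / e) (f y / e) \<le> L * dist x y"
        using e by (simp add: dist_real_def L_def divide_le_cancel flip: diff_divide_distrib)
    qed (use L in simp)
    from upper_gradient_lipschitz[OF this]
    have "upper_gradient UNIV (\<lambda>x. ereal (max s (min 1 (f x / e)))) (\<lambda>x. ennreal L * indicator (- K) x)"
    proof (rule upper_gradient_clamp[OF _ _ _ m])
      show "continuous_on UNIV (\<lambda>x. f x / e)" using e by (intro continuous_intros f) auto
      fix x assume "s \<le> f x / e"
      then have "x \<notin> K" using s fK[of x] by auto
      then show "ennreal L \<le> ennreal L * indicator (- K) x" by simp
    qed (use s in simp)
    moreover have "\<bar>\<zeta> x - max s (min 1 (f x / e))\<bar> \<le> s" for x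
      using \<zeta>0(1)[of x] s by (auto simp: \<zeta>_def[symmetric] abs_if max_def)
    ultimately show "\<exists>w. upper_gradient UNIV (\<lambda>x. ereal (w x)) (\<lambda>x. ennreal L * indicator (- K) x) \<and>
        (\<forall>x\<in>UNIV. \<bar>\<zeta> x - w x\<bar> \<le> s)"
      by (intro exI[of _ "\<lambda>x. max s (min 1 (f x / e))"] conjI ballI)
  qed
  define w where "w i x = max 0 (min 1 (v i x - \<zeta> x))" for i x
  define g' where "g' i x = (g i x + ennreal L * indicator (- K) x) * indicator {x. \<zeta> x \<le> v i x} x" for i x
  have g'm: "g' i \<in> borel_measurable (restrict_space borel \<Omega>)" for i
  proof -
    have [measurable]: "v i \<in> borel_measurable (restrict_space borel \<Omega>)"
      by (intro borel_measurable_continuous_on_restrict vg)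
    have [measurable]: "\<zeta> \<in> borel_measurable (restrict_space borel \<Omega>)"
      by (intro borel_measurable_continuous_on_restrict \<zeta>c)
    have [measurable]: "g i \<in> borel_measurable (restrict_space borel \<Omega>)"
      by (rule upper_gradient_measurable[OF vg(4)])
    have [measurable]: "(\<lambda>x. ennreal L * indicator (- K) x) \<in> borel_measurable (restrict_space borel \<Omega>)"
      using upper_gradient_measurable[OF upper_gradient_mono_set[OF \<zeta>u subset_UNIV]] .
    have "(\<lambda>x. (g i x + ennreal L * indicator (- K) x) * indicator {0..} (v i x - \<zeta> x)) \<in> borel_measurable (restrict_space borel \<Omega>)"
      by measurable
    also have "(\<lambda>x. (g i x + ennreal L * indicator (- K) x) * indicator {0..} (v i x - \<zeta> x)) = g' i"
      by (auto simp: indicator_def fun_eq_iff g'_def)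
    finally show ?thesis .
  qed
  have wu: "upper_gradient \<Omega> (\<lambda>x. ereal (w i x)) (g' i)" for i
    unfolding w_def
  proof (rule upper_gradient_clamp[OF upper_gradient_diff[OF vg(4) upper_gradient_mono_set[OF \<zeta>u subset_UNIV]] _ _ g'm])
    show "continuous_on \<Omega> (\<lambda>x. v i x - \<zeta> x)" by (intro continuous_intros vg \<zeta>c)
  qed (auto simp: g'_def)
  define W where "W i x = (if f x \<le> e then w i x else 0)" for i x
  define G where "G i x = (if f x \<le> e then g' i x else 0)" for i x
  have w0: "w i x = 0" if "e \<le> f x" for i x
  proof -
    have "\<zeta> x = 1" using that e by (simp add: \<zeta>_def le_divide_eq)
    then show ?thesis using vg(3)[of i x] by (simp add: w_def)
  qed
  have Ww: "W i x = w i x" for i x using w0[of x i] by (auto simp: W_def)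
  have W01: "0 \<le> W i x" "W i x \<le> 1" for i x by (auto simp: W_def w_def)
  have Gm: "G i \<in> borel_measurable borel" for i
  proof -
    have "(\<lambda>x. g' i x * indicator \<Omega> x) \<in> borel_measurable borel"
      using g'm[of i] \<Omega> by (subst (asm) borel_measurable_restrict_space_iff_ennreal) auto
    from borel_measurable_times_ennreal[OF this borel_measurable_indicator[OF borel_closed[OF clK']]]
    have "(\<lambda>x. g' i x * indicator \<Omega> x * indicator K' x) \<in> borel_measurable borel" .
    moreover have "(\<lambda>x. g' i x * indicator \<Omega> x * indicator K' x) = G i"
      using f\<Omega> by (auto simp: G_def K'_def indicator_def fun_eq_iff)
    ultimately show ?thesis by simp
  qed
  have Wu: "upper_gradient UNIV (\<lambda>x. ereal (W i x)) (G i)" for i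
    by (rule upper_gradient_zero_extension[OF wu f f\<Omega> _ _ _ Gm]) (use W01 w0 in \<open>auto simp: W_def G_def\<close>)
  have Wc: "continuous_on UNIV (W i)" for i
  proof -
    have "continuous_on \<Omega> (W i)" unfolding Ww[abs_def] w_def by (intro continuous_intros vg \<zeta>c)
    moreover have "continuous_on (- K') (W i)"
      by (rule continuous_on_eq[OF continuous_on_const[of _ 0]]) (auto simp: W_def K'_def)
    ultimately have "continuous_on (\<Omega> \<union> - K') (W i)"
      using \<Omega> clK' by (intro continuous_on_open_Un) auto
    moreover have "\<Omega> \<union> - K' = UNIV" using K' by auto
    ultimately show ?thesis by simp
  qed
  have AK: "indicator A x = (0::real)" if "x \<notin> K" for x
  proof -
    have "x \<notin> A" using A(2) that by blast
    then show ?thesis by (rule indicator_simps)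
  qed
  have Wdiff: "\<bar>W i x - indicator A x\<bar> \<le> \<bar>v i x - indicator A x\<bar>" for i x
  proof (cases "x \<in> K")
    case True
    then have "\<zeta> x = 0" using fK[of x] by (simp add: \<zeta>_def)
    then show ?thesis using vg(2,3)[of i x] by (simp add: Ww w_def)
  next
    case False
    then show ?thesis using AK[of x] vg(2)[of i x] \<zeta>0[of x] by (auto simp: Ww w_def)
  qed
  have Wconv: "L1_loc_tendsto M UNIV W (\<lambda>x. ereal (indicator A x))"
    unfolding L1_loc_tendsto_def
  proof
    fix x :: 'a
    show "\<exists>r>0. ball x r \<subseteq> UNIV \<and> (\<lambda>i. \<integral>\<^sup>+y\<in>ball x r. e2ennreal \<bar>ereal (W i y) - ereal (indicator A y)\<bar> \<partial>M) \<longlonglongrightarrow> 0"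
    proof (cases "x \<in> \<Omega>")
      case True
      then obtain r where r: "0 < r"
        "(\<lambda>i. \<integral>\<^sup>+y\<in>ball x r. e2ennreal \<bar>ereal (v i y) - ereal (indicator A y)\<bar> \<partial>M) \<longlonglongrightarrow> 0"
        using conv by (auto simp: L1_loc_tendsto_def)
      have "(\<lambda>i. \<integral>\<^sup>+y\<in>ball x r. e2ennreal \<bar>ereal (W i y) - ereal (indicator A y)\<bar> \<partial>M) \<longlonglongrightarrow> 0"
      proof (rule tendsto_sandwich[OF _ _ tendsto_const r(2)])
        have "(\<integral>\<^sup>+y\<in>ball x r. e2ennreal \<bar>ereal (W i y) - ereal (indicator A y)\<bar> \<partial>M)
            \<le> (\<integral>\<^sup>+y\<in>ball x r. e2ennreal \<bar>ereal (v i y) - ereal (indicator A y)\<bar> \<partial>M)" for i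
          unfolding e2ennreal_abs_diff using Wdiff
          by (intro nn_integral_mono mult_right_mono ennreal_leI) auto
        then show "eventually (\<lambda>i. (\<integral>\<^sup>+y\<in>ball x r. e2ennreal \<bar>ereal (W i y) - ereal (indicator A y)\<bar> \<partial>M)
            \<le> (\<integral>\<^sup>+y\<in>ball x r. e2ennreal \<bar>ereal (v i y) - ereal (indicator A y)\<bar> \<partial>M)) sequentially"
          by (intro always_eventually allI)
      qed auto
      then show ?thesis using r(1) by blast
    next
      case False
      then have "x \<in> - K'" using K' by auto
      then obtain r where r: "0 < r" "ball x r \<subseteq> - K'"
        using clK' by (meson open_Compl open_contains_ball)
      have "(\<integral>\<^sup>+y\<in>ball x r. e2ennreal \<bar>ereal (W i y) - ereal (indicator A y)\<bar> \<partial>M) = (\<integral>\<^sup>+y. 0 \<partial>M)" for i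
      proof (rule nn_integral_cong)
        fix y
        have "W i y = 0 \<and> indicator A y = (0::real)" if "y \<in> ball x r"
        proof -
          have "y \<notin> K'" using r that by auto
          then have "e < f y" by (simp add: K'_def)
          then show ?thesis using e AK[of y] fK[of y] by (auto simp: W_def)
        qed
        then show "e2ennreal \<bar>ereal (W i y) - ereal (indicator A y)\<bar> * indicator (ball x r) y = 0"
          unfolding e2ennreal_abs_diff by (auto simp: indicator_def)
      qed
      then show ?thesis using r(1) by (intro exI[of _ r]) simp
    qed
  qed
  define Z where "Z i = {x\<in>K'. x \<notin> K \<and> \<zeta> x \<le> v i x}" for i
  define V where "V i x = v i x * indicator \<Omega> x" for i x
  have [measurable]: "V i \<in> borel_measurable M" for i
    using borel_measurable_M[OF borel_measurable_continuous_on_indicator[OF _ vg(1)[of i]]] \<Omega>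
    by (simp add: V_def[abs_def] mult.commute)
  have [measurable]: "\<zeta> \<in> borel_measurable M" "f \<in> borel_measurable M" using continuous_M \<zeta>c f by auto
  have [measurable]: "K \<in> sets M" "K' \<in> sets M" using compact_imp_closed[OF K(1)] clK' by auto
  note A(1)[measurable]
  have Zm [measurable]: "Z i \<in> sets M" for i
  proof -
    have "Z i = (K' - K) \<inter> {x\<in>space M. \<zeta> x \<le> V i x}" using K' by (auto simp: Z_def V_def)
    also have "\<dots> \<in> sets M" by measurable
    finally show ?thesis .
  qed
  have Z0: "(\<lambda>i. emeasure M (Z i)) \<longlonglongrightarrow> 0"
  proof (rule ennreal_tendsto_0I)
    fix d :: real assume d: "0 < d"
    \<comment> \<open>A point of \<open>Z i\<close> either lies in this layer around
      \<open>K\<close>, whose measure tends to 0 with increasing \<open>n\<close>, or has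
      \<open>v i\<close> at least \<open>1 / real (Suc n)\<close> although the limit is 0 there.
      Chebyshev's inequality bounds the measure of the latter points.\<close>
    define T where "T n = {x\<in>K'. x \<notin> K \<and> f x / e \<le> 1 / real (Suc n)}" for n
    have Tm [measurable]: "T n \<in> sets M" for n
    proof -
      have "T n = (K' - K) \<inter> {x\<in>space M. f x / e \<le> 1 / real (Suc n)}" by (auto simp: T_def)
      also have "\<dots> \<in> sets M" by measurable
      finally show ?thesis .
    qed
    obtain x0 R where x0R: "K' \<subseteq> ball x0 R" using bounded_subset_ballD[OF bK'] by blast
    have "(\<lambda>n. emeasure M (T n)) \<longlonglongrightarrow> 0"
    proof (rule emeasure_decseq_0)
      show "decseq T"
      proof (rule decseq_SucI, rule subsetI)
        fix n x assume "x \<in> T (Suc n)"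
        moreover have "1 / real (Suc (Suc n)) \<le> 1 / real (Suc n)" by (intro divide_left_mono) auto
        ultimately show "x \<in> T n" by (auto simp: T_def)
      qed
      have False if x: "x \<in> (\<Inter>n. T n)" for x
      proof -
        have "f x / e \<le> 1 / real (Suc n)" for n using x by (auto simp: T_def)
        moreover have "(\<lambda>n. 1 / real (Suc n)) \<longlonglongrightarrow> 0"
          using LIMSEQ_inverse_real_of_nat by (simp add: divide_inverse)
        ultimately have "f x / e \<le> 0" by (intro LIMSEQ_le_const[of _ 0 "f x / e"]) auto
        then have "f x = 0" using f0[of x] e by (simp add: divide_le_0_iff)
        then show False using x fK by (auto simp: T_def)
      qed
      then show "(\<Inter>n. T n) = {}" by blast
      show "T 0 \<subseteq> ball x0 R" using x0R by (auto simp: T_def)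
    qed (rule Tm)
    then obtain n where n: "emeasure M (T n) \<le> ennreal (d/2)"
      using ennreal_tendsto_0D[of _ sequentially "d/2"] d by (auto simp: eventually_sequentially)
    define a where "a = 1 / real (Suc n)"
    have a: "0 < a" by (simp add: a_def)
    have "eventually (\<lambda>i. (\<integral>\<^sup>+x\<in>K'. ennreal \<bar>v i x - indicator A x\<bar> \<partial>M) \<le> ennreal (a * (d/2))) sequentially"
      using a d by (intro ennreal_tendsto_0D L1_loc_tendsto_compact[OF conv K' vg(1) \<Omega> A(1)]) simp
    then show "eventually (\<lambda>i. emeasure M (Z i) \<le> ennreal d) sequentially"
    proof eventually_elim
      case (elim i)
      have "emeasure M (Z i) = (\<integral>\<^sup>+x. indicator (Z i) x \<partial>M)" by simp
      also have "\<dots> \<le> (\<integral>\<^sup>+x. indicator (T n) x + ennreal (1/a) * (ennreal \<bar>V i x - indicator A x\<bar> * indicator K' x) \<partial>M)"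
      proof (rule nn_integral_mono)
        fix x
        show "indicator (Z i) x \<le> indicator (T n) x + ennreal (1/a) * (ennreal \<bar>V i x - indicator A x\<bar> * indicator K' x)"
        proof (cases "x \<in> Z i \<and> x \<notin> T n")
          case True
          then have x: "x \<in> K'" "x \<notin> K" "\<zeta> x \<le> v i x" "a < f x / e" by (auto simp: Z_def T_def a_def)
          have "a \<le> 1" by (simp add: a_def)
          then have "a \<le> \<zeta> x" using x(4) by (simp add: \<zeta>_def)
          then have "a \<le> \<bar>V i x - indicator A x\<bar>" using x AK[of x] K' by (auto simp: V_def)
          then have "1 \<le> (1/a) * \<bar>V i x - indicator A x\<bar>" using a by (simp add: le_divide_eq)
          then have "1 \<le> ennreal ((1/a) * \<bar>V i x - indicator A x\<bar>)" by simp
          also have "\<dots> = ennreal (1/a) * ennreal \<bar>V i x - indicator A x\<bar>"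
            using a by (intro ennreal_mult) auto
          finally show ?thesis using True x(1) by simp
        qed (auto simp: indicator_def)
      qed
      also have "\<dots> = emeasure M (T n) + ennreal (1/a) * (\<integral>\<^sup>+x\<in>K'. ennreal \<bar>V i x - indicator A x\<bar> \<partial>M)"
        by (subst nn_integral_add) (auto simp: nn_integral_cmult)
      also have "(\<integral>\<^sup>+x\<in>K'. ennreal \<bar>V i x - indicator A x\<bar> \<partial>M) = (\<integral>\<^sup>+x\<in>K'. ennreal \<bar>v i x - indicator A x\<bar> \<partial>M)"
        using K'(2) by (intro nn_integral_cong) (auto simp: V_def indicator_def)
      also have "emeasure M (T n) + ennreal (1/a) * \<dots> \<le> ennreal (d/2) + ennreal (1/a) * ennreal (a * (d/2))"
        using n elim by (intro add_mono mult_left_mono) auto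
      also have "\<dots> = ennreal d" using a d by (simp flip: ennreal_plus ennreal_mult)
      finally show ?case .
    qed
  qed
  obtain N where N: "\<And>i. N \<le> i \<Longrightarrow> emeasure M (Z i) \<le> ennreal (\<eta> / L)"
    using ennreal_tendsto_0D[OF Z0, of "\<eta> / L"] \<eta> L by (auto simp: eventually_sequentially)
  have Gint: "(\<integral>\<^sup>+x. G i x \<partial>M) \<le> ennreal (\<epsilon> + \<eta>)" if "N \<le> i" for i
  proof -
    have gm [measurable]: "(\<lambda>x. g i x * indicator \<Omega> x) \<in> borel_measurable M"
      using upper_gradient_measurable[OF vg(4)[of i]] \<Omega>
      by (intro borel_measurable_M) (subst (asm) borel_measurable_restrict_space_iff_ennreal, auto)
    have "(\<integral>\<^sup>+x. G i x \<partial>M) \<le> (\<integral>\<^sup>+x. g i x * indicator \<Omega> x + ennreal L * indicator (Z i) x \<partial>M)"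
      using f\<Omega> by (intro nn_integral_mono) (auto simp: G_def g'_def Z_def K'_def indicator_def)
    also have "\<dots> = (\<integral>\<^sup>+x\<in>\<Omega>. g i x \<partial>M) + ennreal L * emeasure M (Z i)"
      by (subst nn_integral_add) (auto simp: nn_integral_cmult_indicator)
    also have "\<dots> \<le> ennreal \<epsilon> + ennreal L * ennreal (\<eta> / L)"
      using N[OF that] vg(5)[of i] by (intro add_mono mult_left_mono) auto
    also have "\<dots> = ennreal (\<epsilon> + \<eta>)" using L \<eta> \<epsilon> by (simp flip: ennreal_plus ennreal_mult)
    finally show ?thesis .
  qed
  have "strict_mono (\<lambda>i. i + N)" by (simp add: strict_mono_def)
  from L1_loc_tendsto_subseq[OF Wconv this]
  show ?thesis
    unfolding approx_per_def
    by (intro exI[of _ "\<lambda>i. W (i + N)"] exI[of _ "\<lambda>i. G (i + N)"]) (use Wc W01 Wu Gint in auto)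
qed

end

section \<open>The boxing inequality\<close>

text \<open>Zorn's lemma is applied to the disjoint subfamilies with this property: every ball of
  the whole family that meets a selected ball meets one of at least half its radius. A maximal
  subfamily meets every ball; otherwise, among the balls that it misses, one whose radius exceeds
  half the supremum of the radii could be added.\<close>

lemma vitali_balls:
  fixes \<rho> :: "'a::metric_space \<Rightarrow> real"
  assumes \<rho>: "\<And>x. x \<in> E \<Longrightarrow> 0 < \<rho> x" "\<And>x. x \<in> E \<Longrightarrow> \<rho> x \<le> R"
  obtains S where "S \<subseteq> E" "disjoint_family_on (\<lambda>x. ball x (\<rho> x)) S" "E \<subseteq> (\<Union>x\<in>S. ball x (5 * \<rho> x))"
proof -
  let ?B = "\<lambda>x. ball x (\<rho> x)"
  define good where "good = {S. S \<subseteq> E \<and> disjoint_family_on ?B S \<and>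
    (\<forall>x\<in>E. (\<exists>y\<in>S. ?B x \<inter> ?B y \<noteq> {}) \<longrightarrow> (\<exists>y\<in>S. ?B x \<inter> ?B y \<noteq> {} \<and> \<rho> x \<le> 2 * \<rho> y))}"
  have "\<exists>S\<in>good. \<forall>X\<in>good. S \<subseteq> X \<longrightarrow> X = S"
  proof (rule subset_Zorn')
    fix C assume C: "subset.chain good C"
    then have Cg: "S \<in> good" if "S \<in> C" for S using that by (auto simp: subset_chain_def)
    show "\<Union>C \<in> good"
      unfolding good_def
    proof (intro CollectI conjI ballI impI)
      show "\<Union>C \<subseteq> E"
      proof (rule Union_least)
        show "X \<subseteq> E" if "X \<in> C" for X using Cg[OF that] by (simp add: good_def)
      qed
      show "disjoint_family_on ?B (\<Union>C)"
        unfolding disjoint_family_on_def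
      proof (intro ballI impI)
        fix x y assume "x \<in> \<Union>C" "y \<in> \<Union>C" and xy: "x \<noteq> y"
        then obtain S T where ST: "S \<in> C" "T \<in> C" "x \<in> S" "y \<in> T" by auto
        then have "S \<subseteq> T \<or> T \<subseteq> S" using C by (auto simp: subset_chain_def)
        then obtain Q where "Q \<in> C" "x \<in> Q" "y \<in> Q" using ST by blast
        then show "?B x \<inter> ?B y = {}" using Cg[of Q] xy by (auto simp: good_def disjoint_family_on_def)
      qed
      fix x assume x: "x \<in> E" "\<exists>y\<in>\<Union>C. ?B x \<inter> ?B y \<noteq> {}"
      then obtain S y where S: "S \<in> C" "y \<in> S" "?B x \<inter> ?B y \<noteq> {}" by blast
      then have "\<exists>y\<in>S. ?B x \<inter> ?B y \<noteq> {} \<and> \<rho> x \<le> 2 * \<rho> y"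
        using Cg[OF S(1)] x(1) unfolding good_def by blast
      then show "\<exists>y\<in>\<Union>C. ?B x \<inter> ?B y \<noteq> {} \<and> \<rho> x \<le> 2 * \<rho> y" using S(1) by blast
    qed
  qed
  then obtain S where S: "S \<in> good" "\<And>X. X \<in> good \<Longrightarrow> S \<subseteq> X \<Longrightarrow> X = S" by blast
  have SE: "S \<subseteq> E" and Sd: "disjoint_family_on ?B S"
    and Sm: "\<And>x. x \<in> E \<Longrightarrow> (\<exists>y\<in>S. ?B x \<inter> ?B y \<noteq> {}) \<Longrightarrow> \<exists>y\<in>S. ?B x \<inter> ?B y \<noteq> {} \<and> \<rho> x \<le> 2 * \<rho> y"
    using S(1) unfolding good_def by blast+
  have meets: "\<exists>y\<in>S. ?B x \<inter> ?B y \<noteq> {}" if x: "x \<in> E" for x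
  proof (rule ccontr)
    assume n: "\<not> ?thesis"
    define E' where "E' = {x\<in>E. \<forall>y\<in>S. ?B x \<inter> ?B y = {}}"
    have E': "x \<in> E'" using x n by (auto simp: E'_def)
    have bdd: "bdd_above (\<rho> ` E')" using \<rho>(2) by (intro bdd_aboveI2[of _ _ R]) (auto simp: E'_def)
    define m where "m = Sup (\<rho> ` E')"
    have m: "\<rho> z \<le> m" if "z \<in> E'" for z unfolding m_def using that bdd by (intro cSup_upper) auto
    have "0 < m" using m[OF E'] \<rho>(1)[OF x] by linarith
    then have "m / 2 < m" by simp
    then obtain z where z: "z \<in> E'" "m / 2 < \<rho> z"
      unfolding m_def using less_cSup_iff[OF _ bdd, of "m / 2"] E' by (auto simp: m_def)
    have zE: "z \<in> E" "\<And>y. y \<in> S \<Longrightarrow> ?B z \<inter> ?B y = {}" using z(1) by (auto simp: E'_def)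
    have "z \<in> ?B z" using \<rho>(1)[OF zE(1)] by simp
    have "insert z S \<in> good"
      unfolding good_def
    proof (intro CollectI conjI ballI impI)
      show "insert z S \<subseteq> E" using SE zE by auto
      show "disjoint_family_on ?B (insert z S)"
        unfolding disjoint_family_on_def
      proof (intro ballI impI)
        fix p q assume pq: "p \<in> insert z S" "q \<in> insert z S" "p \<noteq> q"
        show "?B p \<inter> ?B q = {}"
        proof (cases "p = z")
          case True
          then show ?thesis using pq zE(2)[of q] by auto
        next
          case p: False
          show ?thesis
          proof (cases "q = z")
            case True
            then show ?thesis using pq zE(2)[of p] by auto
          next
            case False
            then show ?thesis using pq p Sd by (auto simp: disjoint_family_on_def)
          qed
        qed
      qed
      fix p assume p: "p \<in> E" "\<exists>y\<in>insert z S. ?B p \<inter> ?B y \<noteq> {}"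
      show "\<exists>y\<in>insert z S. ?B p \<inter> ?B y \<noteq> {} \<and> \<rho> p \<le> 2 * \<rho> y"
      proof (cases "\<exists>y\<in>S. ?B p \<inter> ?B y \<noteq> {}")
        case True
        then show ?thesis using Sm[OF p(1)] by blast
      next
        case False
        then have "p \<in> E'" using p(1) by (auto simp: E'_def)
        then have "\<rho> p \<le> 2 * \<rho> z" using m[of p] z(2) by linarith
        moreover have "?B p \<inter> ?B z \<noteq> {}" using p(2) False by blast
        ultimately show ?thesis by blast
      qed
    qed
    then have "insert z S = S" by (rule S(2)) auto
    then have "z \<in> S" by auto
    then show False using zE(2)[of z] \<open>z \<in> ?B z\<close> by auto
  qed
  show ?thesis
  proof (rule that[OF SE Sd], rule subsetI)
    fix x assume x: "x \<in> E"
    then obtain y where y: "y \<in> S" "?B x \<inter> ?B y \<noteq> {}" "\<rho> x \<le> 2 * \<rho> y" using Sm meets by blast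
    then obtain z where "dist x z < \<rho> x" "dist y z < \<rho> y" by auto
    then have "dist y x < 5 * \<rho> y" using y(3) dist_triangle2[of y x z] \<rho>(1)[of y] y(1) SE by auto
    then show "x \<in> (\<Union>x\<in>S. ball x (5 * \<rho> x))" using y(1) by auto
  qed
qed

context doubling_space
begin

text \<open>All terms are positive, so bounded finite sums force \<open>S\<close> to be countable.
  It can then be indexed by natural numbers, as the definition of the content demands.\<close>

lemma codim1_content_le:
  assumes E: "E \<subseteq> (\<Union>x\<in>S. ball x (\<rho> x))" and \<rho>: "\<And>x. x \<in> S \<Longrightarrow> 0 < \<rho> x" "\<And>x. x \<in> S \<Longrightarrow> \<rho> x \<le> \<delta>"
    and b: "\<And>F. finite F \<Longrightarrow> F \<subseteq> S \<Longrightarrow> (\<Sum>x\<in>F. measure M (ball x (\<rho> x)) / \<rho> x) \<le> b"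
  shows "codim1_content (emeasure M) \<delta> E \<le> ennreal b"
proof -
  let ?f = "\<lambda>x. measure M (ball x (\<rho> x)) / \<rho> x"
  have fpos: "0 < ?f x" if "x \<in> S" for x using measure_ball_pos \<rho>(1)[OF that] by simp
  have "countable S"
  proof -
    have "?f summable_on S"
    proof (rule nonneg_bdd_above_summable_on)
      show "0 \<le> ?f x" if "x \<in> S" for x using fpos[OF that] by (rule less_imp_le)
      show "bdd_above (sum ?f ` {F. F \<subseteq> S \<and> finite F})"
        by (rule bdd_aboveI2[of _ _ b]) (use b in simp)
    qed
    then have "countable {x\<in>S. ?f x \<noteq> 0}" by (rule summable_countable_real)
    moreover have "{x\<in>S. ?f x \<noteq> 0} = S" using fpos by (intro Collect_conj_eq[THEN trans] equalityI subsetI) fastforce+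
    ultimately show ?thesis by simp
  qed
  define I where "I = to_nat_on S ` S"
  define c where "c = inv_into S (to_nat_on S)"
  have inj: "inj_on (to_nat_on S) S" using \<open>countable S\<close> by (rule inj_on_to_nat_on)
  have c: "c (to_nat_on S x) = x" if "x \<in> S" for x using inj that by (simp add: c_def)
  have "codim1_content (emeasure M) \<delta> E
      \<le> (\<Sum>\<^sub>\<infinity>i\<in>I. emeasure M (ball (c i) (\<rho> (c i))) / ennreal (\<rho> (c i)))"
    unfolding codim1_content_def
    by (rule INF_lower2[of "(I, c, \<rho> \<circ> c)"]) (use E \<rho> c in \<open>auto simp: I_def\<close>)
  also have "\<dots> \<le> ennreal b"
  proof (rule infsum_le_finite_sums[OF nonneg_summable_on_complete])
    fix F assume F: "finite F" "F \<subseteq> I"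
    have injF: "inj_on c F" unfolding c_def using F by (intro inj_on_inv_into) (simp add: I_def)
    have cF: "c i \<in> S" if "i \<in> F" for i using that F c by (auto simp: I_def)
    have "(\<Sum>i\<in>F. emeasure M (ball (c i) (\<rho> (c i))) / ennreal (\<rho> (c i))) = (\<Sum>i\<in>F. ennreal (?f (c i)))"
      using cF \<rho>(1) by (intro sum.cong refl) (simp add: ball_real divide_ennreal)
    also have "\<dots> = (\<Sum>x\<in>c ` F. ennreal (?f x))" using injF by (simp add: sum.reindex)
    also have "\<dots> = ennreal (\<Sum>x\<in>c ` F. ?f x)"
      using cF fpos by (intro sum_ennreal) (auto intro: less_imp_le)
    also have "\<dots> \<le> ennreal b" using F cF by (intro ennreal_leI b) auto
    finally show "(\<Sum>i\<in>F. emeasure M (ball (c i) (\<rho> (c i))) / ennreal (\<rho> (c i))) \<le> ennreal b" .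
  qed simp
  finally show ?thesis .
qed

end

section \<open>The relative isoperimetric inequality and the boxing inequality\<close>

locale poincare_space = doubling_space M CD for M :: "'a::complete_space measure" and CD +
  fixes CP \<tau> :: real
  assumes CP: "0 < CP" and \<tau>: "1 \<le> \<tau>"
    and poincare: "0 < r \<Longrightarrow> L1_loc_on M UNIV u \<Longrightarrow> weak_upper_gradient M UNIV u g \<Longrightarrow>
      (\<integral>\<^sup>+y\<in>ball x r. e2ennreal \<bar>u y - ereal (mean_value M (ball x r) u)\<bar> \<partial>M) / emeasure M (ball x r)
        \<le> ennreal (CP * r) * ((\<integral>\<^sup>+y\<in>ball x (\<tau> * r). g y \<partial>M) / emeasure M (ball x (\<tau> * r)))"
begin

text \<open>For the mean \<open>m\<close> of \<open>v\<close>, at least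
  \<open>\<bar>1 - m\<bar> + \<bar>m\<bar> \<ge> 1\<close> holds; so the smaller of the two measures
  is at most the integral of \<open>\<bar>indicator A y - m\<bar>\<close> over the ball. Replacing
  the indicator by \<open>v\<close> costs the second term, and the Poincare inequality bounds the
  rest, where the averages disappear because the ball is contained in its dilate.\<close>

lemma poincare_set:
  assumes v: "continuous_on UNIV v" "\<And>x. 0 \<le> v x" "\<And>x. v x \<le> 1" and g: "upper_gradient UNIV (\<lambda>x. ereal (v x)) g"
    and r: "0 < r" and A [measurable]: "A \<in> sets M"
  shows "min (emeasure M (A \<inter> ball x r)) (emeasure M (ball x r - A))
    \<le> ennreal (CP * r) * (\<integral>\<^sup>+y\<in>ball x (\<tau> * r). g y \<partial>M) + (\<integral>\<^sup>+y\<in>ball x r. ennreal \<bar>v y - indicator A y\<bar> \<partial>M)"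
proof -
  let ?B = "ball x r" and ?T = "ball x (\<tau> * r)"
  have [measurable]: "v \<in> borel_measurable M" using v(1) by (rule continuous_M)
  define m where "m = mean_value M ?B (\<lambda>x. ereal (v x))"
  have "L1_loc_on M UNIV (\<lambda>x. ereal (v x))"
    unfolding L1_loc_on_def L1_on_def
  proof (intro ballI exI[of _ 1] conjI)
    fix z
    show "(\<lambda>x. ereal (v x)) \<in> borel_measurable (restrict_space M (ball z 1))"
      by (intro measurable_restrict_space1) measurable
    have "(\<integral>\<^sup>+x\<in>ball z 1. e2ennreal \<bar>ereal (v x)\<bar> \<partial>M) \<le> (\<integral>\<^sup>+x. indicator (ball z 1) x \<partial>M)"
      using v(2,3) by (intro nn_integral_mono) (auto simp: indicator_def)
    also have "\<dots> < \<infinity>" using ball_finite[of z 1] by simp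
    finally show "(\<integral>\<^sup>+x\<in>ball z 1. e2ennreal \<bar>ereal (v x)\<bar> \<partial>M) < \<infinity>" .
  qed auto
  then have P: "(\<integral>\<^sup>+y\<in>?B. ennreal \<bar>v y - m\<bar> \<partial>M) / emeasure M ?B
      \<le> ennreal (CP * r) * ((\<integral>\<^sup>+y\<in>?T. g y \<partial>M) / emeasure M ?T)"
    using poincare[OF r _ upper_gradient_imp_weak[OF g borel_M], of x] unfolding m_def e2ennreal_abs_diff by blast
  have Bp: "emeasure M ?B \<noteq> 0" "emeasure M ?B \<noteq> \<infinity>" "emeasure M ?T \<noteq> 0" "emeasure M ?T \<noteq> \<infinity>"
    using ball_pos[of r x] ball_finite[of x r] ball_pos[of "\<tau> * r" x] ball_finite[of x "\<tau> * r"] r \<tau> by auto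
  have "(\<integral>\<^sup>+y\<in>?B. ennreal \<bar>v y - m\<bar> \<partial>M) = (\<integral>\<^sup>+y\<in>?B. ennreal \<bar>v y - m\<bar> \<partial>M) / emeasure M ?B * emeasure M ?B"
    using Bp by (simp add: ennreal_divide_times ennreal_divide_self less_top)
  also have "\<dots> \<le> ennreal (CP * r) * ((\<integral>\<^sup>+y\<in>?T. g y \<partial>M) / emeasure M ?T) * emeasure M ?B"
    using P by (intro mult_right_mono) auto
  also have "\<dots> \<le> ennreal (CP * r) * ((\<integral>\<^sup>+y\<in>?T. g y \<partial>M) / emeasure M ?T) * emeasure M ?T"
    using r \<tau> by (intro mult_left_mono emeasure_mono subset_ball) auto
  also have "\<dots> = ennreal (CP * r) * ((\<integral>\<^sup>+y\<in>?T. g y \<partial>M) / emeasure M ?T * emeasure M ?T)"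
    by (simp only: mult.assoc)
  also have "(\<integral>\<^sup>+y\<in>?T. g y \<partial>M) / emeasure M ?T * emeasure M ?T = (\<integral>\<^sup>+y\<in>?T. g y \<partial>M)"
    using Bp by (simp add: ennreal_divide_times ennreal_divide_self less_top)
  finally have P': "(\<integral>\<^sup>+y\<in>?B. ennreal \<bar>v y - m\<bar> \<partial>M) \<le> ennreal (CP * r) * (\<integral>\<^sup>+y\<in>?T. g y \<partial>M)" .
  let ?min = "min (emeasure M (A \<inter> ?B)) (emeasure M (?B - A))"
  have "1 \<le> ennreal \<bar>1 - m\<bar> + ennreal \<bar>m\<bar>" by (simp flip: ennreal_plus)
  then have "?min * 1 \<le> ?min * (ennreal \<bar>1 - m\<bar> + ennreal \<bar>m\<bar>)" by (rule mult_left_mono) simp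
  then have "?min \<le> ?min * ennreal \<bar>1 - m\<bar> + ?min * ennreal \<bar>m\<bar>" by (simp only: distrib_left mult_1_right)
  also have "\<dots> \<le> ennreal \<bar>1 - m\<bar> * emeasure M (A \<inter> ?B) + ennreal \<bar>m\<bar> * emeasure M (?B - A)"
    unfolding mult.commute[of "min _ _"] by (intro add_mono mult_left_mono) auto
  also have "\<dots> = (\<integral>\<^sup>+y. ennreal \<bar>1 - m\<bar> * indicator (A \<inter> ?B) y + ennreal \<bar>m\<bar> * indicator (?B - A) y \<partial>M)"
    by (subst nn_integral_add) (simp_all add: nn_integral_cmult_indicator)
  also have "\<dots> = (\<integral>\<^sup>+y\<in>?B. ennreal \<bar>indicator A y - m\<bar> \<partial>M)"
    by (intro nn_integral_cong) (auto simp: indicator_def)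
  also have "\<dots> \<le> (\<integral>\<^sup>+y. ennreal \<bar>v y - m\<bar> * indicator ?B y + ennreal \<bar>v y - indicator A y\<bar> * indicator ?B y \<partial>M)"
  proof (rule nn_integral_mono)
    fix y
    have "ennreal \<bar>indicator A y - m\<bar> \<le> ennreal \<bar>v y - m\<bar> + ennreal \<bar>v y - indicator A y\<bar>"
      by (simp flip: ennreal_plus add: ennreal_leI)
    then show "ennreal \<bar>indicator A y - m\<bar> * indicator ?B y
        \<le> ennreal \<bar>v y - m\<bar> * indicator ?B y + ennreal \<bar>v y - indicator A y\<bar> * indicator ?B y"
      by (simp add: indicator_def)
  qed
  also have "\<dots> = (\<integral>\<^sup>+y\<in>?B. ennreal \<bar>v y - m\<bar> \<partial>M) + (\<integral>\<^sup>+y\<in>?B. ennreal \<bar>v y - indicator A y\<bar> \<partial>M)"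
    by (rule nn_integral_add) measurable
  also have "\<dots> \<le> ennreal (CP * r) * (\<integral>\<^sup>+y\<in>?T. g y \<partial>M) + (\<integral>\<^sup>+y\<in>?B. ennreal \<bar>v y - indicator A y\<bar> \<partial>M)"
    by (intro add_right_mono P')
  finally show ?thesis .
qed

text \<open>The dilated balls are disjoint, so the gradient integrals over them add up to at most
  the whole energy. The L1 errors of \<open>poincare_set\<close> vanish in the limit, as
  \<open>F\<close> is finite. For a single ball this is the relative isoperimetric
  inequality.\<close>

lemma isoperimetric_sum:
  assumes app: "approx_per M UNIV A (ennreal \<epsilon>)" and \<epsilon>: "0 \<le> \<epsilon>" and A: "A \<in> sets M"
    and F: "finite F" "disjoint_family_on (\<lambda>x. ball x (\<tau> * \<rho> x)) F" "\<And>x. x \<in> F \<Longrightarrow> 0 < \<rho> x"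
    and b: "\<And>x. x \<in> F \<Longrightarrow> 0 \<le> b x"
      "\<And>x. x \<in> F \<Longrightarrow> ennreal (b x) \<le> min (emeasure M (A \<inter> ball x (\<rho> x))) (emeasure M (ball x (\<rho> x) - A))"
  shows "(\<Sum>x\<in>F. b x / \<rho> x) \<le> CP * \<epsilon>"
proof -
  obtain v g where vg: "\<And>i::nat. continuous_on UNIV (v i)" "\<And>i x. 0 \<le> v i x" "\<And>i x. v i x \<le> 1"
    "\<And>i. upper_gradient UNIV (\<lambda>x. ereal (v i x)) (g i)"
    "\<And>i. (\<integral>\<^sup>+x. g i x \<partial>M) \<le> ennreal \<epsilon>" and conv: "L1_loc_tendsto M UNIV v (\<lambda>x. ereal (indicator A x))"
    using app unfolding approx_per_def by auto
  have [measurable]: "g i \<in> borel_measurable M" for i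
    using upper_gradient_measurable[OF vg(4)[of i]] borel_measurable_M
    by (metis space_borel measurable_cong_sets restrict_space_sets_cong sets_restrict_UNIV)
  define D where "D i x = (\<integral>\<^sup>+y\<in>ball x (\<rho> x). ennreal \<bar>v i y - indicator A y\<bar> \<partial>M)" for i x
  have D: "(\<lambda>i. D i x) \<longlonglongrightarrow> 0" for x
  proof (rule tendsto_sandwich[OF _ _ tendsto_const])
    show "(\<lambda>i. \<integral>\<^sup>+y\<in>cball x (\<rho> x). ennreal \<bar>v i y - indicator A y\<bar> \<partial>M) \<longlonglongrightarrow> 0"
      by (rule L1_loc_tendsto_compact[OF conv compact_cball]) (use vg A in auto)
    show "eventually (\<lambda>i. D i x \<le> (\<integral>\<^sup>+y\<in>cball x (\<rho> x). ennreal \<bar>v i y - indicator A y\<bar> \<partial>M)) sequentially"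
      unfolding D_def by (intro always_eventually allI nn_integral_mono mult_left_mono) (auto simp: indicator_def)
  qed simp
  have "ennreal (\<Sum>x\<in>F. b x / \<rho> x) \<le> ennreal (CP * \<epsilon>) + (\<Sum>x\<in>F. ennreal (1 / \<rho> x) * D i x)" for i
  proof -
    have "ennreal (\<Sum>x\<in>F. b x / \<rho> x) = (\<Sum>x\<in>F. ennreal (1 / \<rho> x) * ennreal (b x))"
    proof -
      have "ennreal (\<Sum>x\<in>F. b x / \<rho> x) = (\<Sum>x\<in>F. ennreal (b x / \<rho> x))"
        using b(1) F(3) by (intro sum_ennreal[symmetric]) (simp add: less_imp_le)
      also have "\<dots> = (\<Sum>x\<in>F. ennreal (1 / \<rho> x) * ennreal (b x))"
        using b(1) F(3) by (intro sum.cong refl) (simp flip: ennreal_mult add: less_imp_le)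
      finally show ?thesis .
    qed
    also have "\<dots> \<le> (\<Sum>x\<in>F. ennreal (1 / \<rho> x) *
        (ennreal (CP * \<rho> x) * (\<integral>\<^sup>+y\<in>ball x (\<tau> * \<rho> x). g i y \<partial>M) + D i x))"
      unfolding D_def using F(3)
      by (intro sum_mono mult_left_mono order_trans[OF b(2)] poincare_set vg A) auto
    also have "\<dots> = (\<Sum>x\<in>F. ennreal CP * (\<integral>\<^sup>+y\<in>ball x (\<tau> * \<rho> x). g i y \<partial>M) + ennreal (1 / \<rho> x) * D i x)"
    proof (rule sum.cong[OF refl])
      fix x assume "x \<in> F"
      then have "ennreal (1 / \<rho> x) * ennreal (CP * \<rho> x) = ennreal CP"
        using F(3)[of x] CP by (subst ennreal_mult[symmetric]) (auto intro: less_imp_le)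
      then show "ennreal (1 / \<rho> x) * (ennreal (CP * \<rho> x) * (\<integral>\<^sup>+y\<in>ball x (\<tau> * \<rho> x). g i y \<partial>M) + D i x)
          = ennreal CP * (\<integral>\<^sup>+y\<in>ball x (\<tau> * \<rho> x). g i y \<partial>M) + ennreal (1 / \<rho> x) * D i x"
        by (simp only: distrib_left mult.assoc[symmetric])
    qed
    also have "\<dots> = ennreal CP * (\<Sum>x\<in>F. \<integral>\<^sup>+y\<in>ball x (\<tau> * \<rho> x). g i y \<partial>M) + (\<Sum>x\<in>F. ennreal (1 / \<rho> x) * D i x)"
      by (simp only: sum.distrib sum_distrib_left)
    also have "(\<Sum>x\<in>F. \<integral>\<^sup>+y\<in>ball x (\<tau> * \<rho> x). g i y \<partial>M) = (\<integral>\<^sup>+y. (\<Sum>x\<in>F. g i y * indicator (ball x (\<tau> * \<rho> x)) y) \<partial>M)"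
      by (rule nn_integral_sum[symmetric]) measurable
    also have "\<dots> \<le> (\<integral>\<^sup>+y. g i y \<partial>M)"
    proof (rule nn_integral_mono)
      fix y
      have "(\<Sum>x\<in>F. indicator (ball x (\<tau> * \<rho> x)) y) \<le> (1::ennreal)"
      proof -
        have "(\<Sum>x\<in>F. indicator (ball x (\<tau> * \<rho> x)) y) = (indicator (\<Union>x\<in>F. ball x (\<tau> * \<rho> x)) y :: ennreal)"
          using F(1,2) by (rule indicator_UN_disjoint[symmetric])
        then show ?thesis by (simp add: indicator_def)
      qed
      then have "g i y * (\<Sum>x\<in>F. indicator (ball x (\<tau> * \<rho> x)) y) \<le> g i y * 1" by (rule mult_left_mono) simp
      then show "(\<Sum>x\<in>F. g i y * indicator (ball x (\<tau> * \<rho> x)) y) \<le> g i y" by (simp add: sum_distrib_left)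
    qed
    also have "\<dots> \<le> ennreal \<epsilon>" by (rule vg(5))
    finally show ?thesis using CP \<epsilon> by (simp add: ennreal_mult add_right_mono mult_left_mono)
  qed
  moreover have "(\<lambda>i. ennreal (CP * \<epsilon>) + (\<Sum>x\<in>F. ennreal (1 / \<rho> x) * D i x)) \<longlonglongrightarrow> ennreal (CP * \<epsilon>) + (\<Sum>x\<in>F. ennreal (1 / \<rho> x) * 0)"
    by (intro tendsto_add tendsto_const tendsto_sum ennreal_tendsto_cmult D) auto
  ultimately have "ennreal (\<Sum>x\<in>F. b x / \<rho> x) \<le> ennreal (CP * \<epsilon>) + (\<Sum>x\<in>F. ennreal (1 / \<rho> x) * 0)"
    by (intro LIMSEQ_le_const) auto
  then show ?thesis using CP \<epsilon> by (simp add: ennreal_le_iff)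
qed

text \<open>At every point the radius is the last one in a dyadic sequence at which \<open>A\<close> fills at most half of
  the ball, so that there both \<open>A\<close> and its complement occupy a fixed proportion of the ball.\<close>

lemma boxing:
  obtains C where "0 < C"
    "\<And>A U E \<epsilon> r \<delta>. approx_per M UNIV A (ennreal \<epsilon>) \<Longrightarrow> 0 \<le> \<epsilon> \<Longrightarrow> A \<in> sets M \<Longrightarrow> open U \<Longrightarrow> E \<subseteq> U \<Longrightarrow> U \<subseteq> A \<Longrightarrow>
       0 < r \<Longrightarrow> 5 * \<tau> * r \<le> \<delta> \<Longrightarrow> (\<And>x. x \<in> E \<Longrightarrow> measure M (A \<inter> ball x r) \<le> measure M (ball x r) / 2) \<Longrightarrow>
       codim1_content (emeasure M) \<delta> E \<le> ennreal (C * \<epsilon>)"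
proof -
  obtain C1 where C1: "1 \<le> C1" "\<And>x r. 0 < r \<Longrightarrow> measure M (ball x (5 * \<tau> * r)) \<le> C1 * measure M (ball x r)"
    using measure_ball_dilate by blast
  have CD: "1 \<le> CD" by (rule CD_ge_1)
  \<comment> \<open>In the constant below, \<open>C1\<close> pays for enlarging the balls by
    \<open>5 * \<tau>\<close>, \<open>2 * CD\<close> for the density of \<open>A\<close> and of its
    complement in them, and \<open>CP\<close> for \<open>isoperimetric_sum\<close>.\<close>
  show ?thesis
  proof (rule that[of "C1 * (2 * CD) * CP"])
    show "0 < C1 * (2 * CD) * CP" using C1 CD CP by simp
    fix A U E \<epsilon> r \<delta>
    assume app: "approx_per M UNIV A (ennreal \<epsilon>)" and \<epsilon>: "0 \<le> \<epsilon>" and A: "A \<in> sets M"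
      and U: "open U" "E \<subseteq> U" "U \<subseteq> A" and r: "0 < r" and \<delta>: "5 * \<tau> * r \<le> \<delta>"
      and half: "\<And>x. x \<in> E \<Longrightarrow> measure M (A \<inter> ball x r) \<le> measure M (ball x r) / 2"
    have fm: "S \<inter> ball x s \<in> fmeasurable M" "ball x s - S \<in> fmeasurable M" if "S \<in> sets M" for S x s
      using that ball_finite[of x s] emeasure_mono[of "S \<inter> ball x s" "ball x s" M]
        emeasure_mono[of "ball x s - S" "ball x s" M] by (auto intro!: fmeasurableI intro: le_less_trans)
    have "\<exists>s. 0 < s \<and> s \<le> r \<and> measure M (ball x s) / (2 * CD) \<le> measure M (A \<inter> ball x s) \<and>
        measure M (ball x s) / (2 * CD) \<le> measure M (ball x s - A)" if x: "x \<in> E" for x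
    proof -
      define s where "s j = r * (1/2) ^ j" for j :: nat
      have s: "0 < s j" "s j \<le> r" "s j = 2 * s (Suc j)" for j
        using r by (auto simp: s_def power_le_one)
      define P where "P j \<longleftrightarrow> measure M (ball x (s j)) / 2 < measure M (A \<inter> ball x (s j))" for j
      have P0: "\<not> P 0" using half[OF x] by (simp add: P_def s_def)
      \<comment> \<open>Small balls around \<open>x\<close> lie in \<open>U\<close>, hence are
        filled by \<open>A\<close>; this is where a neighbourhood of \<open>E\<close> is
        required.\<close>
      have "\<exists>j. P j"
      proof -
        obtain d where d: "0 < d" "ball x d \<subseteq> U" using U x by (meson open_contains_ball subsetD)
        obtain j :: nat where "(1/2) ^ j < d / r" using real_arch_pow_inv[of "d / r" "1/2"] d r by auto
        then have "s j \<le> d" using r by (simp add: s_def field_simps)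
        then have "A \<inter> ball x (s j) = ball x (s j)" using d(2) U(3) subset_ball[of "s j" d x] by blast
        then have "P j" using measure_ball_pos[OF s(1)[of j], of x] by (simp add: P_def)
        then show ?thesis ..
      qed
      then obtain k where k: "P k" "\<And>j. j < k \<Longrightarrow> \<not> P j" by (metis exists_least_iff)
      then obtain j where j: "k = Suc j" using P0 by (cases k) auto
      have Pj: "P (Suc j)" "\<not> P j" using k j by auto
      let ?B = "ball x (s j)"
      \<comment> \<open>In the concentric ball of half the radius \<open>A\<close> fills more than
        half, which by doubling is at least the fraction \<open>1 / (2 * CD)\<close> of
        \<open>?B\<close>.\<close>
      have "measure M ?B \<le> CD * measure M (ball x (s (Suc j)))"
        using measure_ball_double[OF s(1)[of "Suc j"], of x] s(3)[of j] by simp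
      then have "measure M ?B / (2 * CD) \<le> measure M (ball x (s (Suc j))) / 2"
        using CD by (simp add: divide_simps mult.commute)
      also have "\<dots> \<le> measure M (A \<inter> ball x (s (Suc j)))" using Pj by (simp add: P_def)
      also have "\<dots> \<le> measure M (A \<inter> ?B)"
        using s(3)[of j] s(1)[of "Suc j"] fm[OF A] A
        by (intro measure_mono_fmeasurable) (auto intro: less_le_trans)
      finally have 1: "measure M ?B / (2 * CD) \<le> measure M (A \<inter> ?B)" .
      have "measure M ?B = measure M (A \<inter> ?B) + measure M (?B - A)"
      proof -
        have "measure M ((A \<inter> ?B) \<union> (?B - A)) = measure M (A \<inter> ?B) + measure M (?B - A)"
          using fm[OF A, of x "s j"] by (intro measure_Un_AE) (auto simp: fmeasurable_def)
        moreover have "(A \<inter> ?B) \<union> (?B - A) = ?B" by auto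
        ultimately show ?thesis by simp
      qed
      then have "measure M ?B / 2 \<le> measure M (?B - A)" using Pj by (simp add: P_def)
      moreover have "measure M ?B / (2 * CD) \<le> measure M ?B / 2"
        using CD measure_nonneg[of M ?B] by (intro divide_left_mono) auto
      ultimately show ?thesis using 1 s(1,2)[of j] by (intro exI[of _ "s j"]) auto
    qed
    then have "\<exists>\<rho>. \<forall>x\<in>E. 0 < \<rho> x \<and> \<rho> x \<le> r \<and> measure M (ball x (\<rho> x)) / (2 * CD) \<le> measure M (A \<inter> ball x (\<rho> x)) \<and>
        measure M (ball x (\<rho> x)) / (2 * CD) \<le> measure M (ball x (\<rho> x) - A)"
      by (intro bchoice) blast
    then obtain \<rho> where \<rho>: "\<And>x. x \<in> E \<Longrightarrow> 0 < \<rho> x" "\<And>x. x \<in> E \<Longrightarrow> \<rho> x \<le> r"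
      "\<And>x. x \<in> E \<Longrightarrow> measure M (ball x (\<rho> x)) / (2 * CD) \<le> measure M (A \<inter> ball x (\<rho> x))"
      "\<And>x. x \<in> E \<Longrightarrow> measure M (ball x (\<rho> x)) / (2 * CD) \<le> measure M (ball x (\<rho> x) - A)" by blast
    \<comment> \<open>The dilates by \<tau> are made disjoint, because the Poincare inequality
      integrates the gradient over them.\<close>
    obtain S where S: "S \<subseteq> E" "disjoint_family_on (\<lambda>x. ball x (\<tau> * \<rho> x)) S" "E \<subseteq> (\<Union>x\<in>S. ball x (5 * (\<tau> * \<rho> x)))"
      by (rule vitali_balls[of E "\<lambda>x. \<tau> * \<rho> x" "\<tau> * r"]) (use \<rho>(1,2) \<tau> in auto)
    show "codim1_content (emeasure M) \<delta> E \<le> ennreal (C1 * (2 * CD) * CP * \<epsilon>)"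
    proof (rule codim1_content_le)
      show "E \<subseteq> (\<Union>x\<in>S. ball x (5 * \<tau> * \<rho> x))" using S(3) by (simp only: mult.assoc)
      show "0 < 5 * \<tau> * \<rho> x" if "x \<in> S" for x using \<rho>(1)[of x] S(1) that \<tau> by auto
      show "5 * \<tau> * \<rho> x \<le> \<delta>" if "x \<in> S" for x
      proof -
        have "5 * \<tau> * \<rho> x \<le> 5 * \<tau> * r" using \<rho>(2)[of x] S(1) that \<tau> by (intro mult_left_mono) auto
        then show ?thesis using \<delta> by linarith
      qed
      fix F assume F: "finite F" "F \<subseteq> S"
      have pos: "0 < \<rho> x" if "x \<in> F" for x using that F S \<rho>(1) by blast
      have "(\<Sum>x\<in>F. measure M (ball x (5 * \<tau> * \<rho> x)) / (5 * \<tau> * \<rho> x))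
          \<le> (\<Sum>x\<in>F. C1 * (2 * CD) * (measure M (ball x (\<rho> x)) / (2 * CD) / \<rho> x))"
      proof (rule sum_mono)
        fix x assume x: "x \<in> F"
        have "measure M (ball x (5 * \<tau> * \<rho> x)) / (5 * \<tau> * \<rho> x) \<le> C1 * measure M (ball x (\<rho> x)) / (5 * \<tau> * \<rho> x)"
          using C1(2)[OF pos[OF x]] pos[OF x] \<tau> by (intro divide_right_mono) auto
        also have "\<dots> \<le> C1 * measure M (ball x (\<rho> x)) / \<rho> x"
          using pos[OF x] \<tau> C1(1) by (intro divide_left_mono) (auto simp: mult_le_cancel_right1)
        also have "\<dots> = C1 * (2 * CD) * (measure M (ball x (\<rho> x)) / (2 * CD) / \<rho> x)" using CD by simp
        finally show "measure M (ball x (5 * \<tau> * \<rho> x)) / (5 * \<tau> * \<rho> x)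
            \<le> C1 * (2 * CD) * (measure M (ball x (\<rho> x)) / (2 * CD) / \<rho> x)" .
      qed
      also have "\<dots> = C1 * (2 * CD) * (\<Sum>x\<in>F. measure M (ball x (\<rho> x)) / (2 * CD) / \<rho> x)"
        by (simp only: sum_distrib_left)
      also have "\<dots> \<le> C1 * (2 * CD) * (CP * \<epsilon>)"
      proof (intro mult_left_mono isoperimetric_sum[OF app \<epsilon> A F(1)])
        show "disjoint_family_on (\<lambda>x. ball x (\<tau> * \<rho> x)) F" by (rule disjoint_family_on_mono[OF F(2) S(2)])
        fix x assume x: "x \<in> F"
        then have xE: "x \<in> E" using F S by blast
        show "ennreal (measure M (ball x (\<rho> x)) / (2 * CD))
            \<le> min (emeasure M (A \<inter> ball x (\<rho> x))) (emeasure M (ball x (\<rho> x) - A))"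
          using \<rho>(3,4)[OF xE] fm[OF A, of x "\<rho> x"]
          by (simp add: emeasure_eq_measure2 ennreal_leI)
      qed (use pos CD C1 in auto)
      also have "\<dots> = C1 * (2 * CD) * CP * \<epsilon>" by simp
      finally show "(\<Sum>x\<in>F. measure M (ball x (5 * \<tau> * \<rho> x)) / (5 * \<tau> * \<rho> x)) \<le> C1 * (2 * CD) * CP * \<epsilon>" .
    qed
  qed
qed

end

section \<open>Discrete chains\<close>

text \<open>A left Riemann sum of a line integral: every step is weighted by \<open>h\<close> at its
  starting point.\<close>

fun chain_cost :: "('a::metric_space \<Rightarrow> real) \<Rightarrow> 'a list \<Rightarrow> real" where
  "chain_cost h (x # y # zs) = h x * dist x y + chain_cost h (y # zs)"
| "chain_cost h xs = 0"

fun small_steps :: "real \<Rightarrow> 'a::metric_space list \<Rightarrow> bool" where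
  "small_steps d (x # y # zs) \<longleftrightarrow> dist x y \<le> d \<and> small_steps d (y # zs)"
| "small_steps d xs \<longleftrightarrow> True"

abbreviation chain_length :: "'a::metric_space list \<Rightarrow> real" where
  "chain_length \<equiv> chain_cost (\<lambda>_. 1)"

text \<open>The step function that visits the points of a chain at unit speed.\<close>

fun walk :: "'a::metric_space list \<Rightarrow> real \<Rightarrow> 'a" where
  "walk (x # y # zs) s = (if s < dist x y then x else walk (y # zs) (s - dist x y))"
| "walk [x] s = x"
| "walk [] s = undefined"

lemma chain_cost_nonneg: "(\<And>x. 0 \<le> h x) \<Longrightarrow> 0 \<le> chain_cost h xs"
  by (induction h xs rule: chain_cost.induct) auto

lemma chain_cost_mono: "(\<And>x. h x \<le> h' x) \<Longrightarrow> chain_cost h xs \<le> chain_cost h' xs"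
  by (induction h xs rule: chain_cost.induct) (auto intro!: add_mono mult_right_mono)

lemma chain_cost_ge_length: "(\<And>x. c \<le> h x) \<Longrightarrow> c * chain_length xs \<le> chain_cost h xs"
  by (induction h xs rule: chain_cost.induct) (auto simp: distrib_left intro!: add_mono mult_right_mono)

lemma small_steps_mono: "d \<le> d' \<Longrightarrow> small_steps d xs \<Longrightarrow> small_steps d' xs"
  by (induction d xs rule: small_steps.induct) auto

lemma dist_hd_walk: "xs \<noteq> [] \<Longrightarrow> 0 \<le> s \<Longrightarrow> dist (hd xs) (walk xs s) \<le> s"
proof (induction xs s rule: walk.induct)
  case (1 x y zs s)
  show ?case
  proof (cases "s < dist x y")
    case False
    then have "dist y (walk (y # zs) (s - dist x y)) \<le> s - dist x y" using 1 by simp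
    then show ?thesis using False dist_triangle[of x "walk (y # zs) (s - dist x y)" y] by simp
  qed (use 1 in simp)
qed auto

text \<open>The walk waits at each point for as long as the next step is long, and then jumps. At
  time \<open>s\<close> it has waited at most \<open>d\<close>, and measured from the beginning of
  that wait it moves at most at unit speed.\<close>

lemma dist_walk:
  "xs \<noteq> [] \<Longrightarrow> small_steps d xs \<Longrightarrow> 0 \<le> d \<Longrightarrow> 0 \<le> s \<Longrightarrow> s \<le> t \<Longrightarrow> dist (walk xs s) (walk xs t) \<le> (t - s) + d"
proof (induction xs s arbitrary: t rule: walk.induct)
  case (1 x y zs s)
  show ?case
  proof (cases "s < dist x y")
    case True
    have "dist x (walk (x # y # zs) t) \<le> t" using dist_hd_walk[of "x # y # zs" t] 1 by simp
    then show ?thesis using True 1 by auto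
  next
    case False
    then have "dist (walk (y # zs) (s - dist x y)) (walk (y # zs) (t - dist x y)) \<le> (t - dist x y - (s - dist x y)) + d"
      using 1 by (intro 1(1)) auto
    then show ?thesis using False 1 by auto
  qed
qed auto

lemma walk_beyond: "xs \<noteq> [] \<Longrightarrow> chain_length xs \<le> s \<Longrightarrow> walk xs s = last xs"
proof (induction xs s rule: walk.induct)
  case (1 x y zs s)
  have "0 \<le> chain_length (y # zs)" by (intro chain_cost_nonneg) simp
  then show ?case using 1 by auto
qed auto

lemma walk_measurable:
  fixes h :: "'a::metric_space \<Rightarrow> real"
  shows "(\<lambda>s. h (walk xs s)) \<in> borel_measurable borel"
proof (induction xs)
  case (Cons x ys)
  show ?case
  proof (cases ys)
    case (Cons y zs)
    have "(\<lambda>s. h (walk ys (s - dist x y))) \<in> borel_measurable borel"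
      by (rule measurable_compose[OF _ Cons.IH]) simp
    then show ?thesis unfolding Cons by (simp add: if_distrib[of h] cong: if_cong)
  qed simp
qed simp

text \<open>Each point of the chain is occupied for as long as the next step is long, so the cost is
  an integral of \<open>h\<close> along the walk. This turns costs into integrals to which Fatou's
  lemma applies.\<close>

lemma walk_integral:
  assumes h: "\<And>x. 0 \<le> h x"
  shows "xs \<noteq> [] \<Longrightarrow> (\<integral>\<^sup>+ s. ennreal (h (walk xs s)) * indicator {0..<chain_length xs} s \<partial>lborel) \<le> ennreal (chain_cost h xs)"
proof (induction xs)
  case (Cons x ys)
  show ?case
  proof (cases ys)
    case ys: (Cons y zs)
    let ?d = "dist x y"
    let ?f = "\<lambda>s. ennreal (h (walk ys s)) * indicator {0..<chain_length ys} s"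
    have fm: "?f \<in> borel_measurable borel"
      by (intro borel_measurable_times_ennreal measurable_compose[OF walk_measurable measurable_ennreal]) simp
    have ly: "0 \<le> chain_length ys" by (intro chain_cost_nonneg) simp
    have "(\<integral>\<^sup>+ s. ennreal (h (walk (x # ys) s)) * indicator {0..<chain_length (x # ys)} s \<partial>lborel)
        = (\<integral>\<^sup>+ s. ennreal (h x) * indicator {0..<?d} s + ?f (- ?d + 1 * s) \<partial>lborel)"
      proof (rule nn_integral_cong)
      fix s
      consider "s < 0" | "0 \<le> s" "s < ?d" | "?d \<le> s" by linarith
      then show "ennreal (h (walk (x # ys) s)) * indicator {0..<chain_length (x # ys)} s
          = ennreal (h x) * indicator {0..<?d} s + ?f (- ?d + 1 * s)"
      proof cases
        case 1
        then have "\<not> ?d \<le> s" using zero_le_dist[of x y] by linarith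
        then show ?thesis using 1 by (auto simp: indicator_def)
      next
        case 2
        then show ?thesis using ly unfolding ys by (auto simp: indicator_def)
      next
        case 3
        then have "0 \<le> s" using zero_le_dist[of x y] by linarith
        then show ?thesis using 3 unfolding ys by (auto simp: indicator_def)
      qed
    qed
    also have "\<dots> = ennreal (h x) * ennreal ?d + (\<integral>\<^sup>+ s. ?f (- ?d + 1 * s) \<partial>lborel)"
    proof -
      have "(\<lambda>s. ?f (- ?d + 1 * s)) \<in> borel_measurable lborel"
        using measurable_compose[OF _ fm, of "\<lambda>s. - ?d + 1 * s" lborel] by simp
      then have "(\<integral>\<^sup>+ s. ennreal (h x) * indicator {0..<?d} s + ?f (- ?d + 1 * s) \<partial>lborel)
          = (\<integral>\<^sup>+ s. ennreal (h x) * indicator {0..<?d} s \<partial>lborel) + (\<integral>\<^sup>+ s. ?f (- ?d + 1 * s) \<partial>lborel)"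
        by (intro nn_integral_add) simp_all
      then show ?thesis by (simp add: nn_integral_cmult_indicator)
    qed
    also have "(\<integral>\<^sup>+ s. ?f (- ?d + 1 * s) \<partial>lborel) = (\<integral>\<^sup>+ s. ?f s \<partial>lborel)"
      using nn_integral_real_affine[OF fm, of 1 "- ?d"] by simp
    also have "ennreal (h x) * ennreal ?d + (\<integral>\<^sup>+ s. ?f s \<partial>lborel) \<le> ennreal (h x) * ennreal ?d + ennreal (chain_cost h ys)"
      using Cons.IH ys by (intro add_left_mono) simp
    also have "\<dots> = ennreal (chain_cost h (x # ys))"
      using ennreal_plus[of "h x * ?d" "chain_cost h ys"] ennreal_mult[of "h x" ?d] h[of x]
        chain_cost_nonneg[of h ys, OF h] ys by simp
    finally show ?thesis .
  qed simp
qed simp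

section \<open>Compactness of asymptotically 1-Lipschitz maps\<close>

lemma compact_rat_functions:
  assumes "compact (K :: 'a::metric_space set)"
  shows "compact {f :: rat \<Rightarrow> 'a. \<forall>q. f q \<in> K}"
proof -
  have "compactin (product_topology (\<lambda>i::rat. euclidean) UNIV) (PiE UNIV (\<lambda>_. K))"
    using assms by (simp add: compactin_PiE compactin_euclidean_iff)
  moreover have "PiE UNIV (\<lambda>_. K) = {f :: rat \<Rightarrow> 'a. \<forall>q. f q \<in> K}" by (auto simp: PiE_def)
  ultimately show ?thesis by (simp add: euclidean_product_topology compactin_euclidean_iff)
qed

text \<open>An Arzela--Ascoli argument for maps that are asymptotically 1-Lipschitz.\<close>

lemma asymptotically_lipschitz_subseq:
  fixes w :: "nat \<Rightarrow> real \<Rightarrow> 'a::complete_space" and len d :: "nat \<Rightarrow> real"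
  assumes K: "compact K" "\<And>k s. s \<in> {0..L} \<Longrightarrow> w k s \<in> K" and len: "\<And>k. len k \<in> {0..L}"
    and w: "\<And>k s t. 0 \<le> s \<Longrightarrow> s \<le> t \<Longrightarrow> t \<le> L \<Longrightarrow> dist (w k s) (w k t) \<le> (t - s) + d k" and d: "d \<longlonglongrightarrow> 0"
  obtains r :: "nat \<Rightarrow> nat" and \<gamma> l where "strict_mono r" "(\<lambda>j. len (r j)) \<longlonglongrightarrow> l" "l \<in> {0..L}"
    "1-lipschitz_on {0..L} \<gamma>" "\<And>s. s \<in> {0..L} \<Longrightarrow> (\<lambda>j. w (r j) s) \<longlonglongrightarrow> \<gamma> s"
proof -
  have L: "0 \<le> L" using len[of 0] by auto
  \<comment> \<open>Rational parameters, clamped to \<open>{0..L}\<close>. Countably many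
    coordinates keep the product metrizable, so compactness yields a subsequence; pairing with
    \<open>len\<close> in \<open>X\<close> lets the same subsequence serve the lengths.\<close>
  define c where "c q = max 0 (min L (of_rat q))" for q
  have c: "c q \<in> {0..L}" for q using L by (auto simp: c_def)
  define X where "X k = ((\<lambda>q. w k (c q)), len k)" for k
  have "compact ({f :: rat \<Rightarrow> 'a. \<forall>q. f q \<in> K} \<times> {0..L})"
    by (intro compact_Times compact_rat_functions K(1)) simp
  moreover have "X k \<in> {f. \<forall>q. f q \<in> K} \<times> {0..L}" for k using K(2) c len by (auto simp: X_def)
  ultimately obtain Z r where Z: "Z \<in> {f :: rat \<Rightarrow> 'a. \<forall>q. f q \<in> K} \<times> {0..L}" and r: "strict_mono r" and lim: "(X \<circ> r) \<longlonglongrightarrow> Z"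
    unfolding compact_def by blast
  have lim1: "(\<lambda>j. fst (X (r j))) \<longlonglongrightarrow> fst Z" and lim2: "(\<lambda>j. len (r j)) \<longlonglongrightarrow> snd Z"
    using tendsto_fst[OF lim] tendsto_snd[OF lim] by (auto simp: X_def comp_def)
  have conv_rat: "(\<lambda>j. w (r j) (c q)) \<longlonglongrightarrow> fst Z q" for q
  proof -
    have "isCont (\<lambda>f::rat \<Rightarrow> 'a. f q) (fst Z)"
      by (rule continuous_on_eq_continuous_at[OF open_UNIV, THEN iffD1, rule_format,
          OF continuous_on_product_coordinates UNIV_I])
    from isCont_tendsto_compose[OF this lim1] show ?thesis by (simp add: X_def)
  qed
  have dr: "(\<lambda>j. d (r j)) \<longlonglongrightarrow> 0" using LIMSEQ_subseq_LIMSEQ[OF d r] by (simp add: comp_def)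
  have w': "dist (w k s) (w k t) \<le> \<bar>t - s\<bar> + d k" if "s \<in> {0..L}" "t \<in> {0..L}" for k s t
    using w[of s t k] w[of t s k] that by (cases "s \<le> t") (auto simp: dist_commute)
  have "convergent (\<lambda>j. w (r j) s)" if s: "s \<in> {0..L}" for s
  proof (rule Cauchy_convergent, rule metric_CauchyI)
    fix e :: real assume e: "0 < e"
    \<comment> \<open>Of the five parts of \<open>e\<close>, two are spent on each passage between
      \<open>s\<close> and a rational parameter and one on the Cauchy condition there.\<close>
    obtain q where q: "\<bar>c q - s\<bar> < e / 5"
    proof -
      obtain q where q: "s < of_rat q" "of_rat q < s + e / 5" using of_rat_dense[of s "s + e/5"] e by auto
      have "\<bar>max 0 (min L t) - s\<bar> < e / 5" if "s < t" "t < s + e / 5" for t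
        using that s by (auto simp: max_def min_def)
      from this[OF q] have "\<bar>c q - s\<bar> < e / 5" by (simp only: c_def)
      then show ?thesis by (rule that)
    qed
    have "Cauchy (\<lambda>j. w (r j) (c q))" using conv_rat by (rule LIMSEQ_imp_Cauchy)
    then obtain N1 where N1: "\<And>m n. N1 \<le> m \<Longrightarrow> N1 \<le> n \<Longrightarrow> dist (w (r m) (c q)) (w (r n) (c q)) < e / 5"
      using e by (meson metric_CauchyD divide_pos_pos zero_less_numeral)
    obtain N2 where N2: "\<And>j. N2 \<le> j \<Longrightarrow> d (r j) < e / 5"
      using order_tendstoD(2)[OF dr, of "e/5"] e by (auto simp: eventually_sequentially)
    show "\<exists>N. \<forall>m\<ge>N. \<forall>n\<ge>N. dist (w (r m) s) (w (r n) s) < e"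
    proof (intro exI[of _ "max N1 N2"] allI impI)
      fix m n assume mn: "max N1 N2 \<le> m" "max N1 N2 \<le> n"
      have a: "dist (w (r j) s) (w (r j) (c q)) < 2 * e / 5" if "max N1 N2 \<le> j" for j
        using w'[OF s c[of q], of "r j"] q N2[of j] that by auto
      have "dist (w (r m) s) (w (r n) s)
          \<le> dist (w (r m) s) (w (r m) (c q)) + (dist (w (r m) (c q)) (w (r n) (c q)) + dist (w (r n) (c q)) (w (r n) s))"
        by (meson add_left_mono dist_triangle order_trans)
      then show "dist (w (r m) s) (w (r n) s) < e"
        using a[OF mn(1)] a[OF mn(2)] N1[of m n] mn by (simp add: dist_commute)
    qed
  qed
  then have lim\<gamma>: "(\<lambda>j. w (r j) s) \<longlonglongrightarrow> lim (\<lambda>j. w (r j) s)" if "s \<in> {0..L}" for s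
    using that by (simp add: convergent_LIMSEQ_iff)
  define \<gamma> where "\<gamma> s = lim (\<lambda>j. w (r j) s)" for s
  have "1-lipschitz_on {0..L} \<gamma>"
  proof (rule lipschitz_onI)
    fix s t assume st: "s \<in> {0..L}" "t \<in> {0..L}"
    have "(\<lambda>j. dist (w (r j) s) (w (r j) t)) \<longlonglongrightarrow> dist (\<gamma> s) (\<gamma> t)"
      unfolding \<gamma>_def by (intro tendsto_dist lim\<gamma> st)
    moreover have "(\<lambda>j. \<bar>t - s\<bar> + d (r j)) \<longlonglongrightarrow> \<bar>t - s\<bar> + 0" by (intro tendsto_add tendsto_const dr)
    ultimately have "dist (\<gamma> s) (\<gamma> t) \<le> \<bar>t - s\<bar> + 0"
      by (rule LIMSEQ_le) (use w'[OF st] in auto)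
    then show "dist (\<gamma> s) (\<gamma> t) \<le> 1 * dist s t" by (simp add: dist_real_def abs_minus_commute)
  qed simp
  then show ?thesis using that[OF r lim2, of \<gamma>] Z lim\<gamma> by (auto simp: \<gamma>_def)
qed

section \<open>Distances along discrete chains\<close>

text \<open>Inserting 1 caps the distance, and covers the case that there is no admissible chain.\<close>

definition chain_dist :: "'a::metric_space set \<Rightarrow> ('a \<Rightarrow> real) \<Rightarrow> real \<Rightarrow> 'a \<Rightarrow> real" where
  "chain_dist F h d x =
     Inf (insert 1 (chain_cost h ` {xs. xs \<noteq> [] \<and> hd xs = x \<and> last xs \<in> F \<and> small_steps d xs}))"

context
  fixes h :: "'a::metric_space \<Rightarrow> real" and F :: "'a set" and d :: real
  assumes h: "\<And>x. 0 \<le> h x"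
begin

lemma chain_dist_bdd: "bdd_below (insert 1 (chain_cost h ` S))"
  by (rule bdd_belowI[of _ 0]) (auto intro: chain_cost_nonneg h)

lemma chain_dist_nonneg: "0 \<le> chain_dist F h d x"
  unfolding chain_dist_def by (rule cInf_greatest) (auto intro: chain_cost_nonneg h)

lemma chain_dist_le_1: "chain_dist F h d x \<le> 1"
  unfolding chain_dist_def by (intro cInf_lower chain_dist_bdd) simp

lemma chain_dist_le:
  "xs \<noteq> [] \<Longrightarrow> hd xs = x \<Longrightarrow> last xs \<in> F \<Longrightarrow> small_steps d xs \<Longrightarrow> chain_dist F h d x \<le> chain_cost h xs"
  unfolding chain_dist_def by (intro cInf_lower chain_dist_bdd) auto

lemma chain_dist_0: "x \<in> F \<Longrightarrow> chain_dist F h d x = 0"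
  using chain_dist_le[of "[x]" x] chain_dist_nonneg[of x] by simp

lemma chain_dist_less:
  assumes "chain_dist F h d x < c" "c \<le> 1"
  obtains xs where "xs \<noteq> []" "hd xs = x" "last xs \<in> F" "small_steps d xs" "chain_cost h xs < c"
proof -
  obtain y where y: "y \<in> insert 1 (chain_cost h ` {xs. xs \<noteq> [] \<and> hd xs = x \<and> last xs \<in> F \<and> small_steps d xs})" "y < c"
    using cInf_lessD[OF _ assms(1)[unfolded chain_dist_def]] by blast
  then have "y \<noteq> 1" using assms(2) by auto
  then show ?thesis using y that by auto
qed

text \<open>Prepending \<open>x\<close> to a chain from \<open>y\<close> adds exactly the first
  term. The inserted value 1 causes no harm, as the distance from \<open>x\<close> is capped by 1 as
  well.\<close>

lemma chain_dist_step:
  assumes "dist x y \<le> d"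
  shows "chain_dist F h d x \<le> h x * dist x y + chain_dist F h d y"
proof -
  have "chain_dist F h d x - h x * dist x y \<le> chain_dist F h d y"
    unfolding chain_dist_def[of F h d y]
  proof (rule cInf_greatest)
    fix e assume "e \<in> insert 1 (chain_cost h ` {xs. xs \<noteq> [] \<and> hd xs = y \<and> last xs \<in> F \<and> small_steps d xs})"
    then consider "e = 1" | xs where "e = chain_cost h xs" "xs \<noteq> []" "hd xs = y" "last xs \<in> F" "small_steps d xs" by auto
    then show "chain_dist F h d x - h x * dist x y \<le> e"
    proof cases
      case 1
      have "0 \<le> h x * dist x y" using h by simp
      then show ?thesis using 1 chain_dist_le_1[of x] by linarith
    next
      case 2
      then obtain zs where zs: "xs = y # zs" by (cases xs) auto
      have "chain_dist F h d x \<le> chain_cost h (x # xs)" by (rule chain_dist_le) (use 2 zs assms in auto)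
      then show ?thesis using 2 zs by simp
    qed
  qed simp
  then show ?thesis by simp
qed

lemma chain_dist_lipschitz:
  assumes "dist x y \<le> d"
  shows "\<bar>chain_dist F h d x - chain_dist F h d y\<bar> \<le> max (h x) (h y) * dist x y"
proof -
  have "h x * dist x y \<le> max (h x) (h y) * dist x y" "h y * dist x y \<le> max (h x) (h y) * dist x y"
    by (auto intro: mult_right_mono)
  then show ?thesis
    using chain_dist_step[OF assms] chain_dist_step[of y x] assms by (auto simp: dist_commute abs_le_iff)
qed

lemma chain_dist_continuous:
  assumes hc: "continuous_on UNIV h" and d: "0 < d"
  shows "continuous_on UNIV (chain_dist F h d)"
  unfolding continuous_on_iff
proof (intro ballI allI impI)
  fix x :: 'a and e :: real assume e: "0 < e"
  obtain s where s: "0 < s" "\<And>y. dist y x < s \<Longrightarrow> dist (h y) (h x) < 1"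
    using hc zero_less_one unfolding continuous_on_iff by (metis UNIV_I)
  have hx: "0 < h x + 1" using h[of x] by linarith
  show "\<exists>s>0. \<forall>y\<in>UNIV. dist y x < s \<longrightarrow> dist (chain_dist F h d y) (chain_dist F h d x) < e"
  proof (intro exI[of _ "min (min s d) (e / (h x + 1))"] conjI ballI impI)
    fix y assume y: "dist y x < min (min s d) (e / (h x + 1))"
    have "h y < h x + 1" using s(2)[of y] y by (auto simp: dist_real_def)
    then have "max (h y) (h x) * dist y x \<le> (h x + 1) * dist y x" by (intro mult_right_mono) auto
    also have "\<dots> < e" using y hx by (simp add: less_divide_eq mult.commute)
    finally show "dist (chain_dist F h d y) (chain_dist F h d x) < e"
      using chain_dist_lipschitz[of y x] y by (auto simp: dist_real_def)
  qed (use s d e hx in auto)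
qed

lemma chain_dist_upper_gradient:
  assumes hc: "continuous_on UNIV h" and d: "0 < d"
  shows "upper_gradient UNIV (\<lambda>x. ereal (chain_dist F h d x)) (\<lambda>x. ennreal (h x))"
  by (rule upper_gradient_pointwise_lipschitz[OF hc h d chain_dist_lipschitz])

end

text \<open>A larger weight makes each chain more expensive, and a smaller bound on the steps leaves
  fewer chains. Hence refining both at once gives an increasing sequence.\<close>

lemma chain_dist_mono:
  assumes "\<And>x. 0 \<le> h x" "\<And>x. h x \<le> h' x" "d' \<le> d"
  shows "chain_dist F h d x \<le> chain_dist F h' d' x"
proof -
  have h': "0 \<le> h' x" for x using assms(1)[of x] assms(2)[of x] by linarith
  show ?thesis
    unfolding chain_dist_def[of F h' d' x]
  proof (rule cInf_greatest)
    fix e assume "e \<in> insert 1 (chain_cost h' ` {xs. xs \<noteq> [] \<and> hd xs = x \<and> last xs \<in> F \<and> small_steps d' xs})"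
    then consider "e = 1" | xs where "e = chain_cost h' xs" "xs \<noteq> []" "hd xs = x" "last xs \<in> F" "small_steps d' xs" by auto
    then show "chain_dist F h d x \<le> e"
    proof cases
      case 1
      then show ?thesis using chain_dist_le_1[of h F d x, OF assms(1)] by simp
    next
      case 2
      have "chain_dist F h d x \<le> chain_cost h xs"
        using 2 small_steps_mono[OF assms(3)] by (intro chain_dist_le[of h, OF assms(1)]) auto
      also have "\<dots> \<le> chain_cost h' xs" by (rule chain_cost_mono) (rule assms(2))
      finally show ?thesis using 2 by simp
    qed
  qed simp
qed

text \<open>If all curves from \<open>x\<close> to \<open>F\<close> have length at least one with respect to \<open>sup h\<close>, then the chain
  distances tend to one: otherwise short chains would subconverge to a short curve.\<close>

lemma chain_dist_limit:
  fixes h :: "nat \<Rightarrow> 'a::complete_space \<Rightarrow> real"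
  assumes K: "\<And>r. compact (cball (x::'a) r)"
    and h: "0 < c" "\<And>m. continuous_on UNIV (h m)" "\<And>m y. c \<le> h m y" "\<And>m y. h m y \<le> h (Suc m) y"
    and F: "closed F"
    and curves: "\<And>l \<gamma>. 0 \<le> l \<Longrightarrow> 1-lipschitz_on {0..l} \<gamma> \<Longrightarrow> \<gamma> 0 = x \<Longrightarrow> \<gamma> l \<in> F \<Longrightarrow>
       1 \<le> line_integral (0, l, \<gamma>) (\<lambda>y. SUP m. ennreal (h m y))"
  shows "(SUP k. chain_dist F (h k) (1 / real (Suc k)) x) = 1"
proof -
  define d where "d k = 1 / real (Suc k)" for k
  have d0: "0 < d k" for k by (simp add: d_def)
  have dlim: "d \<longlonglongrightarrow> 0" using LIMSEQ_inverse_real_of_nat by (simp add: d_def[abs_def] divide_inverse)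
  have h0: "0 \<le> h m y" for m y using h(1) h(3)[of m y] by linarith
  have hmono: "h m y \<le> h n y" if "m \<le> n" for m n y using lift_Suc_mono_le[of "\<lambda>m. h m y"] h(4) that by blast
  let ?v = "\<lambda>k. chain_dist F (h k) (d k) x"
  have v1: "?v k \<le> 1" for k by (rule chain_dist_le_1[of "h k", OF h0])
  have bdd: "bdd_above (range ?v)" using v1 by (intro bdd_aboveI2[of _ _ 1]) auto
  have "(SUP k. ?v k) = 1"
  proof (rule ccontr)
    assume "(SUP k. ?v k) \<noteq> 1"
    moreover have "(SUP k. ?v k) \<le> 1" using v1 by (intro cSUP_least) auto
    ultimately have lt: "(SUP k. ?v k) < 1" by simp
    then obtain c1 where c1: "(SUP k. ?v k) < c1" "c1 < 1" using dense by blast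
    have "\<exists>xs. xs \<noteq> [] \<and> hd xs = x \<and> last xs \<in> F \<and> small_steps (d k) xs \<and> chain_cost (h k) xs < c1" for k
    proof -
      have "?v k \<le> (SUP k. ?v k)" by (rule cSUP_upper[OF UNIV_I bdd])
      then have "?v k < c1" using c1 by linarith
      then show ?thesis using chain_dist_less[of "h k" F "d k" x c1, OF h0] c1 by (metis less_imp_le)
    qed
    then obtain xs where xs: "\<And>k. xs k \<noteq> []" "\<And>k. hd (xs k) = x" "\<And>k. last (xs k) \<in> F"
      "\<And>k. small_steps (d k) (xs k)" "\<And>k. chain_cost (h k) (xs k) < c1" by metis
    \<comment> \<open>The weights are at least \<open>c\<close>, so chains of cost below
      \<open>c1\<close> have at most this length.\<close>
    define L where "L = c1 / c"
    have len0: "0 \<le> chain_length (xs k)" for k by (intro chain_cost_nonneg) simp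
    have len: "chain_length (xs k) \<in> {0..L}" for k
    proof -
      have "c * chain_length (xs k) \<le> c1"
        using chain_cost_ge_length[of c "h k" "xs k", OF h(3)] xs(5)[of k] by linarith
      then show ?thesis using len0 h(1) by (simp add: L_def le_divide_eq mult.commute)
    qed
    have wd: "dist (walk (xs k) s) (walk (xs k) t) \<le> (t - s) + d k" if "0 \<le> s" "s \<le> t" for k s t
      using dist_walk[OF xs(1,4)] d0[of k] that by (simp add: less_imp_le)
    obtain r :: "nat \<Rightarrow> nat" and \<gamma> l where r: "strict_mono r" and l: "(\<lambda>j. chain_length (xs (r j))) \<longlonglongrightarrow> l" "l \<in> {0..L}"
      and \<gamma>: "1-lipschitz_on {0..L} \<gamma>" and conv: "\<And>s. s \<in> {0..L} \<Longrightarrow> (\<lambda>j. walk (xs (r j)) s) \<longlonglongrightarrow> \<gamma> s"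
    proof (rule asymptotically_lipschitz_subseq[where w = "\<lambda>k. walk (xs k)" and len = "\<lambda>k. chain_length (xs k)" and d = d and L = L])
      show "compact (cball x L)" by (rule K)
      show "walk (xs k) s \<in> cball x L" if "s \<in> {0..L}" for k s
        using dist_hd_walk[OF xs(1)[of k], of s] xs(2)[of k] that by auto
    qed (use len wd dlim in auto)
    have dr: "(\<lambda>j. d (r j)) \<longlonglongrightarrow> 0" using LIMSEQ_subseq_LIMSEQ[OF dlim r] by (simp add: comp_def)
    have start: "\<gamma> 0 = x"
    proof -
      have "walk (xs k) 0 = x" for k using dist_hd_walk[OF xs(1)[of k], of 0] xs(2)[of k] by simp
      then show ?thesis using conv[of 0] l(2) by (simp add: LIMSEQ_const_iff)
    qed
    \<comment> \<open>The last point of a chain is the position of its walk at time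
      \<open>max l (chain_length (xs k))\<close>. Since the lengths tend to \<open>l\<close>, it has
      the same limit as the position at time \<open>l\<close>.\<close>
    have ends: "\<gamma> l \<in> F"
    proof -
      have "(\<lambda>j. last (xs (r j))) \<longlonglongrightarrow> \<gamma> l"
      proof (rule metric_tendsto_imp_tendsto)
        have "(\<lambda>j. \<bar>chain_length (xs (r j)) - l\<bar> + d (r j) + dist (walk (xs (r j)) l) (\<gamma> l)) \<longlonglongrightarrow> \<bar>l - l\<bar> + 0 + dist (\<gamma> l) (\<gamma> l)"
          by (intro tendsto_intros l dr conv)
        then show "(\<lambda>j. \<bar>chain_length (xs (r j)) - l\<bar> + d (r j) + dist (walk (xs (r j)) l) (\<gamma> l)) \<longlonglongrightarrow> 0" by simp
        have "dist (last (xs k)) (\<gamma> l) \<le> dist (\<bar>chain_length (xs k) - l\<bar> + d k + dist (walk (xs k) l) (\<gamma> l)) 0" for k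
        proof -
          have "walk (xs k) (max l (chain_length (xs k))) = last (xs k)" by (rule walk_beyond[OF xs(1)]) simp
          then have "dist (walk (xs k) l) (last (xs k)) \<le> (max l (chain_length (xs k)) - l) + d k"
            using wd[of l "max l (chain_length (xs k))" k] l(2) by simp
          also have "\<dots> \<le> \<bar>chain_length (xs k) - l\<bar> + d k" by simp
          finally show ?thesis
            using dist_triangle[of "last (xs k)" "\<gamma> l" "walk (xs k) l"] d0[of k]
            by (simp add: dist_commute dist_real_def)
        qed
        then show "eventually (\<lambda>j. dist (last (xs (r j))) (\<gamma> l)
            \<le> dist (\<bar>chain_length (xs (r j)) - l\<bar> + d (r j) + dist (walk (xs (r j)) l) (\<gamma> l)) 0) sequentially"
          by (intro always_eventually allI)
      qed
      with xs(3) show ?thesis by (rule closed_sequentially[OF F, of "\<lambda>j. last (xs (r j))"])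
    qed
    have \<gamma>l: "1-lipschitz_on {0..l} \<gamma>" using \<gamma> by (rule lipschitz_on_subset) (use l in auto)
    interpret rect_path 0 l \<gamma>
      using l lipschitz_on_continuous_on[OF \<gamma>l] curve_length_lipschitz[OF _ \<gamma>l]
      by unfold_locales (auto intro: le_less_trans)
    \<comment> \<open>The weight \<open>h m\<close> is kept fixed while the chains vary, so that
      continuity and Fatou's lemma apply; it lies below the weight \<open>h (r j)\<close> of the
      chain once \<open>m \<le> j\<close>. The supremum over \<open>m\<close> is taken
      afterwards.\<close>
    have bound: "line_integral (0, l, \<gamma>) (\<lambda>y. ennreal (h m y)) \<le> ennreal c1" for m
    proof -
      have "line_integral (0, l, \<gamma>) (\<lambda>y. ennreal (h m y)) \<le> (\<integral>\<^sup>+ s. ennreal (h m (\<gamma> s)) * indicator {0..l} s \<partial>lborel)"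
        using l(2) \<gamma>l by (intro line_integral_le_of_lipschitz h0 h(2)) auto
      also have "\<dots> \<le> (\<integral>\<^sup>+ s. liminf (\<lambda>j. ennreal (h m (walk (xs (r j)) s)) * indicator {0..<chain_length (xs (r j))} s) \<partial>lborel)"
      \<comment> \<open>At \<open>s = l\<close> the chain may already have ended; for
        \<open>s < l\<close> its length eventually exceeds \<open>s\<close>.\<close>
      proof (rule nn_integral_mono_AE)
        show "AE s in lborel. ennreal (h m (\<gamma> s)) * indicator {0..l} s
            \<le> liminf (\<lambda>j. ennreal (h m (walk (xs (r j)) s)) * indicator {0..<chain_length (xs (r j))} s)"
          using AE_lborel_singleton[of l]
        proof eventually_elim
          fix s assume s: "s \<noteq> l"
          show "ennreal (h m (\<gamma> s)) * indicator {0..l} s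
            \<le> liminf (\<lambda>j. ennreal (h m (walk (xs (r j)) s)) * indicator {0..<chain_length (xs (r j))} s)"
          proof (cases "s \<in> {0..l}")
            case True
            have "(\<lambda>j. ennreal (h m (walk (xs (r j)) s))) \<longlonglongrightarrow> ennreal (h m (\<gamma> s))"
            proof (intro tendsto_ennrealI isCont_tendsto_compose[OF _ conv])
              show "isCont (h m) (\<gamma> s)" using h(2)[of m] by (simp add: continuous_on_eq_continuous_at)
              show "s \<in> {0..L}" using True l(2) by auto
            qed
            then have "ennreal (h m (\<gamma> s)) = liminf (\<lambda>j. ennreal (h m (walk (xs (r j)) s)))"
              by (simp add: lim_imp_Liminf)
            also have "\<dots> \<le> liminf (\<lambda>j. ennreal (h m (walk (xs (r j)) s)) * indicator {0..<chain_length (xs (r j))} s)"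
            proof (rule Liminf_mono)
              have "eventually (\<lambda>j. s < chain_length (xs (r j))) sequentially"
                using order_tendstoD(1)[OF l(1), of s] True s by auto
              then show "eventually (\<lambda>j. ennreal (h m (walk (xs (r j)) s))
                  \<le> ennreal (h m (walk (xs (r j)) s)) * indicator {0..<chain_length (xs (r j))} s) sequentially"
                by eventually_elim (use True in auto)
            qed
            finally show ?thesis using True by simp
          qed simp
        qed
      qed
      also have "\<dots> \<le> liminf (\<lambda>j. \<integral>\<^sup>+ s. ennreal (h m (walk (xs (r j)) s)) * indicator {0..<chain_length (xs (r j))} s \<partial>lborel)"
      proof (rule nn_integral_liminf)
        have "(\<lambda>s. ennreal (h m (walk (xs (r j)) s)) * indicator {0..<chain_length (xs (r j))} s) \<in> borel_measurable borel" for j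
          by (intro borel_measurable_times_ennreal measurable_compose[OF walk_measurable measurable_ennreal]) simp
        then show "(\<lambda>s. ennreal (h m (walk (xs (r j)) s)) * indicator {0..<chain_length (xs (r j))} s) \<in> borel_measurable lborel" for j
          by simp
      qed
      also have "\<dots> \<le> liminf (\<lambda>j. ennreal c1)"
      proof (rule Liminf_mono)
        show "eventually (\<lambda>j. (\<integral>\<^sup>+ s. ennreal (h m (walk (xs (r j)) s)) * indicator {0..<chain_length (xs (r j))} s \<partial>lborel) \<le> ennreal c1) sequentially"
          using eventually_ge_at_top[of m]
        proof eventually_elim
          case (elim j)
          have "m \<le> r j" using seq_suble[OF r, of j] elim by simp
          have "(\<integral>\<^sup>+ s. ennreal (h m (walk (xs (r j)) s)) * indicator {0..<chain_length (xs (r j))} s \<partial>lborel)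
              \<le> ennreal (chain_cost (h m) (xs (r j)))"
            by (rule walk_integral[OF h0 xs(1)])
          also have "\<dots> \<le> ennreal (chain_cost (h (r j)) (xs (r j)))"
            by (intro ennreal_leI chain_cost_mono hmono \<open>m \<le> r j\<close>)
          also have "\<dots> \<le> ennreal c1" using xs(5)[of "r j"] by (intro ennreal_leI) simp
          finally show ?case .
        qed
      qed
      also have "\<dots> = ennreal c1" by (simp add: Liminf_const)
      finally show ?thesis .
    qed
    have "1 \<le> line_integral (0, l, \<gamma>) (\<lambda>y. SUP m. ennreal (h m y))"
      using l(2) by (intro curves \<gamma>l start ends) auto
    also have "\<dots> = (SUP m. line_integral (0, l, \<gamma>) (\<lambda>y. ennreal (h m y)))"
    proof -
      let ?A = "arclength_param (0, l, \<gamma>)"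
      have "line_integral (0, l, \<gamma>) (\<lambda>y. SUP m. ennreal (h m y))
          = (\<integral>\<^sup>+ s. (SUP m. ennreal (h m (?A s)) * indicator {0..len l} s) \<partial>lborel)"
        unfolding line_integral_eq by (intro nn_integral_cong) (simp add: SUP_mult_right_ennreal)
      also have "\<dots> = (SUP m. \<integral>\<^sup>+ s. ennreal (h m (?A s)) * indicator {0..len l} s \<partial>lborel)"
      proof (rule nn_integral_monotone_convergence_SUP)
        show "incseq (\<lambda>m s. ennreal (h m (?A s)) * indicator {0..len l} s)"
          by (intro incseq_SucI le_funI mult_right_mono ennreal_leI h(4)) simp
        show "(\<lambda>s. ennreal (h m (?A s)) * indicator {0..len l} s) \<in> borel_measurable lborel" for m
          by (rule measurable_arclength_lborel[OF subset_UNIV])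
            (intro measurable_restrict_space1 measurable_compose[OF borel_measurable_continuous_onI[OF h(2)] measurable_ennreal])
      qed
      finally show ?thesis unfolding line_integral_eq .
    qed
    also have "\<dots> \<le> ennreal c1" by (intro SUP_least bound)
    finally show False using c1(2) by simp
  qed
  then show ?thesis by (simp only: d_def)
qed

section \<open>From vanishing capacity to vanishing Hausdorff measure\<close>

lemma (in doubling_space) L1_loc_tendsto_bounded:
  fixes v :: "nat \<Rightarrow> 'a \<Rightarrow> real"
  assumes lim: "\<And>x. (\<lambda>n. v n x) \<longlonglongrightarrow> u x" and v: "\<And>n. v n \<in> borel_measurable M"
    "\<And>n x. 0 \<le> v n x" "\<And>n x. v n x \<le> 1"
  shows "L1_loc_tendsto M UNIV v (\<lambda>x. ereal (u x))"
  unfolding L1_loc_tendsto_def e2ennreal_abs_diff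
proof (intro ballI exI[of _ 1] conjI)
  note v(1)[measurable]
  have [measurable]: "u \<in> borel_measurable M" by (rule borel_measurable_LIMSEQ_real[OF lim]) measurable
  have u: "0 \<le> u x" "u x \<le> 1" for x
    using LIMSEQ_le_const[OF lim[of x]] LIMSEQ_le_const2[OF lim[of x]] v(2,3) by blast+
  fix x
  have "(\<lambda>i. \<integral>\<^sup>+y\<in>ball x 1. ennreal \<bar>v i y - u y\<bar> \<partial>M) \<longlonglongrightarrow> (\<integral>\<^sup>+y. 0 \<partial>M)"
  proof (rule nn_integral_dominated_convergence[where w = "indicator (ball x 1)"])
    show "AE y in M. ennreal \<bar>v i y - u y\<bar> * indicator (ball x 1) y \<le> indicator (ball x 1) y" for i
    proof (rule AE_I2)
      fix y
      have "\<bar>v i y - u y\<bar> \<le> 1" using v(2,3)[of i y] u[of y] by linarith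
      then show "ennreal \<bar>v i y - u y\<bar> * indicator (ball x 1) y \<le> indicator (ball x 1) y"
        by (auto simp: indicator_def)
    qed
    show "AE y in M. (\<lambda>i. ennreal \<bar>v i y - u y\<bar> * indicator (ball x 1) y) \<longlonglongrightarrow> 0"
    proof (rule AE_I2)
      fix y
      have "(\<lambda>i. \<bar>v i y - u y\<bar>) \<longlonglongrightarrow> \<bar>u y - u y\<bar>" by (intro tendsto_intros lim)
      then have "(\<lambda>i. ennreal \<bar>v i y - u y\<bar>) \<longlonglongrightarrow> ennreal 0" by (intro tendsto_ennrealI) simp
      then show "(\<lambda>i. ennreal \<bar>v i y - u y\<bar> * indicator (ball x 1) y) \<longlonglongrightarrow> 0"
        by (cases "y \<in> ball x 1") auto
    qed
  qed (use ball_finite[of x 1] in auto)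
  then show "(\<lambda>i. \<integral>\<^sup>+y\<in>ball x 1. ennreal \<bar>v i y - u y\<bar> \<partial>M) \<longlonglongrightarrow> 0" by simp
qed auto

text \<open>The function is the increasing limit of chain distances to the complement of
  \<open>ball x0 (2 * R)\<close> for the weights \<open>h k\<close> of \<open>lsc_majorant\<close>.
  Being a supremum of continuous functions it has open superlevel sets, and \<open>H\<close>,
  applied to the majorant itself, makes it equal to one on \<open>E\<close>. The majorant is built
  on the ball of radius \<open>3 * R\<close> because the gradients are needed on the closed ball of
  radius \<open>2 * R\<close>.\<close>

lemma (in doubling_space) chain_approx:
  assumes \<rho>: "\<rho> \<in> borel_measurable M" "(\<integral>\<^sup>+x\<in>ball x0 (3 * R). \<rho> x \<partial>M) \<le> ennreal I" and I: "0 \<le> I" "0 < e"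
    and R: "0 < R" and E: "E \<subseteq> ball x0 (2 * R)"
    and H: "\<And>a b \<gamma> h. (a, b, \<gamma>) \<in> paths_in UNIV \<Longrightarrow> \<gamma> a \<in> E \<Longrightarrow> \<gamma> b \<notin> ball x0 (2 * R) \<Longrightarrow>
      \<gamma> ` {a..b} \<subseteq> cball x0 (2 * R) \<Longrightarrow> h \<in> borel_measurable borel \<Longrightarrow>
      (\<And>x. x \<in> cball x0 (2 * R) \<Longrightarrow> \<rho> x \<le> h x) \<Longrightarrow> 1 \<le> line_integral (a, b, \<gamma>) h"
  obtains u :: "'a \<Rightarrow> real" where "approx_var M UNIV (\<lambda>x. ereal (u x)) (ennreal (I + e))"
    "\<And>t. open {x. t < u x}" "\<And>x. x \<in> E \<Longrightarrow> u x = 1" "\<And>x. x \<notin> ball x0 (2 * R) \<Longrightarrow> u x = 0"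
    "u \<in> borel_measurable M"
proof -
  have R3: "0 < 3 * R" using R by simp
  obtain h :: "nat \<Rightarrow> 'a \<Rightarrow> real" and c where h: "0 < c" "\<And>m. continuous_on UNIV (h m)" "\<And>m x. c \<le> h m x"
    "\<And>m x. h m x \<le> h (Suc m) x" "\<And>x. x \<in> ball x0 (3 * R) \<Longrightarrow> \<rho> x \<le> (SUP m. ennreal (h m x))"
    "(\<integral>\<^sup>+x\<in>ball x0 (3 * R). (SUP m. ennreal (h m x)) \<partial>M) \<le> (\<integral>\<^sup>+x\<in>ball x0 (3 * R). \<rho> x \<partial>M) + ennreal e"
    by (rule lsc_majorant[OF \<rho>(1) I(2) R3]) (rule that)
  have h0: "0 \<le> h m x" for m x using h(1) h(3)[of m x] by linarith
  define F where "F = - ball x0 (2 * R)"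
  have F: "closed F" by (simp add: F_def closed_Compl)
  define v where "v k = chain_dist F (h k) (1 / real (Suc k))" for k
  have v01: "0 \<le> v k x" "v k x \<le> 1" for k x
    unfolding v_def by (intro chain_dist_nonneg h0 chain_dist_le_1)+
  have vF: "v k x = 0" if "x \<in> F" for k x unfolding v_def by (rule chain_dist_0[OF h0 that])
  have vc: "continuous_on UNIV (v k)" for k
    unfolding v_def by (rule chain_dist_continuous[OF h0 h(2)]) simp
  have vu: "upper_gradient UNIV (\<lambda>x. ereal (v k x)) (\<lambda>x. ennreal (h k x))" for k
    unfolding v_def by (rule chain_dist_upper_gradient[OF h0 h(2)]) simp
  have vmono: "v k x \<le> v (Suc k) x" for k x
    unfolding v_def by (intro chain_dist_mono h0 h(4)) (simp add: frac_le)
  define u where "u x = (SUP k. v k x)" for x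
  have bdd: "bdd_above (range (\<lambda>k. v k x))" for x using v01 by (intro bdd_aboveI2[of _ _ 1]) auto
  have lim: "(\<lambda>k. v k x) \<longlonglongrightarrow> u x" for x
    unfolding u_def by (intro LIMSEQ_incseq_SUP bdd incseq_SucI vmono)
  have [measurable]: "v k \<in> borel_measurable M" for k by (rule continuous_M[OF vc])
  have um [measurable]: "u \<in> borel_measurable M" by (rule borel_measurable_LIMSEQ_real[OF lim]) measurable
  have hb: "(\<lambda>x. SUP m. ennreal (h m x)) \<in> borel_measurable borel"
    by (intro borel_measurable_SUP measurable_compose[OF borel_measurable_continuous_onI[OF h(2)] measurable_ennreal]) auto
  have uE: "u x = 1" if x: "x \<in> E" for x
    unfolding u_def v_def
  proof (rule chain_dist_limit[where h = h and c = c, OF compact_cball h(1-4) F])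
    fix l and \<gamma> :: "real \<Rightarrow> 'a"
    assume l: "0 \<le> l" and \<gamma>: "1-lipschitz_on {0..l} \<gamma>" "\<gamma> 0 = x" "\<gamma> l \<in> F"
    interpret rect_path 0 l \<gamma>
      using l lipschitz_on_continuous_on[OF \<gamma>(1)] curve_length_lipschitz[OF l \<gamma>(1)]
      by unfold_locales (auto intro: le_less_trans)
    have f: "continuous_on {0..l} (\<lambda>s. dist x0 (\<gamma> s))" by (intro continuous_intros cont)
    have x2: "dist x0 x < 2 * R" using x E by auto
    \<comment> \<open>The curve is stopped when it first reaches the sphere of radius
      \<open>2 * R\<close>, since \<open>H\<close> speaks only of curves in the closed ball.\<close>
    obtain s where s: "0 \<le> s" "s \<le> l" "dist x0 (\<gamma> s) = 2 * R" "\<And>r. r \<in> {0..s} \<Longrightarrow> dist x0 (\<gamma> r) \<le> 2 * R"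
      by (rule first_passage[OF l f, of "2 * R"]) (use \<gamma> x2 in \<open>auto simp: F_def\<close>)
    interpret S: rect_path 0 s \<gamma> using s by (intro sub_path) auto
    have ne: "\<gamma> 0 \<noteq> \<gamma> s" using s(3) x2 \<gamma>(2) by auto
    have "\<not> \<gamma> constant_on {0..s}"
      using ne s(1) unfolding constant_on_def by (metis atLeastAtMost_iff order_refl)
    then have p: "(0, s, \<gamma>) \<in> paths_in UNIV" using S.cont S.fin s(1) by (auto simp: paths_in_def)
    have "1 \<le> line_integral (0, s, \<gamma>) (\<lambda>y. SUP m. ennreal (h m y))"
    proof (rule H[OF p _ _ _ hb])
      show "\<gamma> 0 \<in> E" using \<gamma>(2) x by simp
      show "\<gamma> s \<notin> ball x0 (2 * R)" using s(3) by simp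
      show "\<gamma> ` {0..s} \<subseteq> cball x0 (2 * R)" using s(4) by auto
      fix y assume "y \<in> cball x0 (2 * R)"
      then show "\<rho> y \<le> (SUP m. ennreal (h m y))" using R by (intro h(5)) simp
    qed
    also have "\<dots> \<le> line_integral (0, l, \<gamma>) (\<lambda>y. (SUP m. ennreal (h m y)) * indicator UNIV y)"
      using s(1,2) by (intro line_integral_sub[of 0 s UNIV UNIV] measurable_restrict_space1 hb) auto
    finally show "1 \<le> line_integral (0, l, \<gamma>) (\<lambda>y. SUP m. ennreal (h m y))" by simp
  qed
  define G where "G k x = ennreal (h k x) * indicator (cball x0 (2 * R)) x" for k x
  have Gm: "G k \<in> borel_measurable borel" for k
    unfolding G_def
    by (intro borel_measurable_times_ennreal measurable_compose[OF borel_measurable_continuous_onI[OF h(2)] measurable_ennreal]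
        borel_measurable_indicator borel_closed closed_cball)
  have Gu: "upper_gradient UNIV (\<lambda>x. ereal (v k x)) (G k)" for k
  proof (rule upper_gradient_zero_extension[OF vu, where f = "dist x0" and e = "2 * R"])
    show "v k x = 0" if "2 * R \<le> dist x0 x" for x using that by (intro vF) (auto simp: F_def)
  qed (use v01 Gm in \<open>auto intro!: continuous_intros simp: G_def\<close>)
  have Gint: "(\<integral>\<^sup>+x. G k x \<partial>M) \<le> ennreal (I + e)" for k
  proof -
    have "(\<integral>\<^sup>+x. G k x \<partial>M) \<le> (\<integral>\<^sup>+x\<in>ball x0 (3 * R). (SUP m. ennreal (h m x)) \<partial>M)"
    proof (rule nn_integral_mono)
      fix x
      have "ennreal (h k x) \<le> (SUP m. ennreal (h m x))" by (rule SUP_upper) simp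
      then show "G k x \<le> (SUP m. ennreal (h m x)) * indicator (ball x0 (3 * R)) x"
        using R by (auto simp: G_def indicator_def)
    qed
    also have "\<dots> \<le> ennreal I + ennreal e" using h(6) \<rho>(2) by (meson add_right_mono order_trans)
    finally show ?thesis using I by simp
  qed
  have conv: "L1_loc_tendsto M UNIV v (\<lambda>x. ereal (u x))"
    by (rule L1_loc_tendsto_bounded[OF lim]) (use v01 in auto)
  show ?thesis
  proof (rule that)
    show "approx_var M UNIV (\<lambda>x. ereal (u x)) (ennreal (I + e))"
      unfolding approx_var_def using vc Gu Gint conv by (intro exI[of _ v] exI[of _ G]) auto
    show "open {x. t < u x}" for t
    proof -
      have "{x. t < u x} = (\<Union>k. {x. t < v k x})" unfolding u_def by (auto simp: less_cSUP_iff[OF _ bdd])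
      also have "open \<dots>" by (intro open_UN ballI open_Collect_less vc continuous_on_const)
      finally show ?thesis .
    qed
    show "u x = 0" if "x \<notin> ball x0 (2 * R)" for x using vF[of x] that by (simp add: u_def F_def)
  qed (use uE um in auto)
qed

context poincare_space
begin

text \<open>\<open>boxing\<close> is applied at the scale \<open>r\<close> that belongs to \<delta>.
  Balls of radius \<open>r\<close> centred in \<open>ball x0 R\<close> have measure at least some
  positive \<open>m\<close>, so a set of measure at most \<open>m / 2\<close> fills at most half of
  each of them.\<close>

lemma hausdorff_zero:
  assumes E: "E \<subseteq> ball x0 R"
    and A: "\<And>\<epsilon>. 0 < \<epsilon> \<Longrightarrow> \<exists>A U. approx_per M UNIV A (ennreal \<epsilon>) \<and> A \<in> sets M \<and> open U \<and> E \<subseteq> U \<and> U \<subseteq> A \<and>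
      emeasure M A \<le> ennreal \<epsilon>"
  shows "codim1_hausdorff (emeasure M) E = 0"
proof -
  obtain C where C: "0 < C" and box: "\<And>A U E \<epsilon> r \<delta>. approx_per M UNIV A (ennreal \<epsilon>) \<Longrightarrow> 0 \<le> \<epsilon> \<Longrightarrow> A \<in> sets M \<Longrightarrow>
      open U \<Longrightarrow> E \<subseteq> U \<Longrightarrow> U \<subseteq> A \<Longrightarrow> 0 < r \<Longrightarrow> 5 * \<tau> * r \<le> \<delta> \<Longrightarrow>
      (\<And>x. x \<in> E \<Longrightarrow> measure M (A \<inter> ball x r) \<le> measure M (ball x r) / 2) \<Longrightarrow>
      codim1_content (emeasure M) \<delta> E \<le> ennreal (C * \<epsilon>)"
    using boxing by blast
  have "codim1_content (emeasure M) \<delta> E \<le> 0" if \<delta>: "0 < \<delta>" for \<delta>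
  proof (rule ennreal_le_epsilon)
    fix e :: real assume e: "0 < e"
    define r where "r = \<delta> / (5 * \<tau>)"
    have r: "0 < r" "5 * \<tau> * r = \<delta>" using \<delta> \<tau> by (auto simp: r_def)
    obtain m where m: "0 < m" "\<And>x. x \<in> ball x0 R \<Longrightarrow> m \<le> measure M (ball x r)"
      using measure_ball_lower[OF r(1)] by blast
    \<comment> \<open>The first bound makes the content at most \<open>e\<close>; the second gives
      the density condition of \<open>boxing\<close>.\<close>
    define \<epsilon> where "\<epsilon> = min (e / C) (m / 2)"
    have \<epsilon>: "0 < \<epsilon>" "C * \<epsilon> \<le> e" "\<epsilon> \<le> m / 2"
      using e C m by (auto simp: \<epsilon>_def min_def field_simps)
    obtain A U where AU: "approx_per M UNIV A (ennreal \<epsilon>)" "A \<in> sets M" "open U" "E \<subseteq> U" "U \<subseteq> A"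
      "emeasure M A \<le> ennreal \<epsilon>" using A[OF \<epsilon>(1)] by blast
    have "codim1_content (emeasure M) \<delta> E \<le> ennreal (C * \<epsilon>)"
    proof (rule box[OF AU(1) _ AU(2-5) r(1)])
      fix x assume x: "x \<in> E"
      have "emeasure M (A \<inter> ball x r) \<le> ennreal \<epsilon>"
        using AU(2,6) emeasure_mono[of "A \<inter> ball x r" A M] by (auto intro: order_trans)
      then have "measure M (A \<inter> ball x r) \<le> \<epsilon>"
        unfolding measure_def using \<epsilon>(1) by (intro enn2real_leI) auto
      then show "measure M (A \<inter> ball x r) \<le> measure M (ball x r) / 2"
        using \<epsilon>(3) m(2)[of x] x E by auto
    qed (use \<epsilon> r in auto)
    also have "\<dots> \<le> 0 + ennreal e" using \<epsilon> by (simp add: ennreal_leI)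
    finally show "codim1_content (emeasure M) \<delta> E \<le> 0 + ennreal e" .
  qed
  then show ?thesis unfolding codim1_hausdorff_eq_SUP by (intro antisym SUP_least) auto
qed

text \<open>In a large ball, which contains a whole ball outside \<open>A\<close>, the relative isoperimetric inequality
  bounds the measure of \<open>A\<close>.\<close>

lemma measure_le_perimeter:
  assumes s: "0 < s" "ball y s \<inter> ball x0 (2 * R) = {}" and R: "0 < R"
  obtains C e0 where "0 < C" "0 < e0"
    "\<And>A \<epsilon>. approx_per M UNIV A (ennreal \<epsilon>) \<Longrightarrow> A \<in> sets M \<Longrightarrow> A \<subseteq> ball x0 (2 * R) \<Longrightarrow> 0 \<le> \<epsilon> \<Longrightarrow> \<epsilon> \<le> e0 \<Longrightarrow>
       emeasure M A \<le> ennreal (C * \<epsilon>)"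
proof -
  \<comment> \<open>A radius at which the ball around \<open>x0\<close> contains both 2B and
    \<open>ball y s\<close>.\<close>
  define T where "T = 2 * R + dist x0 y + s"
  have T: "0 < T" using R s by (simp add: T_def add_pos_pos add_pos_nonneg)
  have sub: "ball x0 (2 * R) \<subseteq> ball x0 T" "ball y s \<subseteq> ball x0 T"
  proof -
    show "ball x0 (2 * R) \<subseteq> ball x0 T" using s by (intro subset_ball) (simp add: T_def)
    show "ball y s \<subseteq> ball x0 T"
    proof
      fix z assume "z \<in> ball y s"
      then show "z \<in> ball x0 T" using dist_triangle[of x0 z y] R by (simp add: T_def)
    qed
  qed
  define m where "m = measure M (ball y s)"
  have m: "0 < m" using measure_ball_pos[OF s(1)] by (simp add: m_def)
  have C: "0 < CP * T" using CP T by simp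
  show ?thesis
  \<comment> \<open>With this threshold \<open>CP * T * \<epsilon>\<close> is at most
    \<open>m / 2\<close>. The isoperimetric bound thus excludes that the minimum \<open>b\<close>
    equals \<open>m\<close>, so it is a bound for the measure of \<open>A\<close>.\<close>
  proof (rule that[of "CP * T" "m / (2 * (CP * T))"])
    fix A \<epsilon> assume app: "approx_per M UNIV A (ennreal \<epsilon>)" and A: "A \<in> sets M" "A \<subseteq> ball x0 (2 * R)"
      and \<epsilon>: "0 \<le> \<epsilon>" "\<epsilon> \<le> m / (2 * (CP * T))"
    have Afin: "emeasure M A = ennreal (measure M A)"
      using bounded_finite[OF bounded_subset[OF bounded_ball A(2)]] by (intro emeasure_eq_ennreal_measure) auto
    define b where "b = min (measure M A) m"
    have "(\<Sum>x\<in>{x0}. b / T) \<le> CP * \<epsilon>"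
    proof (rule isoperimetric_sum[OF app \<epsilon>(1) A(1)])
      have "A \<inter> ball x0 T = A" using A(2) sub(1) by auto
      moreover have "ennreal m \<le> emeasure M (ball x0 T - A)"
        unfolding m_def ball_real[symmetric] using sub(2) s(2) A by (intro emeasure_mono) auto
      ultimately show "ennreal b \<le> min (emeasure M (A \<inter> ball x T)) (emeasure M (ball x T - A))" if "x \<in> {x0}" for x
      proof -
        have "ennreal b \<le> ennreal (measure M A)" "ennreal b \<le> ennreal m" by (auto simp: b_def intro: ennreal_leI)
        then show ?thesis
          using that Afin \<open>A \<inter> ball x0 T = A\<close> order_trans[OF _ \<open>ennreal m \<le> emeasure M (ball x0 T - A)\<close>] by simp
      qed
    qed (use T m in \<open>auto simp: b_def disjoint_family_on_def\<close>)
    then have b: "b \<le> CP * T * \<epsilon>" using T by (simp add: divide_le_eq ac_simps)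
    have "CP * T * \<epsilon> \<le> m / 2" using \<epsilon>(2) C by (simp add: field_simps)
    then have "b < m" using b m by linarith
    then have "measure M A \<le> CP * T * \<epsilon>" using b by (auto simp: b_def min_def split: if_splits)
    then show "emeasure M A \<le> ennreal (CP * T * \<epsilon>)" unfolding Afin by (rule ennreal_leI)
  qed (use C m in auto)
qed

text \<open>Inside 2B, small perimeter already implies small measure by
  \<open>measure_le_perimeter\<close>, so the condition on the measure in
  \<open>hausdorff_zero\<close> can be replaced by containment.\<close>

lemma hausdorff_zero_bounded:
  assumes s: "0 < s" "ball y s \<inter> ball x0 (2 * R) = {}" and R: "0 < R" and E: "E \<subseteq> ball x0 R"
    and A: "\<And>\<epsilon>. 0 < \<epsilon> \<Longrightarrow> \<exists>A U. approx_per M UNIV A (ennreal \<epsilon>) \<and> A \<in> sets M \<and> open U \<and> E \<subseteq> U \<and> U \<subseteq> A \<and>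
      A \<subseteq> ball x0 (2 * R)"
  shows "codim1_hausdorff (emeasure M) E = 0"
proof (rule hausdorff_zero[OF E])
  obtain C e0 where C: "0 < C" "0 < e0"
    "\<And>A \<epsilon>. approx_per M UNIV A (ennreal \<epsilon>) \<Longrightarrow> A \<in> sets M \<Longrightarrow> A \<subseteq> ball x0 (2 * R) \<Longrightarrow> 0 \<le> \<epsilon> \<Longrightarrow> \<epsilon> \<le> e0 \<Longrightarrow>
       emeasure M A \<le> ennreal (C * \<epsilon>)" using measure_le_perimeter[OF s R] by blast
  fix \<epsilon> :: real assume \<epsilon>: "0 < \<epsilon>"
  define \<epsilon>' where "\<epsilon>' = min \<epsilon> (min e0 (\<epsilon> / C))"
  have \<epsilon>': "0 < \<epsilon>'" "\<epsilon>' \<le> \<epsilon>" "\<epsilon>' \<le> e0" "C * \<epsilon>' \<le> \<epsilon>"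
  proof -
    show "0 < \<epsilon>'" "\<epsilon>' \<le> \<epsilon>" "\<epsilon>' \<le> e0" using \<epsilon> C(1,2) by (simp_all add: \<epsilon>'_def min.coboundedI1 min.coboundedI2)
    have "\<epsilon>' \<le> \<epsilon> / C" by (simp add: \<epsilon>'_def)
    then show "C * \<epsilon>' \<le> \<epsilon>" using C(1) by (simp add: le_divide_eq mult.commute)
  qed
  obtain A U where AU: "approx_per M UNIV A (ennreal \<epsilon>')" "A \<in> sets M" "open U" "E \<subseteq> U" "U \<subseteq> A" "A \<subseteq> ball x0 (2 * R)"
    using A[OF \<epsilon>'(1)] by blast
  have "emeasure M A \<le> ennreal (C * \<epsilon>')" using \<epsilon>' by (intro C(3) AU) auto
  also have "\<dots> \<le> ennreal \<epsilon>" using \<epsilon>' by (intro ennreal_leI)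
  finally have "emeasure M A \<le> ennreal \<epsilon>" .
  moreover have "approx_per M UNIV A (ennreal \<epsilon>)"
    using AU(1) ennreal_leI[OF \<epsilon>'(2)] unfolding approx_per_def by (meson order_trans)
  ultimately show "\<exists>A U. approx_per M UNIV A (ennreal \<epsilon>) \<and> A \<in> sets M \<and> open U \<and> E \<subseteq> U \<and> U \<subseteq> A \<and> emeasure M A \<le> ennreal \<epsilon>"
    using AU by blast
qed

section \<open>The four capacities that control the Hausdorff measure\<close>

lemma superlevel_measurable:
  assumes "u \<in> borel_measurable (restrict_space M \<Omega>)" "\<Omega> \<in> sets M"
  shows "{x\<in>\<Omega>. ereal t < u x} \<in> sets M"
proof -
  have "{x \<in> space (restrict_space M \<Omega>). ereal t < u x} \<in> sets (restrict_space M \<Omega>)"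
    using assms(1) by measurable
  then show ?thesis using assms(2) by (auto simp: space_restrict_space sets_restrict_space_iff)
qed

lemma Cap_BVO_zero:
  assumes E: "E \<subseteq> ball x0 R" and cap: "Cap_BVO M E = 0"
  shows "codim1_hausdorff (emeasure M) E = 0"
proof (rule hausdorff_zero[OF E])
  fix \<epsilon> :: real assume \<epsilon>: "0 < \<epsilon>"
  \<comment> \<open>\<open>coarea\<close> multiplies the variation by 3, and Chebyshev's inequality
    at a level above 1/4 multiplies the L1 norm by 4; both results have to stay below
    \<epsilon>.\<close>
  have "Cap_BVO M E < ennreal (\<epsilon> / 4)" using cap \<epsilon> by simp
  then obtain u where u: "BV M UNIV u" "one_near E UNIV u"
    and lt: "(\<integral>\<^sup>+x. e2ennreal \<bar>u x\<bar> \<partial>M) + total_variation M UNIV u < ennreal (\<epsilon> / 4)"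
    unfolding Cap_BVO_def INF_less_iff by auto
  have um: "u \<in> borel_measurable (restrict_space M UNIV)" using u(1) by (simp add: BV_def L1_on_def)
  have "total_variation M UNIV u < ennreal (\<epsilon> / 4)"
    using lt by (rule le_less_trans[rotated]) simp
  then have "approx_var M UNIV u (ennreal (\<epsilon> / 4))" by (rule total_variation_approx_var)
  then obtain t where t: "1/4 < t" "t < 3/4" "approx_per M UNIV {x\<in>UNIV. ereal t < u x} (ennreal (3 * (\<epsilon> / 4)))"
    by (rule coarea) (use \<epsilon> um in auto)
  let ?A = "{x\<in>UNIV. ereal t < u x}"
  obtain U where U: "open U" "E \<subseteq> U" "\<And>x. x \<in> U \<Longrightarrow> u x = 1" using u(2) by (auto simp: one_near_def)
  have A: "?A \<in> sets M" using superlevel_measurable[OF um, of t] by simp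
  have "emeasure M ?A = (\<integral>\<^sup>+x. indicator ?A x \<partial>M)" using A by simp
  also have "\<dots> \<le> (\<integral>\<^sup>+x. 4 * e2ennreal \<bar>u x\<bar> \<partial>M)"
  proof (rule nn_integral_mono)
    fix x
    show "indicator ?A x \<le> 4 * e2ennreal \<bar>u x\<bar>"
    proof (cases "x \<in> ?A")
      case True
      then have "ereal (1/4) \<le> \<bar>u x\<bar>" using t(1) by (cases "u x") auto
      then have "ennreal (1/4) \<le> e2ennreal \<bar>u x\<bar>" using e2ennreal_mono by fastforce
      then have "4 * ennreal (1/4) \<le> 4 * e2ennreal \<bar>u x\<bar>" by (rule mult_left_mono) simp
      moreover have "4 * ennreal (1/4) = ennreal (4 * (1/4))" by (simp only: ennreal_mult' ennreal_numeral)
      ultimately show ?thesis using True by simp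
    qed simp
  qed
  also have "\<dots> = 4 * (\<integral>\<^sup>+x. e2ennreal \<bar>u x\<bar> \<partial>M)"
  proof (rule nn_integral_cmult)
    have "u \<in> borel_measurable M" using um using borel_measurable_restrict_space_iff_ereal[of UNIV M u] by simp
    then show "(\<lambda>x. e2ennreal \<bar>u x\<bar>) \<in> borel_measurable M" by measurable
  qed
  also have "\<dots> \<le> 4 * ennreal (\<epsilon> / 4)"
  proof (rule mult_left_mono)
    show "(\<integral>\<^sup>+x. e2ennreal \<bar>u x\<bar> \<partial>M) \<le> ennreal (\<epsilon> / 4)"
      by (rule order_trans[OF _ less_imp_le[OF lt]]) simp
  qed simp
  also have "\<dots> = ennreal (4 * (\<epsilon> / 4))" by (simp only: ennreal_mult' ennreal_numeral)
  finally have mA: "emeasure M ?A \<le> ennreal \<epsilon>" by simp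
  have "approx_per M UNIV ?A (ennreal \<epsilon>)"
  proof -
    have "ennreal (3 * (\<epsilon> / 4)) \<le> ennreal \<epsilon>" using \<epsilon> by (intro ennreal_leI) simp
    then show ?thesis using t(3) unfolding approx_per_def by (meson order_trans)
  qed
  moreover have "U \<subseteq> ?A" using U(3) t(2) by auto
  ultimately show "\<exists>A U. approx_per M UNIV A (ennreal \<epsilon>) \<and> A \<in> sets M \<and> open U \<and> E \<subseteq> U \<and> U \<subseteq> A \<and> emeasure M A \<le> ennreal \<epsilon>"
    using A U mA by blast
qed

lemma rel_cap_BVO_zero:
  assumes s: "0 < s" "ball y s \<inter> ball x0 (2 * R) = {}" and R: "0 < R" and E: "E \<subseteq> ball x0 R"
    and cap: "rel_cap_BVO M E (ball x0 (2 * R)) = 0"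
  shows "codim1_hausdorff (emeasure M) E = 0"
proof (rule hausdorff_zero_bounded[OF s R E])
  let ?\<Omega> = "ball x0 (2 * R)"
  fix \<epsilon> :: real assume \<epsilon>: "0 < \<epsilon>"
  \<comment> \<open>\<open>coarea\<close> triples this amount, and the remaining quarter of
    \<epsilon> is spent on the extension by zero.\<close>
  have "rel_cap_BVO M E ?\<Omega> < ennreal (\<epsilon> / 4)" using cap \<epsilon> by simp
  then obtain u where u: "BV M ?\<Omega> u" "one_near E ?\<Omega> u" "compact_support_in ?\<Omega> u"
    and lt: "total_variation M ?\<Omega> u < ennreal (\<epsilon> / 4)"
    unfolding rel_cap_BVO_def INF_less_iff by auto
  have um: "u \<in> borel_measurable (restrict_space M ?\<Omega>)" using u(1) by (simp add: BV_def L1_on_def)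
  obtain t where t: "1/4 < t" "t < 3/4" "approx_per M ?\<Omega> {x\<in>?\<Omega>. ereal t < u x} (ennreal (3 * (\<epsilon> / 4)))"
    using coarea[OF total_variation_approx_var[OF lt] open_ball _ um] \<epsilon> by auto
  let ?A = "{x\<in>?\<Omega>. ereal t < u x}"
  define K where "K = closure {x\<in>?\<Omega>. u x \<noteq> 0}"
  have K: "compact K" "K \<subseteq> ?\<Omega>" using u(3) by (auto simp: compact_support_in_def K_def)
  have "?A \<subseteq> {x\<in>?\<Omega>. u x \<noteq> 0}" using t(1) by auto
  then have AK: "?A \<subseteq> K" unfolding K_def using closure_subset by blast
  have A: "?A \<in> sets M" using superlevel_measurable[OF um, of t] by simp
  obtain U where U: "open U" "E \<subseteq> U" "U \<subseteq> ?\<Omega>" "\<And>x. x \<in> U \<Longrightarrow> u x = 1" using u(2) by (auto simp: one_near_def)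
  have "approx_per M UNIV ?A (ennreal (3 * (\<epsilon> / 4) + \<epsilon> / 4))"
    using \<epsilon> by (intro approx_per_zero_extension[OF t(3) open_ball K A AK]) auto
  then have "approx_per M UNIV ?A (ennreal \<epsilon>)" by simp
  moreover have "U \<subseteq> ?A" using U(3,4) t(2) by auto
  ultimately show "\<exists>A U. approx_per M UNIV A (ennreal \<epsilon>) \<and> A \<in> sets M \<and> open U \<and> E \<subseteq> U \<and> U \<subseteq> A \<and> A \<subseteq> ?\<Omega>"
    using A U by blast
qed

text \<open>The weight \<rho> is only measurable with respect to \<open>M\<close>, as
  \<open>\<bar>u\<bar>\<close> is in \<open>Cap1_zero\<close>; so the condition on curves is tested
  on Borel functions \<open>h\<close> above it.\<close>

lemma hausdorff_zero_of_curves: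
  assumes s: "0 < s" "ball y s \<inter> ball x0 (2 * R) = {}" and R: "0 < R" and E: "E \<subseteq> ball x0 R"
    and \<rho>: "\<And>\<epsilon>. 0 < \<epsilon> \<Longrightarrow> \<exists>\<rho>\<in>borel_measurable M. (\<integral>\<^sup>+x\<in>ball x0 (3 * R). \<rho> x \<partial>M) \<le> ennreal \<epsilon> \<and>
      (\<forall>a b \<gamma> h. (a, b, \<gamma>) \<in> paths_in UNIV \<longrightarrow> \<gamma> a \<in> E \<longrightarrow> \<gamma> b \<notin> ball x0 (2 * R) \<longrightarrow>
        \<gamma> ` {a..b} \<subseteq> cball x0 (2 * R) \<longrightarrow> h \<in> borel_measurable borel \<longrightarrow>
        (\<forall>x\<in>cball x0 (2 * R). \<rho> x \<le> h x) \<longrightarrow> 1 \<le> line_integral (a, b, \<gamma>) h)"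
  shows "codim1_hausdorff (emeasure M) E = 0"
proof (rule hausdorff_zero_bounded[OF s R E])
  fix \<epsilon> :: real assume \<epsilon>: "0 < \<epsilon>"
  \<comment> \<open>\<open>chain_approx\<close> adds another sixth of \<epsilon>, and
    \<open>coarea\<close> triples the sum.\<close>
  then obtain \<rho> where \<rho>: "\<rho> \<in> borel_measurable M" "(\<integral>\<^sup>+x\<in>ball x0 (3 * R). \<rho> x \<partial>M) \<le> ennreal (\<epsilon> / 6)"
    and H: "\<And>a b \<gamma> h. (a, b, \<gamma>) \<in> paths_in UNIV \<Longrightarrow> \<gamma> a \<in> E \<Longrightarrow> \<gamma> b \<notin> ball x0 (2 * R) \<Longrightarrow>
        \<gamma> ` {a..b} \<subseteq> cball x0 (2 * R) \<Longrightarrow> h \<in> borel_measurable borel \<Longrightarrow>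
        (\<forall>x\<in>cball x0 (2 * R). \<rho> x \<le> h x) \<Longrightarrow> 1 \<le> line_integral (a, b, \<gamma>) h"
    using \<rho>[of "\<epsilon> / 6"] by auto
  have E2: "E \<subseteq> ball x0 (2 * R)" using E subset_ball[of R "2 * R" x0] R by auto
  obtain u where u: "approx_var M UNIV (\<lambda>x. ereal (u x)) (ennreal (\<epsilon> / 6 + \<epsilon> / 6))"
    "\<And>t. open {x. t < u x}" "\<And>x. x \<in> E \<Longrightarrow> u x = 1" "\<And>x. x \<notin> ball x0 (2 * R) \<Longrightarrow> u x = 0"
    "u \<in> borel_measurable M"
  proof (rule chain_approx[OF \<rho> _ _ R E2 H, where e = "\<epsilon> / 6"])
  qed (use \<epsilon> that in auto)
  obtain t where t: "1/4 < t" "t < 3/4" "approx_per M UNIV {x\<in>UNIV. ereal t < ereal (u x)} (ennreal (3 * (\<epsilon> / 6 + \<epsilon> / 6)))"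
  proof (rule coarea[OF u(1) open_UNIV])
    show "(\<lambda>x. ereal (u x)) \<in> borel_measurable (restrict_space M UNIV)"
      using u(5) by (intro measurable_restrict_space1) measurable
  qed (use \<epsilon> in auto)
  have "approx_per M UNIV {x. t < u x} (ennreal \<epsilon>)" using t(3) by simp
  moreover have "E \<subseteq> {x. t < u x}" using u(3) t(2) by auto
  moreover have "{x. t < u x} \<subseteq> ball x0 (2 * R)" using u(4) t(1) by force
  ultimately show "\<exists>A U. approx_per M UNIV A (ennreal \<epsilon>) \<and> A \<in> sets M \<and> open U \<and> E \<subseteq> U \<and> U \<subseteq> A \<and> A \<subseteq> ball x0 (2 * R)"
    using u(2)[of t] by (intro exI[of _ "{x. t < u x}"] conjI) auto
qed

text \<open>A competitor for the total capacity need not vanish outside 2B. But along a curve from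
  \<open>E\<close> out of 2B, either \<open>\<bar>u\<bar>\<close> drops below 1/2 (or becomes
  infinite), so that \<open>g\<close> integrates to at least 1/2, or \<open>\<bar>u\<bar>\<close> is
  at least 1/2 over a length of at least \<open>R\<close>. The weight \<rho> combines
  \<open>\<bar>u\<bar>\<close> and \<open>g\<close> to cover both cases.\<close>

lemma Cap1_zero:
  assumes s: "0 < s" "ball y s \<inter> ball x0 (2 * R) = {}" and R: "0 < R" and E: "E \<subseteq> ball x0 R"
    and cap: "Cap1 M E = 0"
  shows "codim1_hausdorff (emeasure M) E = 0"
proof (rule hausdorff_zero_of_curves[OF s R E])
  fix \<epsilon> :: real assume \<epsilon>: "0 < \<epsilon>"
  \<comment> \<open>The factor 2 normalizes the case of a drop by 1/2, and \<open>2 / R\<close> the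
    case of height 1/2 over length \<open>R\<close>.\<close>
  define c where "c = 2 + 2 / R"
  have c: "2 \<le> c" "2 / R \<le> c" using R by (auto simp: c_def)
  have "Cap1 M E < ennreal (\<epsilon> / c)" using cap \<epsilon> c by simp
  then obtain u g where u: "N11 M UNIV u" "upper_gradient UNIV u g" "\<And>x. x \<in> E \<Longrightarrow> u x = 1"
    and lt: "(\<integral>\<^sup>+x. (e2ennreal \<bar>u x\<bar> + g x) \<partial>M) < ennreal (\<epsilon> / c)"
    unfolding Cap1_def INF_less_iff by auto
  have um [measurable]: "u \<in> borel_measurable M"
    using u(1) borel_measurable_restrict_space_iff_ereal[of UNIV M u] by (simp add: N11_def L1_on_def)
  have gb: "g \<in> borel_measurable borel"
    using upper_gradient_measurable[OF u(2)] borel_measurable_restrict_space_iff_ennreal[of UNIV borel g] by simp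
  have gm [measurable]: "g \<in> borel_measurable M" by (rule borel_measurable_M[OF gb])
  define \<rho> where "\<rho> x = ennreal c * (e2ennreal \<bar>u x\<bar> + g x)" for x
  have "\<rho> \<in> borel_measurable M" unfolding \<rho>_def by measurable
  moreover have "(\<integral>\<^sup>+x\<in>ball x0 (3 * R). \<rho> x \<partial>M) \<le> ennreal \<epsilon>"
  proof -
    have "(\<integral>\<^sup>+x\<in>ball x0 (3 * R). \<rho> x \<partial>M) \<le> (\<integral>\<^sup>+x. ennreal c * (e2ennreal \<bar>u x\<bar> + g x) \<partial>M)"
      by (intro nn_integral_mono) (auto simp: \<rho>_def indicator_def)
    also have "\<dots> = ennreal c * (\<integral>\<^sup>+x. (e2ennreal \<bar>u x\<bar> + g x) \<partial>M)" by (rule nn_integral_cmult) measurable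
    also have "\<dots> \<le> ennreal c * ennreal (\<epsilon> / c)" by (rule mult_left_mono[OF less_imp_le[OF lt]]) simp
    also have "\<dots> = ennreal \<epsilon>" using c \<epsilon> by (simp flip: ennreal_mult)
    finally show ?thesis .
  qed
  moreover have "1 \<le> line_integral (a, b, \<gamma>) h"
    if p: "(a, b, \<gamma>) \<in> paths_in UNIV" and ab: "\<gamma> a \<in> E" "\<gamma> b \<notin> ball x0 (2 * R)" and im: "\<gamma> ` {a..b} \<subseteq> cball x0 (2 * R)"
      and h: "\<forall>x\<in>cball x0 (2 * R). \<rho> x \<le> h x" for a b \<gamma> h
  proof -
    interpret rect_path a b \<gamma> using p by (rule paths_in_rect_path)
    have ua: "u (\<gamma> a) = 1" by (rule u(3)[OF ab(1)])
    have h\<rho>: "\<rho> x \<le> h x" if "x \<in> \<gamma> ` {a..b}" for x using h im that by blast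
    show ?thesis
    proof (cases "\<exists>z\<in>{a..b}. \<bar>u (\<gamma> z)\<bar> = \<infinity> \<or> \<bar>u (\<gamma> z)\<bar> < ereal (1/2)")
      case True
      then obtain z where z: "z \<in> {a..b}" "\<bar>u (\<gamma> z)\<bar> = \<infinity> \<or> \<bar>u (\<gamma> z)\<bar> < ereal (1/2)"
        by (rule bexE)
      have ne: "\<gamma> a \<noteq> \<gamma> z"
      proof
        assume "\<gamma> a = \<gamma> z"
        then have "u (\<gamma> z) = 1" using ua by (simp only:)
        then show False using z(2) by (simp add: one_ereal_def)
      qed
      have pz: "(a, z, \<gamma>) \<in> paths_in UNIV" using z(1) by (intro paths_in_sub[OF p _ _ _ ne]) simp_all
      have ineq: "upper_gradient_inequality u g (a, z, \<gamma>)" using u(2) pz unfolding upper_gradient_def by (elim conjE bspec)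
      have "ennreal (1/2) \<le> line_integral (a, z, \<gamma>) g"
      proof (cases "\<bar>u (\<gamma> z)\<bar> = \<infinity>")
        case True
        then have "line_integral (a, z, \<gamma>) g = \<infinity>" using ineq by (simp add: upper_gradient_inequality_def)
        then show ?thesis by simp
      next
        case False
        then obtain q where q: "u (\<gamma> z) = ereal q" by (cases "u (\<gamma> z)") auto
        then have "\<bar>q\<bar> < 1/2" using z(2) by auto
        then have "1/2 \<le> \<bar>1 - q\<bar>" by linarith
        then have "ennreal (1/2) \<le> ennreal \<bar>1 - q\<bar>" by (rule ennreal_leI)
        also have "\<dots> \<le> line_integral (a, z, \<gamma>) g"
          using ineq q ua e2ennreal_abs_diff[of 1 q] by (simp add: upper_gradient_inequality_def one_ereal_def)
        finally show ?thesis .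
      qed
      also have "\<dots> \<le> line_integral (a, b, \<gamma>) (\<lambda>x. g x * indicator UNIV x)"
        using z(1) by (intro line_integral_sub[of a z UNIV UNIV] measurable_restrict_space1 gb) auto
      finally have half: "ennreal (1/2) \<le> line_integral (a, b, \<gamma>) g" by simp
      have "1 = ennreal 2 * ennreal (1/2)" by (subst ennreal_mult[symmetric]) auto
      also have "\<dots> \<le> ennreal 2 * line_integral (a, b, \<gamma>) g" by (rule mult_left_mono[OF half]) simp
      also have "\<dots> = line_integral (a, b, \<gamma>) (\<lambda>x. ennreal 2 * g x)"
        unfolding line_integral_eq mult.assoc
        by (rule nn_integral_cmult[symmetric])
          (rule measurable_arclength_lborel[OF subset_UNIV upper_gradient_measurable[OF u(2)]])
      also have "\<dots> \<le> line_integral (a, b, \<gamma>) h"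
      proof (rule line_integral_mono)
        fix x assume x: "x \<in> \<gamma> ` {a..b}"
        have "ennreal 2 * g x \<le> \<rho> x" unfolding \<rho>_def using c by (intro mult_mono ennreal_leI) auto
        then show "ennreal 2 * g x \<le> h x" using h\<rho>[OF x] by (rule order_trans)
      qed
      finally show ?thesis .
    next
      case False
      have "ennreal (1 / R) \<le> h x" if x: "x \<in> \<gamma> ` {a..b}" for x
      proof -
        have "ereal (1/2) \<le> \<bar>u x\<bar>" using False x by (auto simp: not_less)
        then have "ennreal (1/2) \<le> e2ennreal \<bar>u x\<bar>" using e2ennreal_mono by fastforce
        then have "ennreal (2 / R) * ennreal (1/2) \<le> \<rho> x"
          unfolding \<rho>_def using c by (intro mult_mono ennreal_leI) (auto intro: add_increasing2)
        moreover have "ennreal (2 / R) * ennreal (1/2) = ennreal (1 / R)"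
          using R by (subst ennreal_mult[symmetric]) auto
        ultimately show ?thesis using h\<rho>[OF x] by simp
      qed
      then have lower: "line_integral (a, b, \<gamma>) (\<lambda>_. ennreal (1 / R)) \<le> line_integral (a, b, \<gamma>) h"
        by (rule line_integral_mono)
      have const: "line_integral (a, b, \<gamma>) (\<lambda>_. ennreal (1 / R)) = ennreal (1 / R * len b)"
        unfolding line_integral_const using R len_mono[of a b] le by (subst ennreal_mult) auto
      have "R \<le> len b"
      proof -
        have "dist x0 (\<gamma> a) < R" using ab(1) E by auto
        moreover have "2 * R \<le> dist x0 (\<gamma> b)" using ab(2) by simp
        ultimately have "R \<le> dist (\<gamma> a) (\<gamma> b)" using dist_triangle[of x0 "\<gamma> b" "\<gamma> a"] by linarith
        then show ?thesis using dist_le_len[of a b] le by simp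
      qed
      then have "1 \<le> 1 / R * len b" using R by (simp add: le_divide_eq)
      then have "1 \<le> ennreal (1 / R * len b)" by simp
      then show ?thesis unfolding const[symmetric] using lower by (rule order_trans)
    qed
  qed
  ultimately show "\<exists>\<rho>\<in>borel_measurable M. (\<integral>\<^sup>+x\<in>ball x0 (3 * R). \<rho> x \<partial>M) \<le> ennreal \<epsilon> \<and>
      (\<forall>a b \<gamma> h. (a, b, \<gamma>) \<in> paths_in UNIV \<longrightarrow> \<gamma> a \<in> E \<longrightarrow> \<gamma> b \<notin> ball x0 (2 * R) \<longrightarrow>
        \<gamma> ` {a..b} \<subseteq> cball x0 (2 * R) \<longrightarrow> h \<in> borel_measurable borel \<longrightarrow>
        (\<forall>x\<in>cball x0 (2 * R). \<rho> x \<le> h x) \<longrightarrow> 1 \<le> line_integral (a, b, \<gamma>) h)" by blast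
qed

text \<open>A curve from \<open>E\<close> out of \<open>2B\<close> leaves the compact support of an admissible function before it leaves
  \<open>2B\<close>.\<close>

lemma rel_cap1_zero:
  assumes s: "0 < s" "ball y s \<inter> ball x0 (2 * R) = {}" and R: "0 < R" and E: "E \<subseteq> ball x0 R"
    and cap: "rel_cap1 M E (ball x0 (2 * R)) = 0"
  shows "codim1_hausdorff (emeasure M) E = 0"
proof (rule hausdorff_zero_of_curves[OF s R E])
  let ?\<Omega> = "ball x0 (2 * R)"
  fix \<epsilon> :: real assume \<epsilon>: "0 < \<epsilon>"
  have "rel_cap1 M E ?\<Omega> < ennreal \<epsilon>" using cap \<epsilon> by simp
  then obtain u g where u: "upper_gradient ?\<Omega> u g" "\<And>x. x \<in> E \<Longrightarrow> u x = 1" "compact_support_in ?\<Omega> u"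
    and lt: "(\<integral>\<^sup>+x\<in>?\<Omega>. g x \<partial>M) < ennreal \<epsilon>"
    unfolding rel_cap1_def INF_less_iff by auto
  define \<rho> where "\<rho> x = g x * indicator ?\<Omega> x" for x
  define K where "K = closure {x\<in>?\<Omega>. u x \<noteq> 0}"
  have K: "closed K" "K \<subseteq> ?\<Omega>" using u(3) by (auto simp: compact_support_in_def K_def)
  have u0: "u x = 0" if "x \<in> ?\<Omega>" "x \<notin> K" for x
    using that closure_subset[of "{x\<in>?\<Omega>. u x \<noteq> 0}"] unfolding K_def by blast
  have "\<rho> \<in> borel_measurable M"
    using upper_gradient_measurable[OF u(1)] borel_measurable_restrict_space_iff_ennreal[of ?\<Omega> borel g]
    unfolding \<rho>_def by (intro borel_measurable_M) simp
  moreover have "(\<integral>\<^sup>+x\<in>ball x0 (3 * R). \<rho> x \<partial>M) \<le> ennreal \<epsilon>"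
  proof -
    have "(\<integral>\<^sup>+x\<in>ball x0 (3 * R). \<rho> x \<partial>M) \<le> (\<integral>\<^sup>+x\<in>?\<Omega>. g x \<partial>M)"
      by (intro nn_integral_mono) (auto simp: \<rho>_def indicator_def)
    then show ?thesis using lt by simp
  qed
  moreover have "1 \<le> line_integral (a, b, \<gamma>) h"
    if p: "(a, b, \<gamma>) \<in> paths_in UNIV" and ab: "\<gamma> a \<in> E" "\<gamma> b \<notin> ?\<Omega>" and hb: "h \<in> borel_measurable borel"
      and h: "\<forall>x\<in>cball x0 (2 * R). \<rho> x \<le> h x" for a b \<gamma> h
  proof -
    interpret rect_path a b \<gamma> using p by (rule paths_in_rect_path)
    have a\<Omega>: "\<gamma> a \<in> ?\<Omega>" using ab(1) E subset_ball[of R "2 * R" x0] R by auto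
    have f: "continuous_on {a..b} (\<lambda>r. dist x0 (\<gamma> r))" by (intro continuous_intros cont)
    define T where "T = {r\<in>{a..b}. 2 * R \<le> dist x0 (\<gamma> r)}"
    have "closed T"
    proof -
      have "T = {a..b} \<inter> (\<lambda>r. dist x0 (\<gamma> r)) -` {2 * R..}" by (auto simp: T_def)
      then show ?thesis using continuous_closed_preimage[OF f, of "{2 * R..}"] by simp
    qed
    then have "compact T" unfolding compact_eq_bounded_closed
      by (auto simp: T_def intro!: bounded_subset[OF bounded_closed_interval[of a b]])
    moreover have "b \<in> T" using ab(2) le by (simp add: T_def)
    ultimately obtain t where t: "t \<in> T" "\<And>r. r \<in> T \<Longrightarrow> t \<le> r"
      using compact_attains_inf[of T] by blast
    have tb: "a \<le> t" "t \<le> b" "\<gamma> t \<notin> ?\<Omega>" using t(1) by (auto simp: T_def)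
    have "t \<noteq> a" using tb(3) a\<Omega> by auto
    then have at: "a < t" using tb(1) by simp
    have before: "\<gamma> r \<in> ?\<Omega>" if "r \<in> {a..<t}" for r
      using t(2)[of r] that tb(2) by (force simp: T_def)
    have "\<gamma> t \<in> - K" using tb(3) K(2) by blast
    then obtain d where d: "0 < d" "ball (\<gamma> t) d \<subseteq> - K" using K(1) by (meson open_Compl open_contains_ball)
    obtain e where e: "0 < e" "\<And>r. r \<in> {a..b} \<Longrightarrow> dist r t < e \<Longrightarrow> dist (\<gamma> r) (\<gamma> t) < d"
      using cont d(1) tb(1,2) unfolding continuous_on_iff by (metis atLeastAtMost_iff)
    \<comment> \<open>A time shortly before the first exit \<open>t\<close>: the curve is still in
      2B, but so close to \<open>\<gamma> t\<close> that it has left \<open>K\<close>, and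
      \<open>u\<close> is 0 there.\<close>
    define r where "r = max a (t - e / 2)"
    have r: "a \<le> r" "r < t" "dist r t < e" using at e(1) by (auto simp: r_def dist_real_def max_def)
    have rb: "r \<le> b" using r tb by simp
    have "\<gamma> r \<in> - K"
    proof (rule subsetD[OF d(2)])
      show "\<gamma> r \<in> ball (\<gamma> t) d" using e(2)[of r] r rb by (simp add: dist_commute)
    qed
    then have ur: "u (\<gamma> r) = 0" using before[of r] r by (intro u0) auto
    have ua: "u (\<gamma> a) = 1" by (rule u(2)[OF ab(1)])
    have sub: "\<gamma> ` {a..r} \<subseteq> ?\<Omega>"
    proof (rule image_subsetI)
      show "\<gamma> q \<in> ?\<Omega>" if "q \<in> {a..r}" for q using before[of q] that r(2) by simp
    qed
    have "(a, r, \<gamma>) \<in> paths_in ?\<Omega>"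
      using ur ua by (intro paths_in_sub[OF p order_refl r(1) rb _ sub]) auto
    then have "upper_gradient_inequality u g (a, r, \<gamma>)" using u(1) by (auto simp: upper_gradient_def)
    then have "1 \<le> line_integral (a, r, \<gamma>) g"
      using ur ua e2ennreal_abs_diff[of 1 0]
      by (simp add: upper_gradient_inequality_def one_ereal_def zero_ereal_def)
    also have "\<dots> \<le> line_integral (a, r, \<gamma>) h"
    proof -
      interpret S: rect_path a r \<gamma> using r rb by (intro sub_path) auto
      show ?thesis
      proof (rule S.line_integral_mono)
        fix x assume "x \<in> \<gamma> ` {a..r}"
        then have "x \<in> ?\<Omega>" using sub by blast
        then show "g x \<le> h x" using h[rule_format, of x] by (simp add: \<rho>_def)
      qed
    qed
    also have "\<dots> \<le> line_integral (a, b, \<gamma>) (\<lambda>x. h x * indicator UNIV x)"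
      using r rb by (intro line_integral_sub[of a r UNIV UNIV] measurable_restrict_space1 hb) auto
    finally show ?thesis by simp
  qed
  ultimately show "\<exists>\<rho>\<in>borel_measurable M. (\<integral>\<^sup>+x\<in>ball x0 (3 * R). \<rho> x \<partial>M) \<le> ennreal \<epsilon> \<and>
      (\<forall>a b \<gamma> h. (a, b, \<gamma>) \<in> paths_in UNIV \<longrightarrow> \<gamma> a \<in> E \<longrightarrow> \<gamma> b \<notin> ball x0 (2 * R) \<longrightarrow>
        \<gamma> ` {a..b} \<subseteq> cball x0 (2 * R) \<longrightarrow> h \<in> borel_measurable borel \<longrightarrow>
        (\<forall>x\<in>cball x0 (2 * R). \<rho> x \<le> h x) \<longrightarrow> 1 \<le> line_integral (a, b, \<gamma>) h)" by blast
qed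

end

section \<open>From vanishing Hausdorff measure to vanishing capacity\<close>

lemma upper_gradient_max:
  assumes u: "upper_gradient \<Omega> (\<lambda>x. ereal (v x)) g" and u': "upper_gradient \<Omega> (\<lambda>x. ereal (v' x)) g"
  shows "upper_gradient \<Omega> (\<lambda>x. ereal (max (v x) (v' x))) g"
  unfolding upper_gradient_real_iff
proof (intro conjI allI impI upper_gradient_measurable[OF u])
  fix a b \<gamma> assume p: "(a, b, \<gamma>) \<in> paths_in \<Omega>"
  have "\<bar>max (v (\<gamma> a)) (v' (\<gamma> a)) - max (v (\<gamma> b)) (v' (\<gamma> b))\<bar> \<le> \<bar>v (\<gamma> a) - v (\<gamma> b)\<bar> \<or>
      \<bar>max (v (\<gamma> a)) (v' (\<gamma> a)) - max (v (\<gamma> b)) (v' (\<gamma> b))\<bar> \<le> \<bar>v' (\<gamma> a) - v' (\<gamma> b)\<bar>"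
    by (auto simp: max_def)
  then show "ennreal \<bar>max (v (\<gamma> a)) (v' (\<gamma> a)) - max (v (\<gamma> b)) (v' (\<gamma> b))\<bar> \<le> line_integral (a, b, \<gamma>) g"
    using upper_gradient_realD[OF u p] upper_gradient_realD[OF u' p] by (meson ennreal_leI order_trans)
qed

lemma upper_gradient_limit:
  assumes u: "\<And>n::nat. upper_gradient \<Omega> (\<lambda>x. ereal (v n x)) g" and lim: "\<And>x. x \<in> \<Omega> \<Longrightarrow> (\<lambda>n. v n x) \<longlonglongrightarrow> u x"
  shows "upper_gradient \<Omega> (\<lambda>x. ereal (u x)) g"
  unfolding upper_gradient_real_iff
proof (intro conjI allI impI upper_gradient_measurable[OF u])
  fix a b \<gamma> assume p: "(a, b, \<gamma>) \<in> paths_in \<Omega>"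
  then have ab: "\<gamma> a \<in> \<Omega>" "\<gamma> b \<in> \<Omega>" by (auto simp: paths_in_def)
  have "(\<lambda>n. ennreal \<bar>v n (\<gamma> a) - v n (\<gamma> b)\<bar>) \<longlonglongrightarrow> ennreal \<bar>u (\<gamma> a) - u (\<gamma> b)\<bar>"
    by (intro tendsto_ennrealI tendsto_intros lim ab)
  then show "ennreal \<bar>u (\<gamma> a) - u (\<gamma> b)\<bar> \<le> line_integral (a, b, \<gamma>) g"
    by (rule LIMSEQ_le_const2) (use upper_gradient_realD[OF u p] in auto)
qed

lemma lipschitz_on_max:
  fixes v v' :: "'a::metric_space \<Rightarrow> real"
  assumes "L-lipschitz_on S v" "L'-lipschitz_on S v'"
  shows "(max L L')-lipschitz_on S (\<lambda>x. max (v x) (v' x))"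
proof (rule lipschitz_onI)
  fix x y assume xy: "x \<in> S" "y \<in> S"
  have "\<bar>v x - v y\<bar> \<le> max L L' * dist x y" "\<bar>v' x - v' y\<bar> \<le> max L L' * dist x y"
    using lipschitz_onD[OF assms(1) xy] lipschitz_onD[OF assms(2) xy]
      mult_right_mono[of L "max L L'" "dist x y"] mult_right_mono[of L' "max L L'" "dist x y"]
    by (auto simp: dist_real_def)
  then show "dist (max (v x) (v' x)) (max (v y) (v' y)) \<le> max L L' * dist x y"
    by (auto simp: dist_real_def max_def)
qed (use lipschitz_on_nonneg[OF assms(1)] in auto)

section \<open>Maxima of bumps over fine covers\<close>

primrec partial_max :: "(nat \<Rightarrow> 'a \<Rightarrow> real) \<Rightarrow> nat \<Rightarrow> 'a \<Rightarrow> real" where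
  "partial_max w 0 x = 0"
| "partial_max w (Suc n) x = max (partial_max w n x) (w n x)"

lemma partial_max_nonneg: "0 \<le> partial_max w n x"
  by (induction n) auto

lemma partial_max_mono: "partial_max w n x \<le> partial_max w (Suc n) x"
  by simp

lemma partial_max_le: "(\<And>i. w i x \<le> c) \<Longrightarrow> 0 \<le> c \<Longrightarrow> partial_max w n x \<le> c"
  by (induction n) auto

context doubling_space
begin

text \<open>Collects what a competitor must satisfy for total and relative, Sobolev and BV
  capacities at once. The Lipschitz functions \<open>v n\<close> share the gradient \<open>g\<close>
  with their limit, so the integral of \<open>g\<close> also bounds the total variation.\<close>

definition small_bump :: "'a set \<Rightarrow> 'a \<Rightarrow> real \<Rightarrow> real \<Rightarrow> ('a \<Rightarrow> real) \<Rightarrow> ('a \<Rightarrow> ennreal) \<Rightarrow> bool" where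
  "small_bump E x0 R \<epsilon> u g \<longleftrightarrow> u \<in> borel_measurable M \<and> (\<forall>x. 0 \<le> u x) \<and> (\<forall>x. u x \<noteq> 0 \<longrightarrow> x \<in> cball x0 (3 / 2 * R)) \<and>
     (\<exists>U. open U \<and> E \<subseteq> U \<and> U \<subseteq> ball x0 (2 * R) \<and> (\<forall>x\<in>U. u x = 1)) \<and>
     upper_gradient UNIV (\<lambda>x. ereal (u x)) g \<and> (\<integral>\<^sup>+x. (ennreal (u x) + g x) \<partial>M) \<le> ennreal \<epsilon> \<and>
     (\<exists>v. (\<forall>n. (\<exists>L. L-lipschitz_on UNIV (v n)) \<and> upper_gradient UNIV (\<lambda>x. ereal (v n x)) g) \<and>
       L1_loc_tendsto M UNIV v (\<lambda>x. ereal (u x)))"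

text \<open>The sum \<open>G\<close> of the gradients of all bumps is an upper gradient of every
  finite maximum and, by pointwise convergence, of the supremum. Its integral is bounded by the sum
  that defines the content. Because the radii are at most 1, \<open>G\<close> dominates
  \<open>u\<close> as well, which settles the L1 norm.\<close>

lemma small_bump_exists:
  assumes R: "0 < R" and E: "E \<subseteq> ball x0 R" and H: "codim1_hausdorff (emeasure M) E = 0" and \<epsilon>: "0 < \<epsilon>"
  obtains u g where "small_bump E x0 R \<epsilon> u g"
proof -
  \<comment> \<open>Radii at most 1 give \<open>u \<le> G\<close>. Radii at most
    \<open>R / 8\<close> keep the bumps, which reach at most three radii beyond \<open>E\<close>,
    inside the ball of radius \<open>3 / 2 * R\<close>.\<close>
  define \<delta> where "\<delta> = min 1 (R / 8)"
  have \<delta>: "0 < \<delta>" "\<delta> \<le> 1" "\<delta> \<le> R / 8" using R by (auto simp: \<delta>_def)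
  \<comment> \<open>The factor 2 is for \<open>u\<close> and \<open>G\<close> together;
    \<open>CD ^ 2\<close> compares a ball with the one of four times its radius, which contains the
    closed ball of radius \<open>2 * r i\<close> that supports a bump.\<close>
  define \<epsilon>' where "\<epsilon>' = \<epsilon> / (2 * CD ^ 2)"
  have CD: "0 < CD" using CD_ge_1 by simp
  have \<epsilon>': "0 < \<epsilon>'" "2 * (CD ^ 2 * \<epsilon>') = \<epsilon>" using \<epsilon> CD by (auto simp: \<epsilon>'_def)
  have "codim1_content (emeasure M) \<delta> E \<le> codim1_hausdorff (emeasure M) E"
    unfolding codim1_hausdorff_eq_SUP using \<delta> by (intro SUP_upper) simp
  then have "codim1_content (emeasure M) \<delta> E < ennreal \<epsilon>'" using H \<epsilon>' by simp
  then obtain I z r where r: "\<And>i. i \<in> I \<Longrightarrow> 0 < r i" "\<And>i. i \<in> I \<Longrightarrow> r i \<le> \<delta>"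
    and cover: "E \<subseteq> (\<Union>i\<in>I. ball (z i) (r i))"
    and sum: "(\<Sum>\<^sub>\<infinity>i\<in>(I::nat set). emeasure M (ball (z i) (r i)) / ennreal (r i)) < ennreal \<epsilon>'"
    unfolding codim1_content_def INF_less_iff by auto
  \<comment> \<open>Balls of the cover that miss \<open>E\<close> may lie anywhere and are
    discarded, so that the support stays near \<open>E\<close>.\<close>
  define J where "J = {i\<in>I. ball (z i) (r i) \<inter> E \<noteq> {}}"
  define w where "w i x = (if i \<in> J then max 0 (min 1 (2 - dist (z i) x / r i)) else 0)" for i x
  define g where "g i x = (if i \<in> J then ennreal (1 / r i) * indicator (cball (z i) (2 * r i)) x else 0)" for i x
  have w01: "0 \<le> w i x" "w i x \<le> 1" for i x by (auto simp: w_def)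
  have gb [measurable]: "g i \<in> borel_measurable borel" for i
  proof (cases "i \<in> J")
    case True
    then have "g i = (\<lambda>x. ennreal (1 / r i) * indicator (cball (z i) (2 * r i)) x)" by (auto simp: g_def)
    then show ?thesis
      by (simp only:) (intro borel_measurable_times_ennreal borel_measurable_const borel_measurable_indicator borel_closed closed_cball)
  next
    case False
    then have "g i = (\<lambda>x. 0)" by (auto simp: g_def)
    then show ?thesis by simp
  qed
  have wlip: "\<exists>L. L-lipschitz_on UNIV (w i)" and wu: "upper_gradient UNIV (\<lambda>x. ereal (w i x)) (g i)" for i
  proof -
    have "(\<exists>L. L-lipschitz_on UNIV (w i)) \<and> upper_gradient UNIV (\<lambda>x. ereal (w i x)) (g i)"
    proof (cases "i \<in> J")
      case True
      then have ri: "0 < r i" using r(1) by (auto simp: J_def)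
      have lip: "(1 / r i)-lipschitz_on UNIV (\<lambda>x. 2 - dist (z i) x / r i)"
      proof (rule lipschitz_onI)
        fix x y
        have "\<bar>dist (z i) y - dist (z i) x\<bar> \<le> dist x y"
          using abs_dist_diff_le[of y "z i" x] by (simp add: dist_commute)
        then have "\<bar>(dist (z i) y - dist (z i) x) / r i\<bar> \<le> dist x y / r i"
          using ri by (simp add: divide_right_mono)
        then show "dist (2 - dist (z i) x / r i) (2 - dist (z i) y / r i) \<le> 1 / r i * dist x y"
          by (simp add: dist_real_def diff_divide_distrib)
      qed (use ri in simp)
      have weq: "w i = (\<lambda>x. max 0 (min 1 (2 - dist (z i) x / r i)))" using True by (auto simp: w_def)
      have "upper_gradient UNIV (\<lambda>x. ereal (w i x)) (g i)"
        unfolding weq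
      proof (rule upper_gradient_clamp[OF upper_gradient_lipschitz[OF lip] lipschitz_on_continuous_on[OF lip]])
        fix x assume "0 \<le> 2 - dist (z i) x / r i"
        then have "dist (z i) x \<le> 2 * r i" using ri by (simp add: divide_le_eq)
        then show "ennreal (1 / r i) \<le> g i x" using True by (simp add: g_def)
      qed (use measurable_restrict_space1[OF gb] in auto)
      moreover have "(1 / r i)-lipschitz_on UNIV (w i)"
      proof (rule lipschitz_onI)
        fix x y
        have "dist (w i x) (w i y) \<le> dist (2 - dist (z i) x / r i) (2 - dist (z i) y / r i)"
          unfolding weq dist_real_def by (auto simp: max_def min_def)
        then show "dist (w i x) (w i y) \<le> 1 / r i * dist x y"
          using lipschitz_onD[OF lip, of x y] by simp
      qed (use ri in simp)
      ultimately show ?thesis by blast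
    next
      case False
      then have eq: "w i = (\<lambda>x. 0)" "g i = (\<lambda>x. ennreal 0)" by (auto simp: w_def g_def)
      have lip: "0-lipschitz_on UNIV (\<lambda>x::'a. 0::real)" by (auto simp: lipschitz_on_def)
      then have "\<exists>L. L-lipschitz_on UNIV (\<lambda>x::'a. 0::real)" ..
      then show ?thesis unfolding eq using upper_gradient_lipschitz[OF lip] by (rule conjI)
    qed
    then show "\<exists>L. L-lipschitz_on UNIV (w i)" "upper_gradient UNIV (\<lambda>x. ereal (w i x)) (g i)" by auto
  qed
  define G where "G x = (\<Sum>i. g i x)" for x
  have gG: "g i x \<le> G x" for i x
    unfolding G_def using sum_le_suminf[of "\<lambda>i. g i x" "{i}"] by simp
  have Gb: "G \<in> borel_measurable borel" unfolding G_def by measurable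
  have Gr: "G \<in> borel_measurable (restrict_space borel UNIV)" using Gb by (intro measurable_restrict_space1)
  define v where "v = partial_max w"
  have v01: "0 \<le> v n x" "v n x \<le> 1" for n x
    unfolding v_def using w01 by (auto intro: partial_max_nonneg partial_max_le)
  have vmono: "v n x \<le> v (Suc n) x" for n x unfolding v_def by (rule partial_max_mono)
  have vlip: "\<exists>L. L-lipschitz_on UNIV (v n)" for n
  proof (induction n)
    case 0
    have "0-lipschitz_on UNIV (v 0)" by (auto simp: v_def lipschitz_on_def)
    then show ?case ..
  next
    case (Suc n)
    then show ?case using lipschitz_on_max[of _ UNIV "v n" _ "w n"] wlip[of n] by (fastforce simp: v_def)
  qed
  have vu: "upper_gradient UNIV (\<lambda>x. ereal (v n x)) G" for n
  proof (induction n)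
    case 0
    have "0-lipschitz_on UNIV (\<lambda>x::'a. 0::real)" by (auto simp: lipschitz_on_def)
    from upper_gradient_mono[OF upper_gradient_lipschitz[OF this] Gr] show ?case by (simp add: v_def)
  next
    case (Suc n)
    from upper_gradient_max[OF this upper_gradient_mono[OF wu[of n] Gr gG]] show ?case by (simp add: v_def)
  qed
  define u where "u x = (SUP n. v n x)" for x
  have bdd: "bdd_above (range (\<lambda>n. v n x))" for x using v01 by (intro bdd_aboveI2[of _ _ 1]) auto
  have lim: "(\<lambda>n. v n x) \<longlonglongrightarrow> u x" for x
    unfolding u_def by (intro LIMSEQ_incseq_SUP bdd incseq_SucI vmono)
  have vule: "v n x \<le> u x" for n x unfolding u_def by (rule cSUP_upper[OF UNIV_I bdd])
  have u01: "0 \<le> u x" "u x \<le> 1" for x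
    using vule[of 0 x] v01[of 0 x] unfolding u_def by (auto intro!: cSUP_least v01)
  have [measurable]: "v n \<in> borel_measurable M" for n
    using vlip[of n] by (auto intro: continuous_M lipschitz_on_continuous_on)
  have um [measurable]: "u \<in> borel_measurable M" by (rule borel_measurable_LIMSEQ_real[OF lim]) measurable
  have uu: "upper_gradient UNIV (\<lambda>x. ereal (u x)) G" by (rule upper_gradient_limit[OF vu lim])
  \<comment> \<open>Where a bump does not vanish, its gradient is \<open>1 / r i\<close>, which is
    at least 1.\<close>
  have uG: "ennreal (u x) \<le> G x" for x
  proof -
    have "ennreal (w i x) \<le> G x" for i
    proof (cases "i \<in> J \<and> x \<in> cball (z i) (2 * r i)")
      case True
      then have "0 < r i" "r i \<le> 1" using r \<delta>(2) by (auto simp: J_def intro: order_trans)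
      then have "1 \<le> 1 / r i" by simp
      then have "ennreal (w i x) \<le> ennreal (1 / r i)" using w01(2)[of i x] by (intro ennreal_leI) linarith
      also have "\<dots> = g i x" using True by (simp add: g_def)
      also have "\<dots> \<le> G x" by (rule gG)
      finally show ?thesis .
    next
      case False
      have "w i x = 0"
      proof (cases "i \<in> J")
        case True
        then have "0 < r i" "2 * r i < dist (z i) x" using False r(1) by (auto simp: J_def)
        then have "2 \<le> dist (z i) x / r i" by (simp add: le_divide_eq)
        then show ?thesis by (simp add: w_def)
      qed (simp add: w_def)
      then show ?thesis by simp
    qed
    then have vG: "ennreal (v n x) \<le> G x" for n unfolding v_def by (induction n) (auto simp: max_def)
    have "(\<lambda>n. ennreal (v n x)) \<longlonglongrightarrow> ennreal (u x)" by (intro tendsto_ennrealI lim)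
    then show ?thesis by (rule LIMSEQ_le_const2) (use vG in auto)
  qed
  have GM [measurable]: "G \<in> borel_measurable M" by (rule borel_measurable_M[OF Gb])
  have Gint: "(\<integral>\<^sup>+x. G x \<partial>M) \<le> ennreal (CD ^ 2 * \<epsilon>')"
  proof -
    let ?f = "\<lambda>i. emeasure M (ball (z i) (r i)) / ennreal (r i)"
    have "(\<integral>\<^sup>+x. G x \<partial>M) = (\<Sum>i. \<integral>\<^sup>+x. g i x \<partial>M)"
      unfolding G_def by (rule nn_integral_suminf) (rule borel_measurable_M[OF gb])
    also have "\<dots> \<le> (\<Sum>i. ennreal (CD ^ 2) * (if i \<in> J then ?f i else 0))"
    proof (rule suminf_le)
      fix i
      show "(\<integral>\<^sup>+x. g i x \<partial>M) \<le> ennreal (CD ^ 2) * (if i \<in> J then ?f i else 0)"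
      proof (cases "i \<in> J")
        case True
        then have ri: "0 < r i" using r(1) by (auto simp: J_def)
        have "(\<integral>\<^sup>+x. g i x \<partial>M) = (\<integral>\<^sup>+x. ennreal (1 / r i) * indicator (cball (z i) (2 * r i)) x \<partial>M)"
          using True by (simp add: g_def)
        also have "\<dots> = ennreal (1 / r i) * emeasure M (cball (z i) (2 * r i))"
          by (rule nn_integral_cmult_indicator) simp
        also have "\<dots> \<le> ennreal (1 / r i) * emeasure M (ball (z i) (2 ^ 2 * r i))"
          using ri by (intro mult_left_mono emeasure_mono) auto
        also have "\<dots> \<le> ennreal (1 / r i) * ennreal (CD ^ 2 * measure M (ball (z i) (r i)))"
          unfolding ball_real using ri by (intro mult_left_mono ennreal_leI measure_ball_pow) auto
        also have "\<dots> = ennreal (CD ^ 2) * ?f i"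
          unfolding ball_real using ri CD by (simp add: divide_ennreal flip: ennreal_mult)
        finally show ?thesis using True by simp
      qed (simp add: g_def)
    qed auto
    also have "\<dots> = ennreal (CD ^ 2) * (\<Sum>i. if i \<in> J then ?f i else 0)" by simp
    also have "(\<Sum>i. if i \<in> J then ?f i else 0) \<le> ennreal \<epsilon>'"
    proof (rule suminf_le_const)
      fix n
      have "(\<Sum>i<n. if i \<in> J then ?f i else 0) = (\<Sum>i\<in>{..<n} \<inter> J. ?f i)"
        by (simp add: sum.inter_restrict)
      also have "\<dots> \<le> (\<Sum>\<^sub>\<infinity>i\<in>I. ?f i)"
        by (subst nonneg_infsum_complete) (auto simp: J_def intro!: SUP_upper)
      also have "\<dots> \<le> ennreal \<epsilon>'" using sum by (rule less_imp_le)
      finally show "(\<Sum>i<n. if i \<in> J then ?f i else 0) \<le> ennreal \<epsilon>'" .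
    qed simp
    finally show ?thesis using CD \<epsilon>' by (simp add: ennreal_mult mult_left_mono)
  qed
  have "(\<integral>\<^sup>+x. (ennreal (u x) + G x) \<partial>M) \<le> (\<integral>\<^sup>+x. G x + G x \<partial>M)" by (intro nn_integral_mono add_right_mono uG)
  also have "\<dots> = (\<integral>\<^sup>+x. G x \<partial>M) + (\<integral>\<^sup>+x. G x \<partial>M)" by (rule nn_integral_add) measurable
  also have "\<dots> \<le> ennreal (CD ^ 2 * \<epsilon>') + ennreal (CD ^ 2 * \<epsilon>')" by (intro add_mono Gint)
  also have "\<dots> = ennreal (2 * (CD ^ 2 * \<epsilon>'))" using \<epsilon>'(1) CD by (simp flip: ennreal_plus)
  also have "\<dots> = ennreal \<epsilon>" by (simp only: \<epsilon>'(2))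
  finally have int: "(\<integral>\<^sup>+x. (ennreal (u x) + G x) \<partial>M) \<le> ennreal \<epsilon>" .
  have supp: "x \<in> cball x0 (3 / 2 * R)" if "u x \<noteq> 0" for x
  proof -
    have "\<exists>i. w i x \<noteq> 0"
    proof (rule ccontr)
      assume "\<not> ?thesis"
      then have "v n x = 0" for n unfolding v_def by (induction n) auto
      then show False using that by (simp add: u_def)
    qed
    then obtain i where i: "w i x \<noteq> 0" by blast
    then have iJ: "i \<in> J" by (auto simp: w_def split: if_splits)
    then have "i \<in> I" by (simp add: J_def)
    then have ri: "0 < r i" "r i \<le> R / 8" using r(1)[of i] order_trans[OF r(2)[of i] \<delta>(3)] by auto
    have "dist (z i) x / r i < 2" using i iJ by (auto simp: w_def max_def min_def split: if_splits)
    then have 1: "dist (z i) x < 2 * r i" using ri by (simp add: divide_less_eq)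
    obtain q where "q \<in> ball (z i) (r i)" "q \<in> E" using iJ by (auto simp: J_def)
    then have "dist x0 q < R" "dist (z i) q < r i" using E by auto
    then have "dist x0 x \<le> R + r i + 2 * r i"
      using 1 dist_triangle[of x0 x "z i"] dist_triangle2[of x0 "z i" q] by (simp add: dist_commute)
    then show ?thesis using ri(2) R by simp
  qed
  define U where "U = (\<Union>i\<in>J. ball (z i) (r i))"
  have U: "open U" by (auto simp: U_def)
  have EU: "E \<subseteq> U"
  proof
    fix x assume x: "x \<in> E"
    then obtain i where i: "i \<in> I" "x \<in> ball (z i) (r i)" using cover by blast
    then have "i \<in> J" using x unfolding J_def by blast
    then show "x \<in> U" using i(2) unfolding U_def by blast
  qed
  have uU: "u x = 1" if xU: "x \<in> U" for x
  proof -
    obtain i where i: "i \<in> J" "dist (z i) x < r i" using xU by (auto simp: U_def)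
    then have "0 < r i" using r(1) by (auto simp: J_def)
    then have "dist (z i) x / r i \<le> 1" using i by (simp add: divide_le_eq)
    then have "w i x = 1" using i by (simp add: w_def)
    then have "1 \<le> v (Suc i) x" by (simp add: v_def)
    then show ?thesis using vule[of "Suc i" x] u01(2)[of x] by linarith
  qed
  have U2: "U \<subseteq> ball x0 (2 * R)"
  proof
    fix x assume "x \<in> U"
    then have "x \<in> cball x0 (3 / 2 * R)" using uU by (intro supp) simp
    then show "x \<in> ball x0 (2 * R)" using R by simp
  qed
  have conv: "L1_loc_tendsto M UNIV v (\<lambda>x. ereal (u x))"
    by (rule L1_loc_tendsto_bounded[OF lim]) (use v01 in auto)
  have "small_bump E x0 R \<epsilon> u G"
    unfolding small_bump_def
  proof (intro conjI)
    show "\<forall>x. 0 \<le> u x" using u01 by simp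
    show "\<forall>x. u x \<noteq> 0 \<longrightarrow> x \<in> cball x0 (3 / 2 * R)" using supp by (intro allI impI)
    show "\<exists>U. open U \<and> E \<subseteq> U \<and> U \<subseteq> ball x0 (2 * R) \<and> (\<forall>x\<in>U. u x = 1)"
      by (intro exI[of _ U] conjI ballI U EU U2 uU)
    show "\<exists>v. (\<forall>n. (\<exists>L. L-lipschitz_on UNIV (v n)) \<and> upper_gradient UNIV (\<lambda>x. ereal (v n x)) G) \<and>
        L1_loc_tendsto M UNIV v (\<lambda>x. ereal (u x))"
      by (intro exI[of _ v] conjI allI vlip vu conv)
  qed (rule um uu int)+
  then show ?thesis by (rule that)
qed

lemma L1_loc_tendsto_subset:
  assumes "L1_loc_tendsto M UNIV v u" "open \<Omega>"
  shows "L1_loc_tendsto M \<Omega> v u"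
  unfolding L1_loc_tendsto_def
proof
  fix x assume x: "x \<in> \<Omega>"
  let ?I = "\<lambda>r i. \<integral>\<^sup>+y\<in>ball x r. e2ennreal \<bar>ereal (v i y) - u y\<bar> \<partial>M"
  obtain r where r: "0 < r" "?I r \<longlonglongrightarrow> 0" using assms(1) by (auto simp: L1_loc_tendsto_def)
  obtain r' where r': "0 < r'" "ball x r' \<subseteq> \<Omega>" using assms(2) x by (meson open_contains_ball)
  have "?I (min r r') \<longlonglongrightarrow> 0"
  proof (rule tendsto_sandwich[OF _ _ tendsto_const r(2)])
    show "eventually (\<lambda>i. ?I (min r r') i \<le> ?I r i) sequentially"
      by (intro always_eventually allI nn_integral_mono mult_left_mono) (auto simp: indicator_def)
  qed simp
  moreover have "ball x (min r r') \<subseteq> \<Omega>" using r'(2) by auto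
  ultimately show "\<exists>r>0. ball x r \<subseteq> \<Omega> \<and> ?I r \<longlonglongrightarrow> 0"
    using r(1) r'(1) by (intro exI[of _ "min r r'"]) simp
qed

text \<open>Applied with \<Omega> equal to \<open>UNIV\<close> for the total capacities and to
  \<open>ball x0 (2 * R)\<close> for the relative ones.\<close>

lemma small_bump_admissible:
  assumes b: "small_bump E x0 R \<epsilon> u g" and \<Omega>: "open \<Omega>" and R: "0 < R"
  shows "upper_gradient \<Omega> (\<lambda>x. ereal (u x)) g" "N11 M \<Omega> (\<lambda>x. ereal (u x))" "BV M \<Omega> (\<lambda>x. ereal (u x))"
    "(\<integral>\<^sup>+x\<in>\<Omega>. (e2ennreal \<bar>ereal (u x)\<bar> + g x) \<partial>M) \<le> ennreal \<epsilon>"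
    "(\<integral>\<^sup>+x\<in>\<Omega>. e2ennreal \<bar>ereal (u x)\<bar> \<partial>M) + total_variation M \<Omega> (\<lambda>x. ereal (u x)) \<le> ennreal \<epsilon>"
    "ball x0 (2 * R) \<subseteq> \<Omega> \<Longrightarrow> one_near E \<Omega> (\<lambda>x. ereal (u x))"
    "compact_support_in (ball x0 (2 * R)) (\<lambda>x. ereal (u x))"
    "\<forall>x\<in>E. ereal (u x) = 1"
proof -
  have um [measurable]: "u \<in> borel_measurable M" and u0: "0 \<le> u x" and supp: "u x \<noteq> 0 \<Longrightarrow> x \<in> cball x0 (3 / 2 * R)"
    and uu: "upper_gradient UNIV (\<lambda>x. ereal (u x)) g" and int: "(\<integral>\<^sup>+x. (ennreal (u x) + g x) \<partial>M) \<le> ennreal \<epsilon>" for x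
    using b by (auto simp: small_bump_def)
  obtain U where U: "open U" "E \<subseteq> U" "U \<subseteq> ball x0 (2 * R)" "\<And>x. x \<in> U \<Longrightarrow> u x = 1"
    using b by (auto simp: small_bump_def)
  obtain v where v: "\<And>n::nat. \<exists>L. L-lipschitz_on UNIV (v n)" "\<And>n. upper_gradient UNIV (\<lambda>x. ereal (v n x)) g"
    "L1_loc_tendsto M UNIV v (\<lambda>x. ereal (u x))"
    using b unfolding small_bump_def by blast
  have eu: "e2ennreal \<bar>ereal (u x)\<bar> = ennreal (u x)" for x using u0[of x] by simp
  have gm [measurable]: "g \<in> borel_measurable M"
    using upper_gradient_measurable[OF uu] borel_measurable_restrict_space_iff_ennreal[of UNIV borel g]
    by (intro borel_measurable_M) simp
  have [measurable]: "\<Omega> \<in> sets M" using \<Omega> by auto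
  show ug: "upper_gradient \<Omega> (\<lambda>x. ereal (u x)) g" by (rule upper_gradient_mono_set[OF uu subset_UNIV])
  have int\<Omega>: "(\<integral>\<^sup>+x\<in>\<Omega>. ennreal (u x) \<partial>M) + (\<integral>\<^sup>+x\<in>\<Omega>. g x \<partial>M) \<le> ennreal \<epsilon>"
  proof -
    have "(\<integral>\<^sup>+x\<in>\<Omega>. ennreal (u x) \<partial>M) + (\<integral>\<^sup>+x\<in>\<Omega>. g x \<partial>M) = (\<integral>\<^sup>+x. ennreal (u x) * indicator \<Omega> x + g x * indicator \<Omega> x \<partial>M)"
      by (rule nn_integral_add[symmetric]) measurable
    also have "\<dots> \<le> (\<integral>\<^sup>+x. (ennreal (u x) + g x) \<partial>M)"
      by (intro nn_integral_mono) (auto simp: indicator_def)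
    finally show ?thesis using int by (rule order_trans)
  qed
  show "(\<integral>\<^sup>+x\<in>\<Omega>. (e2ennreal \<bar>ereal (u x)\<bar> + g x) \<partial>M) \<le> ennreal \<epsilon>"
  proof -
    have "(\<integral>\<^sup>+x\<in>\<Omega>. (e2ennreal \<bar>ereal (u x)\<bar> + g x) \<partial>M) \<le> (\<integral>\<^sup>+x. (ennreal (u x) + g x) \<partial>M)"
      unfolding eu by (intro nn_integral_mono) (auto simp: indicator_def)
    then show ?thesis using int by (rule order_trans)
  qed
  have L1: "L1_on M \<Omega> (\<lambda>x. ereal (u x))"
    unfolding L1_on_def eu
  proof
    show "(\<lambda>x. ereal (u x)) \<in> borel_measurable (restrict_space M \<Omega>)"
      by (intro measurable_restrict_space1) measurable
    have "(\<integral>\<^sup>+x\<in>\<Omega>. ennreal (u x) \<partial>M) \<le> ennreal \<epsilon>" by (rule order_trans[OF _ int\<Omega>]) simp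
    then show "(\<integral>\<^sup>+x\<in>\<Omega>. ennreal (u x) \<partial>M) < \<infinity>" by (auto intro: le_less_trans)
  qed
  show "N11 M \<Omega> (\<lambda>x. ereal (u x))"
  proof -
    have "N11_norm M \<Omega> (\<lambda>x. ereal (u x)) \<le> (\<integral>\<^sup>+x\<in>\<Omega>. ennreal (u x) \<partial>M) + (\<integral>\<^sup>+x\<in>\<Omega>. g x \<partial>M)"
      unfolding N11_norm_def eu
      using upper_gradient_imp_weak[OF ug borel_M] by (intro add_left_mono INF_lower) simp
    also have "\<dots> \<le> ennreal \<epsilon>" by (rule int\<Omega>)
    also have "\<dots> < \<infinity>" by simp
    finally show ?thesis using L1 by (simp add: N11_def)
  qed
  have TV: "total_variation M \<Omega> (\<lambda>x. ereal (u x)) \<le> (\<integral>\<^sup>+x\<in>\<Omega>. g x \<partial>M)"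
  proof -
    have "locally_lipschitz_on \<Omega> (v n)" for n
      unfolding locally_lipschitz_on_def
    proof
      fix x assume "x \<in> \<Omega>"
      then obtain r where "0 < r" "ball x r \<subseteq> \<Omega>" using \<Omega> by (meson open_contains_ball)
      then show "\<exists>r>0. ball x r \<subseteq> \<Omega> \<and> (\<exists>L. L-lipschitz_on (ball x r) (v n))"
        using v(1)[of n] lipschitz_on_subset[OF _ subset_UNIV] by blast
    qed
    then show ?thesis
      unfolding total_variation_def
      using upper_gradient_mono_set[OF v(2) subset_UNIV] L1_loc_tendsto_subset[OF v(3) \<Omega>]
      by (intro INF_lower2[of "(v, \<lambda>_. g)"]) (auto simp: Liminf_const)
  qed
  show tot: "(\<integral>\<^sup>+x\<in>\<Omega>. e2ennreal \<bar>ereal (u x)\<bar> \<partial>M) + total_variation M \<Omega> (\<lambda>x. ereal (u x)) \<le> ennreal \<epsilon>"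
    unfolding eu using TV int\<Omega> by (meson add_left_mono order_trans)
  show "BV M \<Omega> (\<lambda>x. ereal (u x))"
  proof -
    have "total_variation M \<Omega> (\<lambda>x. ereal (u x)) \<le> ennreal \<epsilon>" by (rule order_trans[OF _ tot]) simp
    then show ?thesis using L1 by (auto simp: BV_def intro: le_less_trans)
  qed
  show "ball x0 (2 * R) \<subseteq> \<Omega> \<Longrightarrow> one_near E \<Omega> (\<lambda>x. ereal (u x))"
    unfolding one_near_def using U by (intro exI[of _ U]) (auto simp: one_ereal_def)
  show "\<forall>x\<in>E. ereal (u x) = 1" using U by (auto simp: one_ereal_def)
  have sub: "closure {x\<in>ball x0 (2 * R). ereal (u x) \<noteq> 0} \<subseteq> cball x0 (3 / 2 * R)"
  proof (rule closure_minimal)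
    show "{x\<in>ball x0 (2 * R). ereal (u x) \<noteq> 0} \<subseteq> cball x0 (3 / 2 * R)"
      using supp by (auto simp: zero_ereal_def simp del: mem_cball)
  qed simp
  moreover have "cball x0 (3 / 2 * R) \<subseteq> ball x0 (2 * R)" using R by auto
  moreover have "compact (closure {x\<in>ball x0 (2 * R). ereal (u x) \<noteq> 0})"
    by (rule compact_closed_bounded[OF closed_closure bounded_subset[OF bounded_cball sub]])
  ultimately show "compact_support_in (ball x0 (2 * R)) (\<lambda>x. ereal (u x))"
    unfolding compact_support_in_def by blast
qed

section \<open>The equivalences\<close>

lemma capacities_zero:
  assumes R: "0 < R" and E: "E \<subseteq> ball x0 R" and H: "codim1_hausdorff (emeasure M) E = 0"
  shows "Cap1 M E = 0" "Cap_BVO M E = 0" "rel_Cap1 M E (ball x0 (2 * R)) = 0" "rel_Cap_BVO M E (ball x0 (2 * R)) = 0"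
proof -
  let ?B = "ball x0 (2 * R)"
  have bounds: "Cap1 M E \<le> ennreal \<epsilon>" "Cap_BVO M E \<le> ennreal \<epsilon>" "rel_Cap1 M E ?B \<le> ennreal \<epsilon>" "rel_Cap_BVO M E ?B \<le> ennreal \<epsilon>"
    if \<epsilon>: "0 < \<epsilon>" for \<epsilon>
  proof -
    obtain u g where b: "small_bump E x0 R \<epsilon> u g" using small_bump_exists[OF R E H \<epsilon>] .
    note G = small_bump_admissible[OF b open_UNIV R] and B = small_bump_admissible[OF b open_ball R]
    show "Cap1 M E \<le> ennreal \<epsilon>"
      unfolding Cap1_def using G by (intro INF_lower2[of "((\<lambda>x. ereal (u x)), g)"]) auto
    show "Cap_BVO M E \<le> ennreal \<epsilon>"
      unfolding Cap_BVO_def using G by (intro INF_lower2[of "\<lambda>x. ereal (u x)"]) auto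
    show "rel_Cap1 M E ?B \<le> ennreal \<epsilon>"
      unfolding rel_Cap1_def using B(1,2,4)[of x0 "2 * R"] G(7,8) 
      by (intro INF_lower2[of "((\<lambda>x. ereal (u x)), g)"]) (auto simp del: ereal_eq_1)
    show "rel_Cap_BVO M E ?B \<le> ennreal \<epsilon>"
      unfolding rel_Cap_BVO_def using B(3,5,6)[of x0 "2 * R"] G(7) 
      by (intro INF_lower2[of "\<lambda>x. ereal (u x)"]) auto
  qed
  have zero: "c = 0" if "\<And>\<epsilon>. 0 < \<epsilon> \<Longrightarrow> c \<le> ennreal \<epsilon>" for c
  proof -
    have "c \<le> 0" by (rule ennreal_le_epsilon) (use that in simp)
    then show ?thesis by simp
  qed
  show "Cap1 M E = 0" "Cap_BVO M E = 0" "rel_Cap1 M E ?B = 0" "rel_Cap_BVO M E ?B = 0"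
    using bounds by (auto intro!: zero)
qed

lemma rel_cap1_le_rel_Cap1: "rel_cap1 M E \<Omega> \<le> rel_Cap1 M E \<Omega>"
  unfolding rel_cap1_def rel_Cap1_def
  by (rule INF_superset_mono) (auto intro!: nn_integral_mono mult_right_mono add_increasing)

lemma rel_cap_BVO_le_rel_Cap_BVO: "rel_cap_BVO M E \<Omega> \<le> rel_Cap_BVO M E \<Omega>"
  unfolding rel_cap_BVO_def rel_Cap_BVO_def by (rule INF_superset_mono) (auto intro: add_increasing)

end

theorem corollary5p3:
  fixes \<mu> :: "'a::complete_space set \<Rightarrow> ennreal"
    and x\<^sub>0 :: 'a and R :: real and E :: "'a set"
  defines "M \<equiv> caratheodory_measure \<mu>"
  assumes "borel_regular_outer_measure \<mu>"
    and "\<forall>x r. 0 < r \<longrightarrow> 0 < \<mu> (ball x r) \<and> \<mu> (ball x r) < \<infinity>"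
    and "doubling \<mu>"
    and "weak_11_poincare M"
    and "0 < R"
    and "- closure (ball x\<^sub>0 (2 * R)) \<noteq> {}"
    and "E \<subseteq> ball x\<^sub>0 R"
  shows "(Cap1 M E = 0 \<longleftrightarrow> Cap_BVO M E = 0) \<and>
         (Cap_BVO M E = 0 \<longleftrightarrow> rel_Cap1 M E (ball x\<^sub>0 (2 * R)) = 0) \<and>
         (rel_Cap1 M E (ball x\<^sub>0 (2 * R)) = 0 \<longleftrightarrow> rel_Cap_BVO M E (ball x\<^sub>0 (2 * R)) = 0) \<and>
         (rel_Cap_BVO M E (ball x\<^sub>0 (2 * R)) = 0 \<longleftrightarrow> rel_cap1 M E (ball x\<^sub>0 (2 * R)) = 0) \<and>
         (rel_cap1 M E (ball x\<^sub>0 (2 * R)) = 0 \<longleftrightarrow> rel_cap_BVO M E (ball x\<^sub>0 (2 * R)) = 0) \<and>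
         (rel_cap_BVO M E (ball x\<^sub>0 (2 * R)) = 0 \<longleftrightarrow> codim1_hausdorff \<mu> E = 0)"
proof -
  have om: "outer_measure_space (Pow UNIV) \<mu>" and bl: "sets borel \<subseteq> lambda_system UNIV (Pow UNIV) \<mu>"
    and hull: "\<And>A. \<exists>B\<in>sets borel. A \<subseteq> B \<and> \<mu> B = \<mu> A"
    using assms(2) by (auto simp: borel_regular_outer_measure_def)
  have sp: "space M = UNIV" and st: "sets M = lambda_system UNIV (Pow UNIV) \<mu>"
    and em: "\<And>A. A \<in> sets M \<Longrightarrow> emeasure M A = \<mu> A"
    unfolding M_def
    using space_caratheodory_measure[OF om] sets_caratheodory_measure[OF om] emeasure_caratheodory_measure[OF om] by auto
  have bM: "sets borel \<subseteq> sets M" using bl st by simp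
  have ballM: "emeasure M (ball x r) = \<mu> (ball x r)" for x r using bM by (intro em) auto
  obtain CD where CD: "\<And>x r. 0 < r \<Longrightarrow> \<mu> (ball x (2 * r)) \<le> ennreal CD * \<mu> (ball x r)"
    using assms(4) by (auto simp: doubling_def)
  obtain CP \<tau> where CP: "0 < CP" "1 \<le> \<tau>" and P: "\<And>x r u g. 0 < r \<Longrightarrow> L1_loc_on M UNIV u \<Longrightarrow> weak_upper_gradient M UNIV u g \<Longrightarrow>
      (\<integral>\<^sup>+y\<in>ball x r. e2ennreal \<bar>u y - ereal (mean_value M (ball x r) u)\<bar> \<partial>M) / emeasure M (ball x r)
        \<le> ennreal (CP * r) * ((\<integral>\<^sup>+y\<in>ball x (\<tau> * r). g y \<partial>M) / emeasure M (ball x (\<tau> * r)))"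
    using assms(5) unfolding weak_11_poincare_def by blast
  interpret poincare_space M CD CP \<tau>
  proof
    show "\<exists>B\<in>sets borel. A \<subseteq> B \<and> emeasure M B = emeasure M A" if A: "A \<in> sets M" for A
    proof -
      obtain B where "B \<in> sets borel" "A \<subseteq> B" "\<mu> B = \<mu> A" using hull by blast
      then show ?thesis using bM em A by (intro bexI[of _ B]) auto
    qed
    show "emeasure M (ball x r) < \<infinity>" for x r
      using assms(3) by (cases "0 < r") (auto simp: ballM ball_empty)
  qed (use sp bM assms(3) CD CP P in \<open>simp_all add: ballM\<close>)
  \<comment> \<open>The exterior of 2B is open, hence contains a whole ball; it serves as the part
    of the large ball that \<open>A\<close> cannot reach in
    \<open>measure_le_perimeter\<close>.\<close>
  have "open (- closure (ball x\<^sub>0 (2 * R)))" by (simp add: open_Compl)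
  then obtain y s where s: "0 < s" "ball y s \<subseteq> - closure (ball x\<^sub>0 (2 * R))"
    using assms(7) by (meson all_not_in_conv open_contains_ball)
  have disj: "ball y s \<inter> ball x\<^sub>0 (2 * R) = {}" using s(2) closure_subset[of "ball x\<^sub>0 (2 * R)"] by blast
  \<comment> \<open>The content evaluates the outer measure only on balls, where it agrees with
    \<open>M\<close>.\<close>
  have H: "codim1_hausdorff \<mu> E = codim1_hausdorff (emeasure M) E"
    unfolding codim1_hausdorff_def codim1_content_def by (simp only: ballM)
  note zero = capacities_zero[OF assms(6,8)]
  have zero': "rel_cap1 M E (ball x\<^sub>0 (2 * R)) = 0" if "rel_Cap1 M E (ball x\<^sub>0 (2 * R)) = 0"
    using rel_cap1_le_rel_Cap1[of E "ball x\<^sub>0 (2 * R)"] that by simp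
  have zero'': "rel_cap_BVO M E (ball x\<^sub>0 (2 * R)) = 0" if "rel_Cap_BVO M E (ball x\<^sub>0 (2 * R)) = 0"
    using rel_cap_BVO_le_rel_Cap_BVO[of E "ball x\<^sub>0 (2 * R)"] that by simp
  \<comment> \<open>Vanishing Hausdorff measure makes the total capacities and the relative ones
    with L1 term vanish. The latter dominate the relative capacities without it, and those, like the
    total ones, lead back to the Hausdorff measure.\<close>
  show ?thesis
    unfolding H
    using zero zero' zero'' Cap1_zero[OF s(1) disj assms(6,8)] Cap_BVO_zero[OF assms(8)]
      rel_cap1_zero[OF s(1) disj assms(6,8)] rel_cap_BVO_zero[OF s(1) disj assms(6,8)]
    by blast
qed

end
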